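(* Let $N\ge5$. For $0\le\lambda\le\left(\frac{N-1}{2}\right)^2$ put $\gamma_N(\lambda):=\sqrt{(N-1)^2-4\lambda}$, $h_N(\lambda):=\frac{\gamma_N(\lambda)+1}{2}$ and $\Psi_\lambda(r):=r^{-\frac{N-2}{2}}\left(\frac{\sinh r}{r}\right)^{-\frac{N-1+\gamma_N(\lambda)}{2}}$ for $r>0$. Then for all $0\le\lambda\le\left(\frac{N-1}{2}\right)^2$ and all $u\in C_c^\infty(\mathbb{H}^N\setminus\{x_0\})$, $$\begin{aligned}\int_{\mathbb{H}^N}|\Delta_{\mathbb{H}^N}u|^2\,dv_{\mathbb{H}^N}\ge{}&\lambda\int_{\mathbb{H}^N}|\nabla_{\mathbb{H}^N}u|^2\,dv_{\mathbb{H}^N}+h_N^2(\lambda)\int_{\mathbb{H}^N}\frac{|\nabla_{\mathbb{H}^N}u|^2}{r^2}\,dv_{\mathbb{H}^N}\\&+\left[\left(\frac N2\right)^2-h_N^2(\lambda)\right]\int_{\mathbb{H}^N}\frac{|\nabla_{\mathbb{H}^N}u|^2}{\sinh^2 r}\,dv_{\mathbb{H}^N}\\&+\gamma_N(\lambda)h_N(\lambda)\int_{\mathbb{H}^N}\frac{r\coth r-1}{r^2}|\nabla_{\mathbb{H}^N}u|^2\,dv_{\mathbb{H}^N}\\&+\int_{\mathbb{H}^N}(\Psi_\lambda(r))^2\left|\nabla_{\mathbb{H}^N}\left(\frac{u_r}{\Psi_\lambda(r)}\right)\right|^2dv_{\mathbb{H}^N}.\end{aligned}$$ Furthermore, for any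 given such $\lambda$, the constants $h_N^2(\lambda)$ and $\left(\frac N2\right)^2-h_N^2(\lambda)$ are jointly sharp in the following sense: with $h_N^2(\lambda)$ kept fixed, for every constant $C>\left(\frac N2\right)^2-h_N^2(\lambda)$ the inequality $$\begin{aligned}\int_{\mathbb{H}^N}|\Delta_{\mathbb{H}^N}u|^2\,dv_{\mathbb{H}^N}\ge{}&\lambda\int_{\mathbb{H}^N}|\nabla_{\mathbb{H}^N}u|^2\,dv_{\mathbb{H}^N}+h_N^2(\lambda)\int_{\mathbb{H}^N}\frac{|\nabla_{\mathbb{H}^N}u|^2}{r^2}\,dv_{\mathbb{H}^N}+C\int_{\mathbb{H}^N}\frac{|\nabla_{\mathbb{H}^N}u|^2}{\sinh^2 r}\,dv_{\mathbb{H}^N}\\&+\gamma_N(\lambda)h_N(\lambda)\int_{\mathbb{H}^N}\frac{r\coth r-1}{r^2}|\nabla_{\mathbb{H}^N}u|^2\,dv_{\mathbb{H}^N}\end{aligned}$$ fails for some $u\in C_c^\infty(\mathbb{H}^N\setminus\{x_0\})$.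
   Context: $\mathbb{H}^N$ is the $N$-dimensional hyperbolic space (constant curvature $-1$) with Riemannian volume $dv_{\mathbb{H}^N}$, Laplace-Beltrami operator $\Delta_{\mathbb{H}^N}$ and Riemannian gradient $\nabla_{\mathbb{H}^N}$; $x_0\in\mathbb{H}^N$ is a fixed pole, $r=d(x,x_0)$ is the geodesic distance, and $(r,\Theta)\in(0,\infty)\times\mathbb{S}^{N-1}$ are polar coordinates about $x_0$, in which $dv_{\mathbb{H}^N}=(\sinh r)^{N-1}\,dr\,d\Theta$ and $|\nabla_{\mathbb{H}^N}u|^2=u_r^2+\frac{1}{\sinh^2 r}|\nabla_{\mathbb{S}^{N-1}}u|^2$. Functions are real-valued and $u_r=\frac{\partial u}{\partial r}$. *)

theory Defs
  imports "HOL-Analysis.Analysis"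
begin

section \<open>Smooth functions\<close>

definition pd :: "'n \<Rightarrow> (real^'n \<Rightarrow> real) \<Rightarrow> real^'n \<Rightarrow> real" where
  "pd i f x = frechet_derivative f (at x) (axis i 1)"

primrec Ck :: "nat \<Rightarrow> (real^'n \<Rightarrow> real) \<Rightarrow> bool" where
  "Ck 0 f \<longleftrightarrow> continuous_on UNIV f"
| "Ck (Suc k) f \<longleftrightarrow> f differentiable_on UNIV \<and> (\<forall>i. Ck k (pd i f))"

definition smooth :: "(real^'n \<Rightarrow> real) \<Rightarrow> bool" where
  "smooth f \<longleftrightarrow> (\<forall>k. Ck k f)"

text \<open>The functions of class $C_c^\infty$ on the complement of \<open>p\<close>, extended by zero to \<open>p\<close>.\<close>

definition test_functions :: "real^'n \<Rightarrow> (real^'n \<Rightarrow> real) set" where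
  "test_functions p =
     {u. smooth u \<and> compact (closure {x. u x \<noteq> 0}) \<and> p \<notin> closure {x. u x \<noteq> 0}}"

section \<open>Riemannian operators in a global chart\<close>

text \<open>A Riemannian metric on a manifold with one global chart is given by its Gram matrix
  \<open>G x\<close> with respect to the coordinate frame.\<close>

definition riem_grad :: "(real^'n \<Rightarrow> real^'n^'n) \<Rightarrow> (real^'n \<Rightarrow> real) \<Rightarrow> real^'n \<Rightarrow> real^'n" where
  "riem_grad G f x = matrix_inv (G x) *v (\<chi> i. pd i f x)"

definition riem_norm2 :: "(real^'n \<Rightarrow> real^'n^'n) \<Rightarrow> real^'n \<Rightarrow> real^'n \<Rightarrow> real" where
  "riem_norm2 G x v = v \<bullet> (G x *v v)"

definition riem_div :: "(real^'n \<Rightarrow> real^'n^'n) \<Rightarrow> (real^'n \<Rightarrow> real^'n) \<Rightarrow> real^'n \<Rightarrow> real" where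
  "riem_div G X x = (\<Sum>i\<in>UNIV. pd i (\<lambda>y. sqrt (det (G y)) * X y $ i) x) / sqrt (det (G x))"

definition laplace_beltrami :: "(real^'n \<Rightarrow> real^'n^'n) \<Rightarrow> (real^'n \<Rightarrow> real) \<Rightarrow> real^'n \<Rightarrow> real" where
  "laplace_beltrami G f = riem_div G (riem_grad G f)"

definition riem_volume :: "(real^'n \<Rightarrow> real^'n^'n) \<Rightarrow> (real^'n) measure" where
  "riem_volume G = density lborel (\<lambda>x. ennreal (sqrt (det (G x))))"

section \<open>Hyperbolic space\<close>

text \<open>Hyperbolic space is the upper sheet of the hyperboloid \<open>lorentz X X = - 1\<close> in Minkowski space
  \<open>real \<times> (real^'n)\<close>, with the metric induced by the Lorentz form. The projection \<open>snd\<close> to the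
  spatial part, with inverse \<open>hyperboloid\<close>, is a global chart, so a point of hyperbolic space is
  represented by a vector in \<open>real^'n\<close>.\<close>

definition lorentz :: "real \<times> (real^'n) \<Rightarrow> real \<times> (real^'n) \<Rightarrow> real" where
  "lorentz X Y = snd X \<bullet> snd Y - fst X * fst Y"

definition hyperboloid :: "real^'n \<Rightarrow> real \<times> (real^'n)" where
  "hyperboloid y = (sqrt (1 + y \<bullet> y), y)"

definition hyp_metric :: "real^'n \<Rightarrow> real^'n^'n" where
  "hyp_metric y = (\<chi> i j. lorentz (frechet_derivative hyperboloid (at y) (axis i 1))
                                  (frechet_derivative hyperboloid (at y) (axis j 1)))"

text \<open>The geodesic distance: along a geodesic \<open>\<gamma>\<close> of unit speed,
  \<open>lorentz (\<gamma> 0) (\<gamma> t) = - cosh t\<close>.\<close>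

definition hyp_dist :: "real^'n \<Rightarrow> real^'n \<Rightarrow> real" where
  "hyp_dist x y = arcosh (- lorentz (hyperboloid x) (hyperboloid y))"

abbreviation hyp_vol :: "(real^'n) measure" where
  "hyp_vol \<equiv> riem_volume hyp_metric"

abbreviation hyp_laplacian :: "(real^'n \<Rightarrow> real) \<Rightarrow> real^'n \<Rightarrow> real" where
  "hyp_laplacian \<equiv> laplace_beltrami hyp_metric"

definition hyp_grad2 :: "(real^'n \<Rightarrow> real) \<Rightarrow> real^'n \<Rightarrow> real" where
  "hyp_grad2 f x = riem_norm2 hyp_metric x (riem_grad hyp_metric f x)"

text \<open>Geodesic polar coordinates about the pole \<open>p\<close>. The unit-speed geodesic issuing from \<open>p\<close> with
  initial velocity \<open>V\<close>, a unit tangent vector in Minkowski space, is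
  \<open>t \<mapsto> cosh t *\<^sub>R hyperboloid p + sinh t *\<^sub>R V\<close>.
  For \<open>x \<noteq> p\<close>, \<open>polar_angle p x\<close> is the direction \<open>V\<close> whose geodesic reaches \<open>x\<close> at time
  \<open>hyp_dist x p\<close>.\<close>

definition polar_point :: "real^'n \<Rightarrow> real \<Rightarrow> real \<times> (real^'n) \<Rightarrow> real^'n" where
  "polar_point p t V = snd (cosh t *\<^sub>R hyperboloid p + sinh t *\<^sub>R V)"

definition polar_angle :: "real^'n \<Rightarrow> real^'n \<Rightarrow> real \<times> (real^'n)" where
  "polar_angle p x =
     (hyperboloid x - cosh (hyp_dist x p) *\<^sub>R hyperboloid p) /\<^sub>R sinh (hyp_dist x p)"

definition radial_deriv :: "real^'n \<Rightarrow> (real^'n \<Rightarrow> real) \<Rightarrow> real^'n \<Rightarrow> real" where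
  "radial_deriv p u x = deriv (\<lambda>t. u (polar_point p t (polar_angle p x))) (hyp_dist x p)"

section \<open>Parameters\<close>

definition gammaN :: "nat \<Rightarrow> real \<Rightarrow> real" where
  "gammaN N l = sqrt ((real N - 1)\<^sup>2 - 4 * l)"

definition hN :: "nat \<Rightarrow> real \<Rightarrow> real" where
  "hN N l = (gammaN N l + 1) / 2"

definition Psi :: "nat \<Rightarrow> real \<Rightarrow> real \<Rightarrow> real" where
  "Psi N l r = r powr (- ((real N - 2) / 2))
               * (sinh r / r) powr (- ((real N - 1 + gammaN N l) / 2))"

definition coth :: "real \<Rightarrow> real" where
  "coth r = cosh r / sinh r"

end

(* A Lorentz boost moves the pole to the origin of the chart. There u has a radial derivative a = dr u
   and angular derivatives g_j = ang j u, with Laplacian a' + (N-1) coth r a + L / sinh^2 r, where L is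
   the spherical Laplacian. Since the angular derivatives commute with dr, integration by parts turns the
   integral of |Laplacian|^2 into that of
     a'^2 + (N-1) a^2 / sinh^2 + L^2 / sinh^4
       + sum_j (2 g_j'^2 / sinh^2 + 2 g_j^2 ((N-3) / sinh^2 + (N-4) / sinh^4)),
   so for radial u the stated inequality is an identity. In general one uses the Hardy inequality with the
   ground state Psi for each g_j / sinh and, by Bochner's formula on the sphere, the Poincare inequality
   L^2 >= (N-1) sum_j g_j^2 in the mean. What remains is (N-4) g_j^2 / sinh^2 + (N-5) g_j^2 / sinh^4, which
   is nonnegative for N >= 5. For the sharpness, radial functions concentrated at the pole and cut off
   logarithmically make the remainder term negligible. *)

theory Submission
  imports Defs
begin

section \<open>Smooth functions on open sets\<close>

text \<open>Two devices avoid coordinates on the sphere. The fields behind \<open>ang j\<close> are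
  tangential projections of the constant vectors, scaled to carry no radial factor, so every
  integration by parts is the Euclidean divergence theorem in the chart and the curvature of the
  sphere enters through a commutator. And test functions vanish near the pole, so weights singular
  there can be multiplied in. The shape of \<open>Psi\<close> is forced by its logarithmic
  derivative k = -alpha coth r + h / r. The Hardy weight -k' - k^2 - (N-1) coth r k has constant
  term alpha (N-1-alpha), which is \<open>l\<close> for alpha = (N-1+gamma)/2. Its 1/r^2 part, once
  (r coth r - 1)/r^2 is split off, is h (1+gamma-h), which is largest, and equal to h^2, at h =
  (gamma+1)/2. The weight of the theorem exceeds this Hardy weight by (N-1)/sinh^2, because
  ((N-2)/2)^2 + (N-1) = (N/2)^2; the term (N-1) a^2/sinh^2 pays for that. The terms g_j'^2/sinh^2
  come twice: one copy is spent on the Hardy inequality, the other is the angular part of the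
  remainder.\<close>

lemma pd_eq:
  assumes "(f has_derivative f') (at x)"
  shows "pd i f x = f' (axis i 1)"
  using frechet_derivative_at[OF assms] by (simp add: pd_def)

lemma has_derivative_pd:
  fixes f :: "real^'n \<Rightarrow> real"
  assumes "f differentiable (at x)"
  shows "(f has_derivative (\<lambda>h. \<Sum>i\<in>UNIV. pd i f x * h $ i)) (at x)"
proof -
  let ?D = "frechet_derivative f (at x)"
  have D: "(f has_derivative ?D) (at x)"
    using assms by (simp add: frechet_derivative_works)
  then have "linear ?D" by (rule has_derivative_linear)
  have "?D h = (\<Sum>i\<in>UNIV. pd i f x * h $ i)" for h
  proof -
    have "?D h = ?D (\<Sum>i\<in>UNIV. h $ i *\<^sub>R axis i 1)"
      by (simp add: basis_expansion flip: scalar_mult_eq_scaleR)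
    also have "\<dots> = (\<Sum>i\<in>UNIV. h $ i *\<^sub>R ?D (axis i 1))"
      by (simp add: linear_sum[OF \<open>linear ?D\<close>] linear_scale[OF \<open>linear ?D\<close>])
    finally show ?thesis by (simp add: pd_def mult.commute)
  qed
  then have "?D = (\<lambda>h. \<Sum>i\<in>UNIV. pd i f x * h $ i)" by blast
  with D show ?thesis by simp
qed

lemma pd_cong_open:
  assumes "open S" "x \<in> S" "\<And>y. y \<in> S \<Longrightarrow> f y = g y"
  shows "pd i f x = pd i g x"
proof -
  \<comment> \<open>The two functions have the same derivatives at x, so the choice inside
    \<open>frechet_derivative\<close> returns the same map, even where neither is
    differentiable.\<close>
  have "(f has_derivative D) (at x) \<longleftrightarrow> (g has_derivative D) (at x)" for D
    using has_derivative_transform_within_open[of f D x UNIV S g]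
      has_derivative_transform_within_open[of g D x UNIV S f] assms by auto
  then show ?thesis by (simp add: pd_def frechet_derivative_def)
qed

lemma differentiable_cong_open:
  assumes "open S" "x \<in> S" "\<And>y. y \<in> S \<Longrightarrow> f y = g y" "f differentiable (at x)"
  shows "g differentiable (at x)"
  using assms has_derivative_transform_within_open[of f _ x UNIV S g]
  unfolding differentiable_def by blast

text \<open>Localises \<open>Ck\<close> to an open set: the norm, the angle y / norm y and coth r
  are smooth only off the pole.\<close>

primrec Ck_on :: "nat \<Rightarrow> (real^'n) set \<Rightarrow> (real^'n \<Rightarrow> real) \<Rightarrow> bool" where
  "Ck_on 0 S f \<longleftrightarrow> continuous_on S f"
| "Ck_on (Suc k) S f \<longleftrightarrow> f differentiable_on S \<and> (\<forall>i. Ck_on k S (pd i f))"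

definition smooth_on :: "(real^'n) set \<Rightarrow> (real^'n \<Rightarrow> real) \<Rightarrow> bool" where
  "smooth_on S f \<longleftrightarrow> (\<forall>k. Ck_on k S f)"

lemma smooth_iff_smooth_on: "smooth f \<longleftrightarrow> smooth_on UNIV f"
proof -
  have "Ck k f \<longleftrightarrow> Ck_on k UNIV f" for k
    by (induction k arbitrary: f) auto
  then show ?thesis by (simp add: smooth_def smooth_on_def)
qed

lemma Ck_on_cong:
  assumes "open S" "\<And>x. x \<in> S \<Longrightarrow> f x = g x" "Ck_on k S f"
  shows "Ck_on k S g"
  using assms(2,3)
proof (induction k arbitrary: f g)
  case 0
  then show ?case using continuous_on_cong by (metis Ck_on.simps(1))
next
  case (Suc k)
  have "Ck_on k S (pd i g)" for i
  proof (rule Suc.IH)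
    show "pd i f x = pd i g x" if "x \<in> S" for x
      using pd_cong_open[OF assms(1) that] Suc.prems by blast
  qed (use Suc.prems in auto)
  moreover have "g differentiable_on S"
    using Suc.prems differentiable_cong_open[OF assms(1), of _ f g]
    by (simp add: differentiable_on_eq_differentiable_at[OF assms(1)])
  ultimately show ?case by simp
qed

lemma Ck_on_subset: "Ck_on k S f \<Longrightarrow> T \<subseteq> S \<Longrightarrow> Ck_on k T f"
  by (induction k arbitrary: f) (auto intro: continuous_on_subset differentiable_on_subset)

text \<open>Regularity is local. This joins the complement of the pole with a ball around it on
  which the function vanishes.\<close>

lemma Ck_on_Un:
  assumes "open S" "open T" "Ck_on k S f" "Ck_on k T f"
  shows "Ck_on k (S \<union> T) f"
  using assms(3,4)
proof (induction k arbitrary: f)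
  case 0
  then show ?case using assms by (auto simp: continuous_on_open_Un)
next
  case (Suc k)
  then show ?case using assms
    by (auto simp: differentiable_on_eq_differentiable_at open_Un)
qed

lemma Ck_on_SucI:
  assumes "open S" "\<And>x. x \<in> S \<Longrightarrow> (f has_derivative f' x) (at x)"
    and "\<And>i. Ck_on k S (\<lambda>x. f' x (axis i 1))"
  shows "Ck_on (Suc k) S f"
proof -
  have "Ck_on k S (pd i f)" for i
    by (rule Ck_on_cong[OF assms(1) _ assms(3)[of i]]) (simp add: pd_eq[OF assms(2)])
  moreover have "f differentiable_on S"
    using assms by (auto simp: differentiable_on_eq_differentiable_at differentiable_def)
  ultimately show ?thesis by simp
qed

lemma Ck_on_SucD: "Ck_on (Suc k) S f \<Longrightarrow> Ck_on k S f"
  by (induction k arbitrary: f) (auto intro: differentiable_imp_continuous_on)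

lemma Ck_on_has_derivative:
  assumes "open S" "Ck_on (Suc k) S f" "x \<in> S"
  shows "(f has_derivative (\<lambda>h. \<Sum>i\<in>UNIV. pd i f x * h $ i)) (at x)"
  by (rule has_derivative_pd) (use assms in \<open>simp add: differentiable_on_eq_differentiable_at\<close>)

lemma Ck_on_const: "open S \<Longrightarrow> Ck_on k S (\<lambda>x. c)"
proof (induction k arbitrary: c)
  case (Suc k)
  show ?case
    by (rule Ck_on_SucI[where f' = "\<lambda>_ _. 0"]) (use Suc in auto)
qed auto

lemma Ck_on_component: "open S \<Longrightarrow> Ck_on k S (\<lambda>x. x $ i)"
proof (cases k)
  case (Suc m)
  assume "open S"
  have "Ck_on m S (\<lambda>x. axis j 1 $ i)" for j using \<open>open S\<close> by (rule Ck_on_const)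
  then have "Ck_on (Suc m) S (\<lambda>x. x $ i)"
    by (intro Ck_on_SucI[where f' = "\<lambda>x h. h $ i"])
      (auto intro!: \<open>open S\<close> bounded_linear_imp_has_derivative bounded_linear_vec_nth)
  then show ?thesis using Suc by simp
qed (auto intro!: continuous_intros)

lemma sum_axis_mult: "(\<Sum>j\<in>UNIV. a j * axis i (1::real) $ j) = a i"
proof -
  have "(\<Sum>j\<in>UNIV. a j * axis i (1::real) $ j) = (\<Sum>j\<in>UNIV. if j = i then a j else 0)"
    by (rule sum.cong) (auto simp: axis_def)
  then show ?thesis by simp
qed

lemma Ck_on_add:
  assumes "open S"
  shows "Ck_on k S f \<Longrightarrow> Ck_on k S g \<Longrightarrow> Ck_on k S (\<lambda>x. f x + g x)"
proof (induction k arbitrary: f g)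
  case 0
  then show ?case by (auto intro: continuous_intros)
next
  case (Suc k)
  show ?case
    by (rule Ck_on_SucI[OF assms has_derivative_add[OF Ck_on_has_derivative[OF assms Suc.prems(1)]
          Ck_on_has_derivative[OF assms Suc.prems(2)]]])
      (use Suc in \<open>auto simp: sum_axis_mult\<close>)
qed

lemma Ck_on_mult:
  assumes "open S"
  shows "Ck_on k S f \<Longrightarrow> Ck_on k S g \<Longrightarrow> Ck_on k S (\<lambda>x. f x * g x)"
proof (induction k arbitrary: f g)
  case 0
  then show ?case by (auto intro: continuous_intros)
next
  case (Suc k)
  show ?case
    by (rule Ck_on_SucI[OF assms has_derivative_mult[OF Ck_on_has_derivative[OF assms Suc.prems(1)]
          Ck_on_has_derivative[OF assms Suc.prems(2)]]])
      (use Suc Ck_on_SucD[OF Suc.prems(1)] Ck_on_SucD[OF Suc.prems(2)]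
        in \<open>auto simp: sum_axis_mult intro!: Ck_on_add[OF assms]\<close>)
qed

lemma Ck_on_sum:
  assumes "open S" "\<And>i. i \<in> I \<Longrightarrow> Ck_on k S (f i)"
  shows "Ck_on k S (\<lambda>x. \<Sum>i\<in>I. f i x)"
proof (cases "finite I")
  case True
  then show ?thesis using assms(2)
    by (induction I rule: finite_induct) (auto intro: Ck_on_const Ck_on_add assms)
qed (auto intro: Ck_on_const assms)

text \<open>The witness \<open>d\<close> lists all iterated derivatives, so an explicit tower, such
  as that of exp (-1/x), can be supplied directly.\<close>

definition smooth1 :: "real set \<Rightarrow> (real \<Rightarrow> real) \<Rightarrow> bool" where
  "smooth1 T g \<longleftrightarrow> (\<exists>d. d 0 = g \<and> (\<forall>k. \<forall>t\<in>T. (d k has_real_derivative d (Suc k) t) (at t)))"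

lemma smooth_on_comp1:
  assumes "open S" "smooth1 T g" "smooth_on S f" "\<And>x. x \<in> S \<Longrightarrow> f x \<in> T"
  shows "smooth_on S (\<lambda>x. g (f x))"
proof -
  obtain d where d: "d 0 = g"
    "\<And>k t. t \<in> T \<Longrightarrow> (d k has_real_derivative d (Suc k) t) (at t)"
    using assms(2) unfolding smooth1_def by blast
  \<comment> \<open>Generalised over m, since differentiating d m o f produces d (Suc m) o
    f.\<close>
  have "Ck_on k S (\<lambda>x. d m (f x))" for k m
  proof (induction k arbitrary: m)
    case 0
    have "continuous_on T (d m)"
      using d(2) by (meson DERIV_isCont continuous_at_imp_continuous_on)
    moreover have "continuous_on S f" using assms(3) by (auto simp: smooth_on_def dest: spec[of _ 0])
    ultimately show ?case using assms(4)
      by (auto intro: continuous_on_compose2)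
  next
    case (Suc k)
    have f: "Ck_on (Suc k) S f" "Ck_on k S (pd i f)" for i
      using assms(3) unfolding smooth_on_def by (blast, metis Ck_on.simps(2))
    have "((\<lambda>x. d m (f x)) has_derivative (\<lambda>h. (\<Sum>i\<in>UNIV. pd i f x * h $ i) * d (Suc m) (f x))) (at x)"
      if "x \<in> S" for x
      using has_derivative_compose[OF Ck_on_has_derivative[OF assms(1) f(1) that]
          d(2)[OF assms(4)[OF that], of m, unfolded has_field_derivative_def]]
      by (simp add: mult.commute)
    then show ?case
      by (rule Ck_on_SucI[OF assms(1)])
        (use f(2) Suc.IH in \<open>auto simp: sum_axis_mult intro!: Ck_on_mult[OF assms(1)]\<close>)
  qed
  from this[of _ 0] show ?thesis by (simp add: smooth_on_def d(1))
qed

lemma smooth_on_pd: "smooth_on S f \<Longrightarrow> smooth_on S (pd i f)"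
  unfolding smooth_on_def
proof
  show "Ck_on k S (pd i f)" if "\<forall>k. Ck_on k S f" for k
    using spec[OF that, of "Suc k"] by simp
qed

lemma smooth_on_differentiable: "open S \<Longrightarrow> smooth_on S f \<Longrightarrow> x \<in> S \<Longrightarrow> f differentiable (at x)"
  unfolding smooth_on_def by (metis Ck_on.simps(2) differentiable_on_eq_differentiable_at)

lemma smooth_on_continuous: "smooth_on S f \<Longrightarrow> continuous_on S f"
  unfolding smooth_on_def by (metis Ck_on.simps(1))

lemma smooth_on_cong:
  "open S \<Longrightarrow> smooth_on S f \<Longrightarrow> (\<And>x. x \<in> S \<Longrightarrow> f x = g x) \<Longrightarrow> smooth_on S g"
  unfolding smooth_on_def using Ck_on_cong by blast

lemma smooth_on_subset: "smooth_on S f \<Longrightarrow> T \<subseteq> S \<Longrightarrow> smooth_on T f"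
  unfolding smooth_on_def using Ck_on_subset by blast

lemma smooth_on_Un: "open S \<Longrightarrow> open T \<Longrightarrow> smooth_on S f \<Longrightarrow> smooth_on T f \<Longrightarrow> smooth_on (S \<union> T) f"
  unfolding smooth_on_def using Ck_on_Un by blast

lemma smooth_on_const: "open S \<Longrightarrow> smooth_on S (\<lambda>x. c)"
  by (simp add: smooth_on_def Ck_on_const)

lemma smooth_on_component: "open S \<Longrightarrow> smooth_on S (\<lambda>x. x $ i)"
  by (simp add: smooth_on_def Ck_on_component)

lemma smooth_on_add: "open S \<Longrightarrow> smooth_on S f \<Longrightarrow> smooth_on S g \<Longrightarrow> smooth_on S (\<lambda>x. f x + g x)"
  by (simp add: smooth_on_def Ck_on_add)

lemma smooth_on_mult: "open S \<Longrightarrow> smooth_on S f \<Longrightarrow> smooth_on S g \<Longrightarrow> smooth_on S (\<lambda>x. f x * g x)"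
  by (simp add: smooth_on_def Ck_on_mult)

lemma smooth_on_sum:
  "open S \<Longrightarrow> (\<And>i. i \<in> I \<Longrightarrow> smooth_on S (f i)) \<Longrightarrow> smooth_on S (\<lambda>x. \<Sum>i\<in>I. f i x)"
  by (simp add: smooth_on_def Ck_on_sum)

lemma smooth_on_uminus: "open S \<Longrightarrow> smooth_on S f \<Longrightarrow> smooth_on S (\<lambda>x. - f x)"
  using smooth_on_mult[OF _ smooth_on_const[of S "-1"], of f] by simp

lemma smooth_on_diff: "open S \<Longrightarrow> smooth_on S f \<Longrightarrow> smooth_on S g \<Longrightarrow> smooth_on S (\<lambda>x. f x - g x)"
  using smooth_on_add[OF _ _ smooth_on_uminus[of S g], of f] by simp

lemma smooth_on_power: "open S \<Longrightarrow> smooth_on S f \<Longrightarrow> smooth_on S (\<lambda>x. f x ^ m)"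
  by (induction m) (auto intro: smooth_on_const smooth_on_mult)

lemma smooth_on_map:
  fixes B :: "real^'n \<Rightarrow> real^'n"
  assumes "open S" "open T" "\<And>j. smooth_on S (\<lambda>x. B x $ j)" "\<And>x. x \<in> S \<Longrightarrow> B x \<in> T"
    and "smooth_on T f"
  shows "smooth_on S (\<lambda>x. f (B x))"
proof -
  have B: "(B has_derivative (\<lambda>h. \<chi> j. \<Sum>i\<in>UNIV. pd i (\<lambda>x. B x $ j) x * h $ i)) (at x)" if "x \<in> S" for x
  proof -
    have "((\<lambda>x. B x $ j) has_derivative (\<lambda>h. \<Sum>i\<in>UNIV. pd i (\<lambda>x. B x $ j) x * h $ i)) (at x)" for j
      using smooth_on_differentiable[OF assms(1,3) that] by (rule has_derivative_pd)
    then have "\<forall>e\<in>Basis. ((\<lambda>x. B x \<bullet> e) has_derivative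
        (\<lambda>h. (\<chi> j. \<Sum>i\<in>UNIV. pd i (\<lambda>x. B x $ j) x * h $ i) \<bullet> e)) (at x)"
      by (auto simp: Basis_vec_def inner_axis)
    then show ?thesis using has_derivative_componentwise_within[of B _ x UNIV] by simp
  qed
  \<comment> \<open>Generalised over f, since the chain rule replaces f by its partial
    derivatives.\<close>
  have "Ck_on k S (\<lambda>x. f (B x))" if "smooth_on T f" for k f
    using that
  proof (induction k arbitrary: f)
    case 0
    have "continuous_on S B"
      using B by (meson has_derivative_continuous continuous_at_imp_continuous_on)
    then show ?case
      using smooth_on_continuous[OF 0] assms(4) by (auto intro: continuous_on_compose2)
  next
    case (Suc k)
    have "((\<lambda>x. f (B x)) has_derivative (\<lambda>h. \<Sum>j\<in>UNIV. pd j f (B x) *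
        (\<Sum>i\<in>UNIV. pd i (\<lambda>x. B x $ j) x * h $ i))) (at x)" if "x \<in> S" for x
      using has_derivative_compose[OF B[OF that]
          has_derivative_pd[OF smooth_on_differentiable[OF assms(2) Suc.prems assms(4)[OF that]]]]
      by simp
    then show ?case
      by (rule Ck_on_SucI[OF assms(1)])
        (use Suc.IH[OF smooth_on_pd[OF Suc.prems]] smooth_on_pd[OF assms(3)]
          in \<open>auto simp: sum_axis_mult smooth_on_def intro!: Ck_on_mult[OF assms(1)] Ck_on_sum[OF assms(1)]\<close>)
  qed
  then show ?thesis using assms(5) by (simp add: smooth_on_def)
qed

lemma smooth1_inverse: "smooth1 {0<..} (inverse :: real \<Rightarrow> real)"
  unfolding smooth1_def
proof (intro exI conjI allI ballI)
  let ?d = "\<lambda>k t::real. (-1)^k * fact k * (inverse t)^(Suc k)"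
  show "?d 0 = inverse" by auto
  show "(?d k has_real_derivative ?d (Suc k) t) (at t)" if "t \<in> {0<..}" for k t
    using that by (auto intro!: derivative_eq_intros simp: field_simps power2_eq_square)
      (cases k; simp)
qed

lemma smooth1_ln: "smooth1 {0<..} (ln :: real \<Rightarrow> real)"
proof -
  obtain d where d: "d 0 = inverse"
    "\<And>k t. t > 0 \<Longrightarrow> (d k has_real_derivative d (Suc k) t) (at (t::real))"
    using smooth1_inverse unfolding smooth1_def by force
  show ?thesis unfolding smooth1_def
  proof (intro exI conjI allI ballI)
    \<comment> \<open>The tower of ln is that of its derivative with ln put in front.\<close>
    show "case_nat ln d 0 = ln" by simp
    show "(case_nat ln d k has_real_derivative case_nat ln d (Suc k) t) (at t)" if "t \<in> {0<..}" for k t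
      using that d by (cases k) (auto intro!: derivative_eq_intros simp: field_simps)
  qed
qed

lemma smooth1_exp: "smooth1 UNIV (exp :: real \<Rightarrow> real)"
  unfolding smooth1_def by (intro exI[of _ "\<lambda>_. exp"]) (auto intro!: derivative_eq_intros)

lemma smooth_on_inverse:
  assumes "open S" "smooth_on S f" "\<And>x. x \<in> S \<Longrightarrow> f x > 0"
  shows "smooth_on S (\<lambda>x. inverse (f x))"
  using smooth_on_comp1[OF assms(1) smooth1_inverse assms(2)] assms(3) by simp

lemma smooth_on_ln:
  assumes "open S" "smooth_on S f" "\<And>x. x \<in> S \<Longrightarrow> f x > 0"
  shows "smooth_on S (\<lambda>x. ln (f x))"
  using smooth_on_comp1[OF assms(1) smooth1_ln assms(2)] assms(3) by simp

lemma smooth_on_exp: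
  assumes "open S" "smooth_on S f"
  shows "smooth_on S (\<lambda>x. exp (f x))"
  using smooth_on_comp1[OF assms(1) smooth1_exp assms(2)] by simp

lemma smooth_on_powr:
  assumes "open S" "smooth_on S f" "\<And>x. x \<in> S \<Longrightarrow> f x > 0"
  shows "smooth_on S (\<lambda>x. f x powr a)"
proof (rule smooth_on_cong[OF assms(1)])
  show "smooth_on S (\<lambda>x. exp (a * ln (f x)))"
    by (intro smooth_on_exp smooth_on_mult smooth_on_const smooth_on_ln assms)
qed (use assms(3) in \<open>force simp: powr_def\<close>)

lemma smooth_on_sqrt:
  assumes "open S" "smooth_on S f" "\<And>x. x \<in> S \<Longrightarrow> f x > 0"
  shows "smooth_on S (\<lambda>x. sqrt (f x))"
proof (rule smooth_on_cong[OF assms(1) smooth_on_powr[OF assms, of "1/2"]])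
  show "f x powr (1/2) = sqrt (f x)" if "x \<in> S" for x
    using assms(3)[OF that] by (simp add: powr_half_sqrt)
qed auto

lemma smooth_on_divide:
  assumes "open S" "smooth_on S f" "smooth_on S g" "\<And>x. x \<in> S \<Longrightarrow> g x > 0"
  shows "smooth_on S (\<lambda>x. f x / g x)"
  using smooth_on_mult[OF assms(1,2) smooth_on_inverse[OF assms(1,3,4)]]
  by (simp add: divide_inverse)

lemma smooth_on_inner: "open S \<Longrightarrow> smooth_on S (\<lambda>x. x \<bullet> x)"
  by (auto simp: inner_vec_def intro!: smooth_on_sum smooth_on_mult smooth_on_component)

lemma smooth_on_inner_left: "open S \<Longrightarrow> smooth_on S (\<lambda>x. x \<bullet> p)"
  by (auto simp: inner_vec_def intro!: smooth_on_sum smooth_on_mult smooth_on_component smooth_on_const)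

lemmas smooth_on_intros = smooth_on_const smooth_on_component smooth_on_add smooth_on_mult
  smooth_on_sum smooth_on_uminus smooth_on_diff smooth_on_power smooth_on_divide smooth_on_sqrt
  smooth_on_inverse smooth_on_inner smooth_on_inner_left smooth_on_pd

section \<open>Derivatives along lines and symmetry of mixed partial derivatives\<close>

lemma pd_line_derivative:
  fixes f :: "real^'n \<Rightarrow> real"
  assumes "f differentiable (at (y + t *\<^sub>R v))"
  shows "((\<lambda>t. f (y + t *\<^sub>R v)) has_real_derivative (\<Sum>i\<in>UNIV. pd i f (y + t *\<^sub>R v) * v $ i)) (at t)"
proof -
  have "((\<lambda>t. y + t *\<^sub>R v) has_derivative (\<lambda>h. h *\<^sub>R v)) (at t)"
    by (auto intro!: derivative_eq_intros)
  from has_derivative_compose[OF this has_derivative_pd[OF assms]]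
  show ?thesis
    unfolding has_field_derivative_def
    by (rule has_derivative_eq_rhs) (auto simp: fun_eq_iff sum_distrib_left mult_ac)
qed

lemma pd_axis_derivative:
  fixes f :: "real^'n \<Rightarrow> real"
  assumes "f differentiable (at (y + t *\<^sub>R axis i 1))"
  shows "((\<lambda>t. f (y + t *\<^sub>R axis i 1)) has_real_derivative pd i f (y + t *\<^sub>R axis i 1)) (at t)"
  using pd_line_derivative[OF assms] by (simp add: sum_axis_mult)

text \<open>Both mixed partial derivatives are limits of the same second difference quotient.\<close>

lemma second_difference_mvt:
  fixes f :: "real^'n \<Rightarrow> real"
  assumes S: "open S" "smooth_on S f" and h: "h > 0" "ball x (3 * h) \<subseteq> S"
  shows "\<exists>z\<in>ball x (3 * h). f (x + h *\<^sub>R axis i 1 + h *\<^sub>R axis j 1) - f (x + h *\<^sub>R axis i 1)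
           - f (x + h *\<^sub>R axis j 1) + f x = h * h * pd j (pd i f) z"
proof -
  let ?i = "axis i 1 :: real^'n" and ?j = "axis j 1 :: real^'n"
  have in_S: "x + a *\<^sub>R ?i + b *\<^sub>R ?j \<in> ball x (3 * h)" if "0 \<le> a" "a \<le> h" "0 \<le> b" "b \<le> h" for a b
  proof -
    have "norm (a *\<^sub>R ?i + b *\<^sub>R ?j) \<le> a + b"
      using norm_triangle_ineq[of "a *\<^sub>R ?i" "b *\<^sub>R ?j"] that by simp
    moreover have "dist x (x + a *\<^sub>R ?i + b *\<^sub>R ?j) = norm (a *\<^sub>R ?i + b *\<^sub>R ?j)"
      by (metis add.assoc add_diff_cancel_left' dist_commute dist_norm)
    ultimately show ?thesis using that h by simp
  qed
  then have diff: "g differentiable (at (x + a *\<^sub>R ?i + b *\<^sub>R ?j))"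
    if "smooth_on S g" "0 \<le> a" "a \<le> h" "0 \<le> b" "b \<le> h" for a b g
    using smooth_on_differentiable[OF S(1) that(1)] h(2) that(2-) by blast
  \<comment> \<open>A first difference in direction j; the mean value theorem in direction i, then
    in direction j, turns the second difference into a mixed derivative at one point.\<close>
  define F where "F a = f (x + a *\<^sub>R ?i + h *\<^sub>R ?j) - f (x + a *\<^sub>R ?i)" for a
  have "(F has_real_derivative pd i f (x + a *\<^sub>R ?i + h *\<^sub>R ?j) - pd i f (x + a *\<^sub>R ?i)) (at a)"
    if "0 \<le> a" "a \<le> h" for a
  proof -
    have "((\<lambda>a. f ((x + h *\<^sub>R ?j) + a *\<^sub>R ?i)) has_real_derivative pd i f ((x + h *\<^sub>R ?j) + a *\<^sub>R ?i)) (at a)"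
      using diff[OF S(2) that, of h] h by (intro pd_axis_derivative) (simp add: add_ac)
    moreover have "((\<lambda>a. f (x + a *\<^sub>R ?i)) has_real_derivative pd i f (x + a *\<^sub>R ?i)) (at a)"
      using diff[OF S(2) that, of 0] h by (intro pd_axis_derivative) simp
    ultimately show ?thesis
      unfolding F_def[abs_def] by (intro DERIV_diff) (simp_all add: add_ac)
  qed
  from MVT2[OF h(1) this] obtain a where a: "0 < a" "a < h"
    "F h - F 0 = h * (pd i f (x + a *\<^sub>R ?i + h *\<^sub>R ?j) - pd i f (x + a *\<^sub>R ?i))" by auto
  have "((\<lambda>b. pd i f (x + a *\<^sub>R ?i + b *\<^sub>R ?j)) has_real_derivative
      pd j (pd i f) (x + a *\<^sub>R ?i + b *\<^sub>R ?j)) (at b)" if "0 \<le> b" "b \<le> h" for b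
    using diff[OF smooth_on_pd[OF S(2)] _ _ that, of a] a by (intro pd_axis_derivative) simp
  from MVT2[OF h(1) this] obtain b where b: "0 < b" "b < h"
    "pd i f (x + a *\<^sub>R ?i + h *\<^sub>R ?j) - pd i f (x + a *\<^sub>R ?i)
      = h * pd j (pd i f) (x + a *\<^sub>R ?i + b *\<^sub>R ?j)" by auto
  show ?thesis
    using a b in_S[of a b]
    by (intro bexI[of _ "x + a *\<^sub>R ?i + b *\<^sub>R ?j"]) (auto simp: F_def)
qed

lemma pd_commute:
  fixes f :: "real^'n \<Rightarrow> real"
  assumes S: "open S" "smooth_on S f" "x \<in> S"
  shows "pd i (pd j f) x = pd j (pd i f) x"
proof -
  obtain e where e: "e > 0" "ball x e \<subseteq> S" using S open_contains_ball by blast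
  define h where "h n = e / (3 * real (Suc n))" for n
  have h: "h n > 0" "ball x (3 * h n) \<subseteq> S" for n
  proof -
    show "h n > 0" using e by (simp add: h_def)
    have "3 * h n \<le> e" using e by (simp add: h_def field_simps)
    then show "ball x (3 * h n) \<subseteq> S" using e by (meson subset_ball order_trans)
  qed
  have lim: "(\<lambda>n. 3 * h n) \<longlonglongrightarrow> 0"
  proof -
    have "3 * h n = e / real (Suc n)" for n by (simp add: h_def field_simps)
    then show ?thesis using LIMSEQ_Suc[OF lim_const_over_n[of e]] by simp
  qed
  \<comment> \<open>The second difference is symmetric in i and j, so the two orders of applying the
    mean value theorem give equal mixed derivatives at two points, both within 3 h of x.\<close>
  have "\<exists>z w. z \<in> ball x (3 * h n) \<and> w \<in> ball x (3 * h n) \<and> pd j (pd i f) z = pd i (pd j f) w" for n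
  proof -
    obtain z where z: "z \<in> ball x (3 * h n)"
      "f (x + h n *\<^sub>R axis i 1 + h n *\<^sub>R axis j 1) - f (x + h n *\<^sub>R axis i 1)
           - f (x + h n *\<^sub>R axis j 1) + f x = h n * h n * pd j (pd i f) z"
      using second_difference_mvt[OF S(1,2) h] by blast
    obtain w where w: "w \<in> ball x (3 * h n)"
      "f (x + h n *\<^sub>R axis j 1 + h n *\<^sub>R axis i 1) - f (x + h n *\<^sub>R axis j 1)
           - f (x + h n *\<^sub>R axis i 1) + f x = h n * h n * pd i (pd j f) w"
      using second_difference_mvt[OF S(1,2) h] by blast
    have "h n * h n * pd j (pd i f) z = h n * h n * pd i (pd j f) w"
      using z(2) w(2) by (simp add: algebra_simps)
    then show ?thesis using z w h(1)[of n] by auto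
  qed
  then obtain z w where zw: "\<And>n. z n \<in> ball x (3 * h n)" "\<And>n. w n \<in> ball x (3 * h n)"
    "\<And>n. pd j (pd i f) (z n) = pd i (pd j f) (w n)" by metis
  have conv: "v \<longlonglongrightarrow> x" if "\<And>n. v n \<in> ball x (3 * h n)" for v
  proof (rule tendsto_dist_iff[THEN iffD2], rule tendsto_sandwich[OF _ _ tendsto_const lim])
    show "\<forall>\<^sub>F n in sequentially. dist (v n) x \<le> 3 * h n"
      using that by (auto simp: dist_commute less_imp_le)
  qed auto
  have "isCont (pd j (pd i f)) x" "isCont (pd i (pd j f)) x"
    using S smooth_on_continuous[OF smooth_on_pd[OF smooth_on_pd[OF S(2)]]]
    by (auto simp: continuous_on_eq_continuous_at)
  then have "(\<lambda>n. pd j (pd i f) (z n)) \<longlonglongrightarrow> pd j (pd i f) x"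
    "(\<lambda>n. pd i (pd j f) (w n)) \<longlonglongrightarrow> pd i (pd j f) x"
    using conv[OF zw(1)] conv[OF zw(2)] isCont_tendsto_compose by blast+
  then show ?thesis using zw(3) LIMSEQ_unique by fastforce
qed

section \<open>Integrals of compactly supported functions\<close>

lemma integral_lborel_cbox:
  fixes f :: "real^'n \<Rightarrow> real"
  assumes "continuous_on UNIV f" "\<And>y. y \<notin> cbox p q \<Longrightarrow> f y = 0"
  shows "integrable lborel f" "(LINT y|lborel. f y) = integral (cbox p q) f"
proof -
  have eq: "(\<lambda>x. indicator (cbox p q) x *\<^sub>R f x) = f"
    using assms(2) by (auto simp: fun_eq_iff indicator_def)
  have "integrable lborel (\<lambda>x. indicator (cbox p q) x *\<^sub>R f x)"
    by (rule borel_integrable_compact) (use assms(1) in \<open>auto intro: continuous_on_subset\<close>)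
  then show int: "integrable lborel f" unfolding eq .
  have "set_integrable lborel (cbox p q) f"
    using int eq by (simp add: set_integrable_def)
  from set_borel_integral_eq_integral(2)[OF this]
  show "(LINT y|lborel. f y) = integral (cbox p q) f"
    unfolding set_lebesgue_integral_def eq .
qed

text \<open>Differentiation under the integral takes place over a fixed box; the support condition,
  uniform for parameters up to T, identifies the box integrals with integrals over the whole
  space.\<close>

lemma has_real_derivative_integral_lborel:
  fixes f f' :: "real \<Rightarrow> real^'n \<Rightarrow> real"
  assumes der: "\<And>t y. ((\<lambda>t. f t y) has_real_derivative f' t y) (at t)"
    and cont: "\<And>t. continuous_on UNIV (f t)" "continuous_on UNIV (\<lambda>(t, y). f' t y)"
    and supp: "\<And>t y. \<bar>t\<bar> \<le> T \<Longrightarrow> y \<notin> cbox p q \<Longrightarrow> f t y = 0" and t0: "\<bar>t0\<bar> < T"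
  shows "((\<lambda>t. LINT y|lborel. f t y) has_real_derivative (LINT y|lborel. f' t0 y)) (at t0)"
proof -
  let ?U = "{- T<..<T}"
  have t0_U: "t0 \<in> ?U" using t0 by auto
  have "((\<lambda>t. integral (cbox p q) (f t)) has_field_derivative integral (cbox p q) (f' t0)) (at t0 within ?U)"
  proof (rule leibniz_rule_field_derivative[OF _ _ _ t0_U])
    show "f t integrable_on cbox p q" for t
      using cont(1) by (meson continuous_on_subset integrable_continuous subset_UNIV)
    show "continuous_on (?U \<times> cbox p q) (\<lambda>(x, t). f' x t)"
      using cont(2) by (rule continuous_on_subset) auto
  qed (auto intro: has_field_derivative_at_within der)
  then have "((\<lambda>t. integral (cbox p q) (f t)) has_field_derivative integral (cbox p q) (f' t0)) (at t0)"
    using t0_U by (subst (asm) at_within_open) auto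
  moreover have "integral (cbox p q) (f t) = (LINT y|lborel. f t y)" if "t \<in> ?U" for t
    using integral_lborel_cbox(2)[OF cont(1), of p q t] supp[of t] that by auto
  moreover have "integral (cbox p q) (f' t0) = (LINT y|lborel. f' t0 y)"
  proof (rule integral_lborel_cbox(2)[symmetric])
    show "continuous_on UNIV (f' t0)"
    proof -
      have "continuous_on UNIV (\<lambda>y::real^'n. (t0, y))"
        by (intro continuous_on_Pair continuous_on_const continuous_on_id)
      from continuous_on_compose2[OF cont(2) this] show ?thesis by simp
    qed
    \<comment> \<open>Outside the box the function of t is zero on a neighbourhood of t0, hence so
      is its derivative.\<close>
    show "f' t0 y = 0" if "y \<notin> cbox p q" for y
    proof -
      have "((\<lambda>t. f t y) has_real_derivative 0) (at t0)"
        by (rule has_field_derivative_transform_within_open[of "\<lambda>_. 0" _ _ ?U])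
          (use supp that t0_U in \<open>auto simp: abs_if split: if_splits\<close>)
      then show ?thesis using der DERIV_unique by blast
    qed
  qed
  ultimately show ?thesis
    by (auto intro: has_field_derivative_transform_within_open[of _ _ _ ?U] t0_U)
qed

text \<open>By translation invariance the integral of f (y + t e_i) is constant in t, and its
  derivative at t = 0 is the integral of the partial derivative.\<close>

lemma integral_pd_eq_0:
  fixes f :: "real^'n \<Rightarrow> real"
  assumes diff: "\<And>y. f differentiable (at y)" and cont: "continuous_on UNIV (pd i f)"
    and supp: "\<And>y. norm y > R \<Longrightarrow> f y = 0"
  shows "(LINT y|lborel. pd i f y) = 0"
proof -
  let ?e = "axis i 1 :: real^'n"
  \<comment> \<open>The margin 2 leaves room for the translations with |t| at most 1.\<close>
  obtain p where p: "cball (0::real^'n) (R + 2) \<subseteq> cbox (- p) p"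
    using bounded_subset_cbox_symmetric[of "cball (0::real^'n) (R + 2)"] by auto
  have contf: "continuous_on UNIV f"
    using diff by (meson differentiable_imp_continuous_within continuous_at_imp_continuous_on)
  have "((\<lambda>t. LINT y|lborel. f (y + t *\<^sub>R ?e)) has_real_derivative (LINT y|lborel. pd i f (y + 0 *\<^sub>R ?e))) (at 0)"
  proof (rule has_real_derivative_integral_lborel[where f = "\<lambda>t y. f (y + t *\<^sub>R ?e)" and T = 1])
    show "((\<lambda>t. f (y + t *\<^sub>R ?e)) has_real_derivative pd i f (y + t *\<^sub>R ?e)) (at t)" for t y
      by (intro pd_axis_derivative diff)
    show "continuous_on UNIV (\<lambda>y. f (y + t *\<^sub>R ?e))" for t
      by (rule continuous_on_compose2[OF contf]) (auto intro!: continuous_intros)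
    show "continuous_on UNIV (\<lambda>(t, y). pd i f (y + t *\<^sub>R ?e))"
      unfolding split_beta
      by (rule continuous_on_compose2[OF cont]) (auto intro!: continuous_intros)
    show "f (y + t *\<^sub>R ?e) = 0" if "\<bar>t\<bar> \<le> 1" "y \<notin> cbox (- p) p" for t y
    proof (rule supp)
      have "norm y > R + 2" using p that(2) by (meson in_mono mem_cball_0 not_le)
      moreover have "norm y \<le> norm (y + t *\<^sub>R ?e) + norm (t *\<^sub>R ?e)"
        using norm_triangle_ineq4[of "y + t *\<^sub>R ?e" "t *\<^sub>R ?e"] by simp
      ultimately show "norm (y + t *\<^sub>R ?e) > R" using that(1) by simp
    qed
  qed auto
  moreover have "(LINT y|lborel. f (y + t *\<^sub>R ?e)) = (LINT y|lborel. f y)" for t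
  proof -
    have "(LINT y|lborel. f y) = (LINT y|distr lborel borel ((+) (t *\<^sub>R ?e)). f y)"
      by (simp add: lborel_distr_plus)
    also have "\<dots> = (LINT y|lborel. f (t *\<^sub>R ?e + y))"
      by (subst integral_distr) (auto intro: borel_measurable_continuous_onI contf)
    finally show ?thesis by (simp add: add.commute)
  qed
  ultimately have "((\<lambda>t::real. LINT y|lborel. f y) has_real_derivative (LINT y|lborel. pd i f y)) (at 0)"
    by simp
  then show ?thesis using DERIV_unique[OF _ DERIV_const] by blast
qed

section \<open>The metric of the hyperboloid in the chart\<close>

lemma pd_const [simp]: "pd i (\<lambda>x. c) x = 0"
  by (subst pd_eq[where f' = "\<lambda>h. 0"]) auto

lemma pd_add:
  "f differentiable (at x) \<Longrightarrow> g differentiable (at x) \<Longrightarrow> pd i (\<lambda>x. f x + g x) x = pd i f x + pd i g x"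
  using pd_eq[OF has_derivative_add[OF has_derivative_pd has_derivative_pd], of f x g i]
  by (simp add: sum_axis_mult)

lemma pd_mult:
  "f differentiable (at x) \<Longrightarrow> g differentiable (at x)
    \<Longrightarrow> pd i (\<lambda>x. f x * g x) x = pd i f x * g x + f x * pd i g x"
  using pd_eq[OF has_derivative_mult[OF has_derivative_pd has_derivative_pd], of f x g i]
  by (simp add: sum_axis_mult)

lemma pd_sum:
  "(\<And>j. j \<in> I \<Longrightarrow> f j differentiable (at x)) \<Longrightarrow> pd i (\<lambda>x. \<Sum>j\<in>I. f j x) x = (\<Sum>j\<in>I. pd i (f j) x)"
  using pd_eq[OF has_derivative_sum[OF has_derivative_pd], of I f x i]
  by (simp add: sum_axis_mult)

lemma differentiable_component: "(\<lambda>x::real^'n. x $ j) differentiable (at x)"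
  by (rule bounded_linear_imp_differentiable[OF bounded_linear_vec_nth])

lemma pd_component: "pd i (\<lambda>x. x $ j) x = (if i = j then 1 else 0)"
  by (subst pd_eq[OF bounded_linear_imp_has_derivative[OF bounded_linear_vec_nth]]) (simp add: axis_def)

lemma pd_comp1:
  assumes "f differentiable (at x)" "(g has_real_derivative d) (at (f x))"
  shows "pd i (\<lambda>x. g (f x)) x = d * pd i f x" "(\<lambda>x. g (f x)) differentiable (at x)"
proof -
  have *: "((\<lambda>x. g (f x)) has_derivative (\<lambda>h. d * (\<Sum>i\<in>UNIV. pd i f x * h $ i))) (at x)"
    using has_derivative_compose[OF has_derivative_pd[OF assms(1)] assms(2)[unfolded has_field_derivative_def]] .
  then show "(\<lambda>x. g (f x)) differentiable (at x)" by (auto simp: differentiable_def)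
  show "pd i (\<lambda>x. g (f x)) x = d * pd i f x"
    using pd_eq[OF *, of i] by (simp add: sum_axis_mult)
qed

text \<open>The time coordinate on the hyperboloid. It is cosh of the distance to the point 0, and
  its reciprocal is the volume density in the chart.\<close>

definition hgt :: "real^'n \<Rightarrow> real" where
  "hgt y = sqrt (1 + y \<bullet> y)"

text \<open>The Euler field. The inverse Gram matrix is I + y y^T, so gradient and Laplacian are the
  Euclidean ones corrected by this field.\<close>

definition euler :: "(real^'n \<Rightarrow> real) \<Rightarrow> real^'n \<Rightarrow> real" where
  "euler f y = (\<Sum>i\<in>UNIV. y $ i * pd i f y)"

lemma hgt_pos [simp]: "0 < hgt y" "hgt y \<noteq> 0" "0 \<le> hgt y"
proof -
  show "0 < hgt y" by (simp add: hgt_def add_pos_nonneg)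
  then show "hgt y \<noteq> 0" "0 \<le> hgt y" by linarith+
qed

lemma hgt_sq: "(hgt y)\<^sup>2 = 1 + y \<bullet> y"
  by (simp add: hgt_def add_pos_nonneg)

lemma hgt_ge_1: "1 \<le> hgt y"
  by (simp add: hgt_def)

lemma hyperboloid_hgt: "hyperboloid y = (hgt y, y)"
  by (simp add: hyperboloid_def hgt_def)

lemma hgt_has_derivative: "(hgt has_derivative (\<lambda>h. (y \<bullet> h) / hgt y)) (at y)"
proof -
  have pos: "0 < 1 + y \<bullet> y" by (simp add: add_pos_nonneg)
  show ?thesis
    unfolding hgt_def[abs_def]
    by (rule derivative_eq_intros pos refl)+
      (auto simp: fun_eq_iff inner_commute field_simps)
qed

lemma smooth_on_hgt: "open S \<Longrightarrow> smooth_on S hgt"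
  unfolding hgt_def[abs_def] by (intro smooth_on_intros) (auto simp: add_pos_nonneg)

lemma pd_hgt: "pd i hgt y = y $ i / hgt y"
  using pd_eq[OF hgt_has_derivative] by (simp add: inner_axis)

lemma differentiable_hgt: "hgt differentiable (at y)"
  using hgt_has_derivative by (auto simp: differentiable_def)

lemma continuous_on_hgt [continuous_intros]:
  "continuous_on S f \<Longrightarrow> continuous_on S (\<lambda>x. hgt (f x))"
  unfolding hgt_def by (intro continuous_intros)

lemma hyp_metric_nth:
  "hyp_metric y $ i $ j = (if i = j then 1 else 0) - y $ i * y $ j / (hgt y)\<^sup>2"
proof -
  have "(hyperboloid has_derivative (\<lambda>h. ((y \<bullet> h) / hgt y, h))) (at y)"
    unfolding hyperboloid_hgt[abs_def] by (intro has_derivative_Pair hgt_has_derivative has_derivative_ident)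
  from frechet_derivative_at[OF this, symmetric]
  show ?thesis
    by (simp add: hyp_metric_def lorentz_def inner_axis inner_axis_axis power2_eq_square)
      (simp add: axis_def)
qed

text \<open>Covers both the Gram matrix, with c = -1 / hgt^2, and its inverse, with c = 1.\<close>

definition id_plus_rank_one :: "real \<Rightarrow> real^'n \<Rightarrow> real^'n^'n" where
  "id_plus_rank_one c y = (\<chi> i j. (if i = j then 1 else 0) + c * y $ i * y $ j)"

lemma id_plus_rank_one_mult: "id_plus_rank_one c y *v v = v + (c * (y \<bullet> v)) *\<^sub>R y"
proof -
  have "(\<Sum>j\<in>UNIV. ((if i = j then 1 else 0) + c * y $ i * y $ j) * v $ j)
      = (\<Sum>j\<in>UNIV. (if i = j then v $ j else 0) + c * y $ i * (y $ j * v $ j))" for i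
    by (rule sum.cong) (auto simp: algebra_simps)
  then show ?thesis
    by (simp add: vec_eq_iff id_plus_rank_one_def matrix_vector_mult_def sum.distrib inner_vec_def
        sum_distrib_left mult_ac)
qed

lemma hyp_metric_eq: "hyp_metric y = id_plus_rank_one (- 1 / (hgt y)\<^sup>2) y"
  by (simp add: vec_eq_iff hyp_metric_nth id_plus_rank_one_def)

lemma hyp_metric_mult: "hyp_metric y *v v = v - ((y \<bullet> v) / (hgt y)\<^sup>2) *\<^sub>R y"
  by (simp add: hyp_metric_eq id_plus_rank_one_mult)

lemma matrix_inv_hyp_metric_mult:
  fixes y :: "real^'n"
  shows "matrix_inv (hyp_metric y) *v v = v + (y \<bullet> v) *\<^sub>R y"
proof -
  let ?K = "id_plus_rank_one 1 y"
  note K = id_plus_rank_one_mult[of 1 y, simplified]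
  have h: "y \<bullet> y = (hgt y)\<^sup>2 - 1" by (simp add: hgt_sq)
  have "hyp_metric y ** ?K = mat 1"
  proof (rule matrix_eq[THEN iffD2], rule allI)
    fix v
    have "(hyp_metric y ** ?K) *v v = v + (y \<bullet> v) *\<^sub>R y - ((y \<bullet> v + (y \<bullet> v) * (y \<bullet> y)) / (hgt y)\<^sup>2) *\<^sub>R y"
      by (simp add: matrix_vector_mul_assoc[symmetric] hyp_metric_mult K inner_add_right)
    also have "(y \<bullet> v + (y \<bullet> v) * (y \<bullet> y)) / (hgt y)\<^sup>2 = y \<bullet> v"
      by (simp add: h field_simps)
    finally show "(hyp_metric y ** ?K) *v v = mat 1 *v v" by simp
  qed
  then have K2: "hyp_metric y ** ?K = mat 1" "?K ** hyp_metric y = mat 1"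
    using matrix_left_right_inverse by blast+
  \<comment> \<open>\<open>matrix_inv\<close> is a choice; the existence of the inverse ?K makes it
    a genuine inverse, and uniqueness then identifies the two.\<close>
  then have "hyp_metric y ** matrix_inv (hyp_metric y) = mat 1"
    unfolding matrix_inv_def by (metis (mono_tags, lifting) someI_ex)
  then have "matrix_inv (hyp_metric y) = ?K"
    using K2 by (metis matrix_mul_assoc matrix_mul_lid matrix_mul_rid)
  then show ?thesis using K by simp
qed

text \<open>A rotation taking y to a multiple of a coordinate axis intertwines this matrix with a
  diagonal one that has at most one entry different from 1.\<close>

lemma det_id_plus_rank_one: "det (id_plus_rank_one c (y :: real^'n)) = 1 + c * (y \<bullet> y)"
proof -
  fix k :: 'n
  let ?A = "id_plus_rank_one c y"
  note A = id_plus_rank_one_mult[of c y]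
  have "norm y = norm (norm y *\<^sub>R axis k 1 :: real^'n)" by simp
  then obtain f where f: "orthogonal_transformation f" "f y = norm y *\<^sub>R axis k (1::real)"
    by (rule orthogonal_transformation_exists)
  let ?Q = "matrix f"
  have Q: "orthogonal_matrix ?Q" and lin: "linear f"
    using f(1) by (simp_all add: orthogonal_transformation_matrix)
  have Qv: "?Q *v v = f v" for v by (simp add: matrix_works linear_matrix_vector_mul_eq lin)
  let ?D = "(\<chi> i j. if i = j then (if i = k then 1 + c * (y \<bullet> y) else 1) else 0) :: real^'n^'n"
  have D: "?D *v v = v + (c * (y \<bullet> y) * v $ k) *\<^sub>R axis k 1" for v
  proof -
    have "(\<Sum>j\<in>UNIV. (if i = j then (if i = k then 1 + c * (y \<bullet> y) else 1) else 0) * v $ j)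
        = (\<Sum>j\<in>UNIV. if i = j then (if i = k then 1 + c * (y \<bullet> y) else 1) * v $ j else 0)" for i
      by (rule sum.cong) auto
    then show ?thesis
      by (simp add: vec_eq_iff matrix_vector_mult_def axis_def) (simp add: algebra_simps)
  qed
  have "?Q ** ?A = ?D ** ?Q"
  proof (rule matrix_eq[THEN iffD2], rule allI)
    fix v
    have "y \<bullet> v = f y \<bullet> f v" using f(1) by (simp add: orthogonal_transformation_def)
    also have "\<dots> = norm y * f v $ k" by (simp add: f(2) inner_axis' )
    finally have yv: "y \<bullet> v = norm y * f v $ k" .
    have "(?Q ** ?A) *v v = f v + (c * (y \<bullet> v)) *\<^sub>R f y"
      by (simp add: matrix_vector_mul_assoc[symmetric] A Qv linear_add[OF lin] linear_scale[OF lin])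
    also have "\<dots> = f v + (c * (norm y * norm y) * f v $ k) *\<^sub>R axis k 1"
      by (simp add: f(2) yv mult.commute mult.left_commute)
    also have "norm y * norm y = y \<bullet> y"
      by (simp add: norm_eq_sqrt_inner)
    also have "f v + (c * (y \<bullet> y) * f v $ k) *\<^sub>R axis k 1 = (?D ** ?Q) *v v"
      by (simp only: matrix_vector_mul_assoc[symmetric] Qv D)
    finally show "(?Q ** ?A) *v v = (?D ** ?Q) *v v" .
  qed
  then have "det (?Q ** ?A) = det (?D ** ?Q)" by (rule arg_cong)
  then have "det ?Q * det ?A = det ?D * det ?Q" unfolding det_mul .
  moreover have "det ?Q \<noteq> 0" using det_orthogonal_matrix[OF Q] by auto
  moreover have "a = b" if "q * a = b * q" "q \<noteq> 0" for a b q :: real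
    using that by (simp add: mult.commute)
  ultimately have "det ?A = det ?D" by blast
  also have "det ?D = (\<Prod>i\<in>UNIV. if i = k then 1 + c * (y \<bullet> y) else 1)"
    by (subst det_diagonal) auto
  also have "\<dots> = 1 + c * (y \<bullet> y)" by simp
  finally show ?thesis .
qed

lemma inner_self_hgt: "y \<bullet> y = (hgt y)\<^sup>2 - 1"
  by (simp add: hgt_sq)

lemma det_hyp_metric: "det (hyp_metric y) = 1 / (hgt y)\<^sup>2"
  unfolding hyp_metric_eq det_id_plus_rank_one inner_self_hgt
  by (simp add: field_simps)

lemma sqrt_det_hyp_metric: "sqrt (det (hyp_metric y)) = 1 / hgt y"
  by (simp add: det_hyp_metric real_sqrt_divide)

lemma integral_hyp_vol:
  assumes "f \<in> borel_measurable borel"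
  shows "(LINT y|hyp_vol. f y) = (LINT y|lborel. f y / hgt y)"
proof -
  have [measurable]: "(hgt :: real^'n \<Rightarrow> real) \<in> borel_measurable borel"
    by (intro borel_measurable_continuous_onI continuous_on_hgt continuous_on_id)
  have "(LINT y|hyp_vol. f y) = (LINT y|density lborel (\<lambda>y. 1 / hgt y). f y)"
    by (simp add: riem_volume_def sqrt_det_hyp_metric)
  also have "\<dots> = (LINT y|lborel. (1 / hgt y) *\<^sub>R f y)"
    by (rule integral_density) (use assms in auto)
  finally show ?thesis by simp
qed

lemma riem_grad_nth: "riem_grad hyp_metric f y $ i = pd i f y + euler f y * y $ i"
  by (simp add: riem_grad_def matrix_inv_hyp_metric_mult euler_def inner_vec_def)

lemma hyp_grad2_eq: "hyp_grad2 f y = (\<Sum>i\<in>UNIV. (pd i f y)\<^sup>2) + (euler f y)\<^sup>2"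
proof -
  define g where "g = (\<chi> i. pd i f y)"
  have e: "euler f y = y \<bullet> g" by (simp add: euler_def inner_vec_def g_def)
  have v: "riem_grad hyp_metric f y = g + (y \<bullet> g) *\<^sub>R y"
    by (simp add: riem_grad_def matrix_inv_hyp_metric_mult g_def)
  have h: "y \<bullet> y = (hgt y)\<^sup>2 - 1" by (simp add: hgt_sq)
  have c: "(y \<bullet> g + (y \<bullet> g) * (y \<bullet> y)) / (hgt y)\<^sup>2 = y \<bullet> g"
    by (simp add: h field_simps)
  have "hyp_grad2 f y = (g + (y \<bullet> g) *\<^sub>R y) \<bullet> g"
    by (simp add: hyp_grad2_def riem_norm2_def v hyp_metric_mult inner_add_right c)
  also have "\<dots> = g \<bullet> g + (y \<bullet> g)\<^sup>2" by (simp add: inner_add_left power2_eq_square)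
  also have "g \<bullet> g = (\<Sum>i\<in>UNIV. (pd i f y)\<^sup>2)"
    by (simp add: inner_vec_def g_def power2_eq_square)
  finally show ?thesis by (simp add: e)
qed

lemma smooth_on_euler: "open S \<Longrightarrow> smooth_on S f \<Longrightarrow> smooth_on S (euler f)"
  unfolding euler_def[abs_def] by (intro smooth_on_intros) auto

lemma hyp_laplacian_eq:
  fixes f :: "real^'n \<Rightarrow> real"
  assumes S: "open S" "smooth_on S f" "x \<in> S"
  shows "hyp_laplacian f x
    = (\<Sum>i\<in>UNIV. pd i (pd i f) x) + euler (euler f) x + (real CARD('n) - 1) * euler f x"
proof -
  note d = smooth_on_differentiable[OF S(1) _ S(3)]
  have dE: "euler f differentiable (at x)" by (intro d smooth_on_euler S)
  have dp: "pd i f differentiable (at x)" for i by (intro d smooth_on_pd S)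
  have inv: "((\<lambda>t. inverse t) has_real_derivative - (1 / (hgt x)\<^sup>2)) (at (hgt x))"
    by (auto intro!: derivative_eq_intros simp: field_simps power2_eq_square)
  have "pd i (\<lambda>y. sqrt (det (hyp_metric y)) * riem_grad hyp_metric f y $ i) x
    = (pd i (pd i f) x + x $ i * pd i (euler f) x + euler f x) / hgt x
      - (x $ i * pd i f x + euler f x * (x $ i * x $ i)) / (hgt x)^3" for i
  proof -
    have "(\<lambda>y. sqrt (det (hyp_metric y)) * riem_grad hyp_metric f y $ i)
        = (\<lambda>y. inverse (hgt y) * (pd i f y + euler f y * y $ i))"
      by (simp add: sqrt_det_hyp_metric riem_grad_nth divide_inverse)
    then have "pd i (\<lambda>y. sqrt (det (hyp_metric y)) * riem_grad hyp_metric f y $ i) x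
        = - (1 / (hgt x)\<^sup>2) * (x $ i / hgt x) * (pd i f x + euler f x * x $ i)
          + inverse (hgt x) * (pd i (pd i f) x + (pd i (euler f) x * x $ i + euler f x))"
      by (simp add: pd_mult pd_add pd_component pd_comp1[OF differentiable_hgt inv] pd_hgt dp dE
          differentiable_component differentiable_mult differentiable_add)
    also have "\<dots> = (pd i (pd i f) x + x $ i * pd i (euler f) x + euler f x) / hgt x
        - (x $ i * pd i f x + euler f x * (x $ i * x $ i)) / (hgt x)^3"
      by (simp add: field_simps power2_eq_square power3_eq_cube)
    finally show ?thesis .
  qed
  then have "hyp_laplacian f x = hgt x * (\<Sum>i\<in>UNIV.
      (pd i (pd i f) x + x $ i * pd i (euler f) x + euler f x) / hgt x
      - (x $ i * pd i f x + euler f x * (x $ i * x $ i)) / (hgt x)^3)"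
    by (simp add: laplace_beltrami_def riem_div_def sqrt_det_hyp_metric mult.commute)
  also have "\<dots> = hgt x * (((\<Sum>i\<in>UNIV. pd i (pd i f) x) + euler (euler f) x + real CARD('n) * euler f x) / hgt x
      - (euler f x + euler f x * (x \<bullet> x)) / (hgt x)^3)"
    by (simp add: sum_subtractf sum.distrib flip: sum_divide_distrib sum_distrib_left)
      (simp add: euler_def[of "euler f"] euler_def[of f] inner_vec_def)
  also have "\<dots> = ((\<Sum>i\<in>UNIV. pd i (pd i f) x) + euler (euler f) x + real CARD('n) * euler f x)
      - (euler f x + euler f x * (x \<bullet> x)) / (hgt x)\<^sup>2"
    by (simp add: right_diff_distrib power3_eq_cube power2_eq_square)
  \<comment> \<open>Differentiating the density 1 / hgt costs exactly one Euler derivative, which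
    lowers the coefficient from N to N - 1.\<close>
  also have "(euler f x + euler f x * (x \<bullet> x)) / (hgt x)\<^sup>2 = euler f x"
  proof -
    have "euler f x + euler f x * (x \<bullet> x) = euler f x * (hgt x)\<^sup>2"
      by (simp add: hgt_sq distrib_left)
    then show ?thesis by simp
  qed
  finally show ?thesis by (simp add: left_diff_distrib)
qed

section \<open>Lorentz boosts\<close>

text \<open>Read in the chart, the boost of rapidity t in direction e moves a point only along e;
  this is the signed length of the displacement.\<close>

definition boost_len :: "real^'n \<Rightarrow> real \<Rightarrow> real^'n \<Rightarrow> real" where
  "boost_len e t y = (cosh t - 1) * (e \<bullet> y) + sinh t * hgt y"

definition boost :: "real^'n \<Rightarrow> real \<Rightarrow> real^'n \<Rightarrow> real^'n" where
  "boost e t y = y + boost_len e t y *\<^sub>R e"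

definition lorentz_boost :: "real^'n \<Rightarrow> real \<Rightarrow> real \<times> (real^'n) \<Rightarrow> real \<times> (real^'n)" where
  "lorentz_boost e t Z = (cosh t * fst Z + sinh t * (e \<bullet> snd Z),
     snd Z + ((cosh t - 1) * (e \<bullet> snd Z) + sinh t * fst Z) *\<^sub>R e)"

lemma lorentz_boost_add: "lorentz_boost e t (X + Y) = lorentz_boost e t X + lorentz_boost e t Y"
  by (simp add: lorentz_boost_def algebra_simps inner_add_right)

lemma lorentz_boost_scaleR: "lorentz_boost e t (c *\<^sub>R X) = c *\<^sub>R lorentz_boost e t X"
  by (simp add: lorentz_boost_def algebra_simps)

lemma abs_inner_le_hgt:
  assumes "norm e = 1"
  shows "\<bar>e \<bullet> y\<bar> \<le> hgt y"
proof -
  have "\<bar>e \<bullet> y\<bar> \<le> norm y" using Cauchy_Schwarz_ineq2[of e y] assms by simp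
  also have "\<dots> \<le> hgt y"
    by (rule power2_le_imp_le) (simp_all add: power2_norm_eq_inner hgt_sq)
  finally show ?thesis .
qed

lemma hgt_le: "hgt y \<le> 1 + norm y"
  by (rule power2_le_imp_le) (simp_all add: power2_sum hgt_sq power2_norm_eq_inner)

lemma abs_sinh_le_cosh: "\<bar>sinh t\<bar> \<le> cosh (t::real)"
  by (rule power2_le_imp_le) (auto simp: cosh_square_eq)

context
  fixes e :: "real^'n"
  assumes e: "norm e = 1"
begin

lemma inner_e: "e \<bullet> e = 1"
  using e by (simp add: norm_eq_sqrt_inner)

lemma inner_boost: "e \<bullet> boost e t y = cosh t * (e \<bullet> y) + sinh t * hgt y"
  by (simp add: boost_def boost_len_def inner_add_right inner_e algebra_simps)

lemma hgt_boost: "hgt (boost e t y) = cosh t * hgt y + sinh t * (e \<bullet> y)"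
proof (rule power2_eq_imp_eq)
  have "boost e t y \<bullet> boost e t y = y \<bullet> y + 2 * boost_len e t y * (e \<bullet> y) + (boost_len e t y)\<^sup>2"
    by (simp add: boost_def inner_add_left inner_add_right inner_e inner_commute power2_eq_square algebra_simps)
  then have "(hgt (boost e t y))\<^sup>2 = (hgt y)\<^sup>2 + 2 * boost_len e t y * (e \<bullet> y) + (boost_len e t y)\<^sup>2"
    by (simp add: hgt_sq)
  also have "\<dots> = (hgt y)\<^sup>2 + ((cosh t)\<^sup>2 - 1) * (e \<bullet> y)\<^sup>2 + 2 * cosh t * sinh t * (e \<bullet> y) * hgt y
      + (sinh t)\<^sup>2 * (hgt y)\<^sup>2"
    by (simp add: boost_len_def power2_eq_square algebra_simps)
  also have "\<dots> = (cosh t * hgt y + sinh t * (e \<bullet> y))\<^sup>2"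
    by (simp add: cosh_square_eq power2_sum power_mult_distrib algebra_simps)
  finally show "(hgt (boost e t y))\<^sup>2 = (cosh t * hgt y + sinh t * (e \<bullet> y))\<^sup>2" .
  \<comment> \<open>Fixes the sign of the root: cosh t times hgt y dominates.\<close>
  have "\<bar>sinh t * (e \<bullet> y)\<bar> \<le> cosh t * hgt y"
    unfolding abs_mult by (intro mult_mono abs_sinh_le_cosh abs_inner_le_hgt e) auto
  then show "0 \<le> cosh t * hgt y + sinh t * (e \<bullet> y)" by linarith
qed simp

lemma hyperboloid_boost: "hyperboloid (boost e t y) = lorentz_boost e t (hyperboloid y)"
  by (simp add: hyperboloid_hgt hgt_boost lorentz_boost_def) (simp add: boost_def boost_len_def)

lemma lorentz_lorentz_boost:
  "lorentz (lorentz_boost e t X) (lorentz_boost e t Y) = lorentz X Y"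
proof -
  define x where "x = e \<bullet> snd X"
  define y where "y = e \<bullet> snd Y"
  define a where "a = fst X"
  define b where "b = fst Y"
  define c where "c = cosh t"
  define s where "s = sinh t"
  have cs: "c * c = s * s + 1" using cosh_square_eq[of t] by (simp add: c_def s_def power2_eq_square)
  have "lorentz (lorentz_boost e t X) (lorentz_boost e t Y)
    = snd X \<bullet> snd Y + ((c - 1) * x + s * a) * y + ((c - 1) * y + s * b) * x
      + ((c - 1) * x + s * a) * ((c - 1) * y + s * b) - (c * a + s * x) * (c * b + s * y)"
    by (simp add: lorentz_def lorentz_boost_def inner_add_left inner_add_right inner_e inner_commute
        x_def y_def a_def b_def c_def s_def)
  also have "\<dots> = snd X \<bullet> snd Y + (c * c - s * s - 1) * (x * y) - (c * c - s * s) * (a * b)"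
    by (simp add: algebra_simps)
  also have "\<dots> = snd X \<bullet> snd Y - a * b" by (simp add: cs)
  also have "\<dots> = lorentz X Y" by (simp add: lorentz_def a_def b_def)
  finally show ?thesis .
qed

lemma hyp_dist_boost: "hyp_dist (boost e t x) (boost e t y) = hyp_dist x y"
  by (simp add: hyp_dist_def hyperboloid_boost lorentz_lorentz_boost)

lemma boost_boost: "boost e s (boost e t y) = boost e (s + t) y"
proof -
  have "boost_len e t y + boost_len e s (boost e t y) = boost_len e (s + t) y"
    by (simp add: boost_len_def[of e s] inner_boost hgt_boost)
      (simp add: boost_len_def cosh_add sinh_add algebra_simps)
  then show ?thesis
    unfolding boost_def[of e s] boost_def[of e "s + t"]
    by (simp add: boost_def[of e t y] flip: scaleR_add_left)
qed

lemma boost_zero [simp]: "boost e 0 y = y"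
  by (simp add: boost_def boost_len_def)

lemma boost_inverse [simp]: "boost e t (boost e (- t) y) = y" "boost e (- t) (boost e t y) = y"
  by (simp_all add: boost_boost)

text \<open>One bound for all rapidities up to T, applied to inverse boosts to place the supports of
  all f o \<open>boost e s\<close> in a common box while the integral is differentiated in
  s.\<close>

lemma norm_boost_le:
  assumes "\<bar>t\<bar> \<le> T" "norm y \<le> R"
  shows "norm (boost e t y) \<le> cosh T * (2 * R + 1)"
proof -
  have c: "cosh t \<le> cosh T"
    using cosh_real_nonneg_le_iff[of "\<bar>t\<bar>" T] assms by (simp add: abs_if split: if_splits)
  have "\<bar>(cosh t - 1) * (e \<bullet> y)\<bar> \<le> (cosh t - 1) * norm y"
    unfolding abs_mult using Cauchy_Schwarz_ineq2[of e y] e cosh_real_ge_1[of t]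
    by (intro mult_mono) auto
  moreover have "\<bar>sinh t * hgt y\<bar> \<le> cosh t * (1 + norm y)"
    unfolding abs_mult using abs_sinh_le_cosh hgt_le[of y] by (intro mult_mono) auto
  ultimately have "\<bar>boost_len e t y\<bar> \<le> (cosh t - 1) * norm y + cosh t * (1 + norm y)"
    unfolding boost_len_def by linarith
  moreover have "norm (boost e t y) \<le> norm y + \<bar>boost_len e t y\<bar>"
    unfolding boost_def using norm_triangle_ineq[of y "boost_len e t y *\<^sub>R e"] e by simp
  ultimately have "norm (boost e t y) \<le> cosh t * (2 * norm y + 1)"
    by (simp add: algebra_simps)
  also have "\<dots> \<le> cosh T * (2 * R + 1)"
    using c assms by (intro mult_mono) auto
  finally show ?thesis .
qed

lemma smooth_on_boost: "open S \<Longrightarrow> smooth_on S (\<lambda>x. boost e t x $ j)"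
  unfolding boost_def boost_len_def
  by (simp add: inner_commute[of e]) (intro smooth_on_intros smooth_on_hgt; assumption)

lemma boost_len_has_derivative:
  "(boost_len e t has_derivative (\<lambda>h. (cosh t - 1) * (e \<bullet> h) + sinh t * ((x \<bullet> h) / hgt x))) (at x)"
  unfolding boost_len_def[abs_def] by (rule derivative_eq_intros hgt_has_derivative refl | simp)+

lemma differentiable_boost_len: "boost_len e t differentiable (at x)"
  using boost_len_has_derivative by (auto simp: differentiable_def)

lemma pd_boost_len: "pd i (boost_len e t) x = (cosh t - 1) * e $ i + sinh t * (x $ i / hgt x)"
  using pd_eq[OF boost_len_has_derivative] by (simp add: inner_axis)

text \<open>The Jacobian of a boost is the identity plus a rank-one map onto the line of e, so only
  the derivative of g along e is added.\<close>

lemma boost_chain: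
  assumes "g differentiable (at (boost e t x))"
  shows "(\<lambda>x. g (boost e t x)) differentiable (at x)"
    and "pd i (\<lambda>x. g (boost e t x)) x = pd i g (boost e t x)
      + pd i (boost_len e t) x * (\<Sum>j\<in>UNIV. e $ j * pd j g (boost e t x))"
proof -
  have "(boost e t has_derivative (\<lambda>h. h + (\<Sum>i\<in>UNIV. pd i (boost_len e t) x * h $ i) *\<^sub>R e)) (at x)"
    unfolding boost_def[abs_def]
    by (rule derivative_eq_intros has_derivative_pd[OF differentiable_boost_len] refl)+
  note * = has_derivative_compose[OF this has_derivative_pd[OF assms]]
  then show "(\<lambda>x. g (boost e t x)) differentiable (at x)" by (auto simp: differentiable_def)
  show "pd i (\<lambda>x. g (boost e t x)) x = pd i g (boost e t x)
      + pd i (boost_len e t) x * (\<Sum>j\<in>UNIV. e $ j * pd j g (boost e t x))"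
  proof -
    have "pd i (\<lambda>x. g (boost e t x)) x
        = (\<Sum>j\<in>UNIV. pd j g (boost e t x) * axis i 1 $ j + pd i (boost_len e t) x * (e $ j * pd j g (boost e t x)))"
      unfolding pd_eq[OF *, of i] vector_add_component vector_scaleR_component sum_axis_mult
        real_scaleR_def by (rule sum.cong) (auto simp: algebra_simps)
    then show ?thesis by (simp add: sum.distrib sum_axis_mult sum_distrib_left)
  qed
qed


text \<open>The isometry property of the boost in scalar form: the left-hand side is the coefficient
  of the only term, quadratic in the derivative along e, by which the squared gradient or the
  Laplacian of g o \<open>boost e t\<close> could differ from that of g.\<close>

lemma boost_len_identity:
  "2 * (cosh t - 1) - 2 * (sinh t / hgt x) * boost_len e t x + (sinh t / hgt x)\<^sup>2
    + (\<Sum>i\<in>UNIV. (pd i (boost_len e t) x)\<^sup>2) = 0"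
proof -
  define c where "c = cosh t"
  define s where "s = sinh t"
  define H where "H = hgt x"
  define q where "q = e \<bullet> x"
  have H: "H \<noteq> 0" by (simp add: H_def)
  have cs: "c\<^sup>2 = s\<^sup>2 + 1" by (simp add: c_def s_def cosh_square_eq)
  have "(\<Sum>i\<in>UNIV. (pd i (boost_len e t) x)\<^sup>2)
      = (\<Sum>i\<in>UNIV. (c - 1)\<^sup>2 * (e $ i * e $ i) + 2 * (c - 1) * (s / H) * (e $ i * x $ i) + (s / H)\<^sup>2 * (x $ i * x $ i))"
    by (rule sum.cong) (auto simp: pd_boost_len c_def s_def H_def power2_eq_square algebra_simps)
  also have "\<dots> = (c - 1)\<^sup>2 * (e \<bullet> e) + 2 * (c - 1) * (s / H) * q + (s / H)\<^sup>2 * (x \<bullet> x)"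
    unfolding inner_vec_def q_def sum_distrib_left sum.distrib[symmetric] by simp
  also have "\<dots> = (c - 1)\<^sup>2 + 2 * (c - 1) * (s / H) * q + (s / H)\<^sup>2 * (H\<^sup>2 - 1)"
    by (simp add: inner_e inner_self_hgt[of x] H_def)
  finally have S: "(\<Sum>i\<in>UNIV. (pd i (boost_len e t) x)\<^sup>2) = \<dots>" .
  have "2 * (c - 1) - 2 * (s / H) * ((c - 1) * q + s * H) + (s / H)\<^sup>2
      + ((c - 1)\<^sup>2 + 2 * (c - 1) * (s / H) * q + (s / H)\<^sup>2 * (H\<^sup>2 - 1)) = c\<^sup>2 - 1 - s\<^sup>2"
    using H by (simp add: power2_eq_square field_simps)
  then show ?thesis
    unfolding S by (simp add: cs boost_len_def flip: c_def s_def H_def q_def)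
qed

lemma sum_pd_boost_len_mult:
  "(\<Sum>i\<in>UNIV. pd i (boost_len e t) x * a $ i)
    = (cosh t - 1) * (e \<bullet> a) + (sinh t / hgt x) * (x \<bullet> a)"
  unfolding inner_vec_def sum_distrib_left sum.distrib[symmetric]
  by (rule sum.cong) (auto simp: pd_boost_len algebra_simps)

lemma euler_boost:
  assumes "g differentiable (at (boost e t x))"
  shows "euler (\<lambda>x. g (boost e t x)) x = euler g (boost e t x)
    - (sinh t / hgt x) * (\<Sum>j\<in>UNIV. e $ j * pd j g (boost e t x))"
proof -
  define D where "D = (\<Sum>j\<in>UNIV. e $ j * pd j g (boost e t x))"
  have "euler (\<lambda>x. g (boost e t x)) x
      = (\<Sum>i\<in>UNIV. x $ i * pd i g (boost e t x)) + (\<Sum>i\<in>UNIV. pd i (boost_len e t) x * x $ i) * D"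
    unfolding sum_distrib_right sum.distrib[symmetric] euler_def
    by (rule sum.cong) (auto simp: boost_chain(2)[OF assms] algebra_simps simp flip: D_def)
  also have "(\<Sum>i\<in>UNIV. x $ i * pd i g (boost e t x)) = euler g (boost e t x) - boost_len e t x * D"
    unfolding sum_distrib_left sum_subtractf[symmetric] euler_def D_def
    by (rule sum.cong) (auto simp: boost_def[of e t x] algebra_simps)
  also have "euler g (boost e t x) - boost_len e t x * D + (\<Sum>i\<in>UNIV. pd i (boost_len e t) x * x $ i) * D
      = euler g (boost e t x) + ((sinh t / hgt x) * (x \<bullet> x) - sinh t * hgt x) * D"
    by (simp only: sum_pd_boost_len_mult boost_len_def) (simp add: algebra_simps)
  also have "(sinh t / hgt x) * (x \<bullet> x) - sinh t * hgt x = - (sinh t / hgt x)"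
    by (simp add: inner_self_hgt field_simps power2_eq_square)
  finally show ?thesis by (simp add: D_def)
qed

lemma hyp_grad2_boost:
  assumes "g differentiable (at (boost e t x))"
  shows "hyp_grad2 (\<lambda>x. g (boost e t x)) x = hyp_grad2 g (boost e t x)"
proof -
  define D where "D = (\<Sum>j\<in>UNIV. e $ j * pd j g (boost e t x))"
  define m where "m = sinh t / hgt x"
  define E where "E = euler g (boost e t x)"
  define a where "a = (\<chi> i. pd i g (boost e t x))"
  define S where "S = (\<Sum>i\<in>UNIV. (pd i (boost_len e t) x)\<^sup>2)"
  have ea: "e \<bullet> a = D" by (simp add: D_def a_def inner_vec_def)
  have "x \<bullet> a = (boost e t x - boost_len e t x *\<^sub>R e) \<bullet> a" by (simp add: boost_def)
  also have "\<dots> = E - boost_len e t x * D"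
    by (simp add: inner_diff_left ea) (simp add: E_def euler_def a_def inner_vec_def)
  finally have xa: "x \<bullet> a = E - boost_len e t x * D" .
  have "(\<Sum>i\<in>UNIV. (pd i (\<lambda>x. g (boost e t x)) x)\<^sup>2)
      = (\<Sum>i\<in>UNIV. (pd i g (boost e t x))\<^sup>2 + 2 * D * (pd i (boost_len e t) x * a $ i) + D\<^sup>2 * (pd i (boost_len e t) x)\<^sup>2)"
    by (rule sum.cong) (auto simp: boost_chain(2)[OF assms] a_def D_def[symmetric] power2_eq_square algebra_simps)
  also have "\<dots> = (\<Sum>i\<in>UNIV. (pd i g (boost e t x))\<^sup>2)
      + 2 * D * ((cosh t - 1) * D + m * (E - boost_len e t x * D)) + D\<^sup>2 * S"
    by (simp add: sum.distrib ea xa m_def S_def sum_pd_boost_len_mult flip: sum_distrib_left)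
  finally have "hyp_grad2 (\<lambda>x. g (boost e t x)) x - hyp_grad2 g (boost e t x)
      = 2 * D * ((cosh t - 1) * D + m * (E - boost_len e t x * D)) + D\<^sup>2 * S + (E - m * D)\<^sup>2 - E\<^sup>2"
    by (simp add: hyp_grad2_eq euler_boost[OF assms] D_def m_def E_def)
  also have "\<dots> = D\<^sup>2 * (2 * (cosh t - 1) - 2 * m * boost_len e t x + m\<^sup>2 + S)"
    by (simp add: power2_eq_square algebra_simps)
  also have "\<dots> = 0" using boost_len_identity[of t x] by (simp add: m_def S_def)
  finally show ?thesis by simp
qed

lemma pd_pd_boost_len:
  "pd i (pd i (boost_len e t)) x = sinh t * (1 / hgt x - x $ i * x $ i / (hgt x)^3)"
proof -
  have inv: "((\<lambda>t. inverse t) has_real_derivative - (1 / (hgt x)\<^sup>2)) (at (hgt x))"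
    by (auto intro!: derivative_eq_intros simp: field_simps power2_eq_square)
  have "pd i (boost_len e t) = (\<lambda>x. (cosh t - 1) * e $ i + sinh t * (x $ i * inverse (hgt x)))"
    by (auto simp: pd_boost_len divide_inverse)
  then show ?thesis
    by (simp add: pd_add pd_mult pd_component pd_comp1[OF differentiable_hgt inv] pd_hgt
        differentiable_component differentiable_mult)
      (simp add: field_simps power2_eq_square power3_eq_cube)
qed

text \<open>With D the derivative along e, the terms in D g and in euler (D g) cancel; what is left
  is a multiple of D (D g), and its coefficient vanishes by
  \<open>boost_len_identity\<close>.\<close>

lemma hyp_laplacian_boost:
  assumes S: "smooth_on UNIV g"
  shows "hyp_laplacian (\<lambda>x. g (boost e t x)) x = hyp_laplacian g (boost e t x)"
proof -
  let ?B = "boost e t"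
  have gB: "smooth_on UNIV (\<lambda>x. f (?B x))" if "smooth_on UNIV f" for f
    by (rule smooth_on_map[OF _ _ smooth_on_boost _ that]) auto
  have d: "f differentiable (at y)" if "smooth_on UNIV f" for f :: "real^'n \<Rightarrow> real" and y
    using smooth_on_differentiable[OF _ that] by auto
  define k where "k i x = pd i (boost_len e t) x" for i x
  define m where "m x = sinh t / hgt x" for x :: "real^'n"
  define D where "D f y = (\<Sum>j\<in>UNIV. e $ j * pd j f y)" for f y
  have sD: "smooth_on UNIV (D f)" if "smooth_on UNIV f" for f
    unfolding D_def[abs_def] by (intro smooth_on_intros that) auto
  have sE: "smooth_on UNIV (euler f)" if "smooth_on UNIV f" for f :: "real^'n \<Rightarrow> real"
    using that by (intro smooth_on_euler) auto
  have dk: "k i differentiable (at y)" for i y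
    unfolding k_def pd_boost_len
    by (intro derivative_intros differentiable_hgt differentiable_component) auto
  have dm: "m differentiable (at y)" for y
    unfolding m_def[abs_def] by (intro derivative_intros differentiable_hgt) auto
  have inv: "((\<lambda>s. sinh t / s) has_real_derivative - sinh t / (hgt y)\<^sup>2) (at (hgt y))" for y :: "real^'n"
    by (auto intro!: derivative_eq_intros simp: field_simps power2_eq_square)
  have pdm: "pd i m y = - sinh t * y $ i / (hgt y)^3" for i y
    unfolding m_def[abs_def] pd_comp1(1)[OF differentiable_hgt inv]
    by (simp add: pd_hgt power2_eq_square power3_eq_cube)
  have chain: "pd i (\<lambda>x. f (?B x)) y = pd i f (?B y) + k i y * D f (?B y)" if "smooth_on UNIV f" for f i y
    using boost_chain(2)[OF d[OF that]] by (simp add: k_def D_def)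
  have eulerB: "euler (\<lambda>x. f (?B x)) y = euler f (?B y) - m y * D f (?B y)" if "smooth_on UNIV f" for f y
    using euler_boost[OF d[OF that]] by (simp add: m_def D_def)
  have pdD: "pd i (D g) y = D (pd i g) y" for i y
    unfolding D_def[abs_def]
    by (subst pd_sum) (auto simp: pd_mult d S smooth_on_pd pd_commute[OF _ S] intro!: differentiable_mult)
  have 1: "pd i (pd i (\<lambda>x. g (?B x))) x = pd i (pd i g) (?B x) + 2 * (k i x * D (pd i g) (?B x))
      + pd i (k i) x * D g (?B x) + (k i x)\<^sup>2 * D (D g) (?B x)" for i
  proof -
    have "pd i (\<lambda>x. g (?B x)) = (\<lambda>y. pd i g (?B y) + k i y * D g (?B y))"
      using chain[OF S] by blast
    then have "pd i (pd i (\<lambda>x. g (?B x))) x = pd i (\<lambda>y. pd i g (?B y)) x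
        + (pd i (k i) x * D g (?B x) + k i x * pd i (\<lambda>y. D g (?B y)) x)"
      by (simp add: pd_add pd_mult dk d gB sD smooth_on_pd S differentiable_mult)
    then show ?thesis
      by (simp add: chain pdD smooth_on_pd S sD power2_eq_square algebra_simps)
  qed
  define a where "a = (\<chi> i. D (pd i g) (?B x))"
  have ea: "e \<bullet> a = D (D g) (?B x)"
  proof -
    show ?thesis by (simp add: a_def inner_vec_def D_def[of "D g"] pdD)
  qed
  \<comment> \<open>D has constant coefficients and lowers homogeneity by one, so passing it through
    the Euler field leaves one extra D g.\<close>
  have ED: "D (euler g) y = D g y + euler (D g) y" for y
  proof -
    have "pd j (euler g) y = pd j g y + (\<Sum>i\<in>UNIV. y $ i * pd j (pd i g) y)" for j
      unfolding euler_def[abs_def]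
      by (subst pd_sum) (auto simp: pd_mult d S smooth_on_pd pd_component differentiable_component
          sum.distrib if_distrib[of "\<lambda>z. z * _"] intro!: differentiable_mult cong: if_cong)
    moreover have "pd i (D g) y = (\<Sum>j\<in>UNIV. e $ j * pd j (pd i g) y)" for i
      unfolding D_def[abs_def]
      by (subst pd_sum) (auto simp: pd_mult d S smooth_on_pd pd_commute[OF _ S] intro!: differentiable_mult)
    ultimately show ?thesis
      by (simp add: D_def[of "euler g"] D_def[of g] euler_def[of "D g"] distrib_left sum.distrib
          sum_distrib_left)
        (subst sum.swap, simp add: mult_ac)
  qed
  have xa: "x \<bullet> a = euler (D g) (?B x) - boost_len e t x * D (D g) (?B x)"
  proof -
    have "euler (D g) (?B x) = ?B x \<bullet> a"
      by (simp add: euler_def inner_vec_def a_def pdD)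
    then show ?thesis by (simp add: boost_def inner_add_left ea)
  qed
  have 2: "euler (euler (\<lambda>x. g (?B x))) x = euler (euler g) (?B x) - 2 * m x * euler (D g) (?B x)
      - m x * D g (?B x) - euler m x * D g (?B x) + (m x)\<^sup>2 * D (D g) (?B x)"
  proof -
    define m' where "m' y = - m y" for y
    have pm: "pd i m' x = - pd i m x" for i
      using pd_mult[of "\<lambda>_. - 1" x m i] dm by (simp add: m'_def[abs_def])
    have dm': "m' differentiable (at x)"
      using dm by (auto simp: m'_def[abs_def] intro!: derivative_intros)
    have "euler (\<lambda>x. g (?B x)) = (\<lambda>y. euler g (?B y) + m' y * D g (?B y))"
      using eulerB[OF S] by (auto simp: m'_def)
    then have "euler (euler (\<lambda>x. g (?B x))) x = euler (\<lambda>y. euler g (?B y) + m' y * D g (?B y)) x"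
      by simp
    also have "\<dots> = (\<Sum>i\<in>UNIV. x $ i * (pd i (\<lambda>y. euler g (?B y)) x
              + (pd i m' x * D g (?B x) + m' x * pd i (\<lambda>y. D g (?B y)) x)))"
      unfolding euler_def[of "\<lambda>y. euler g (?B y) + m' y * D g (?B y)"]
      by (rule sum.cong) (simp_all add: pd_add pd_mult dm' d gB sD sE S differentiable_mult)
    also have "\<dots> = (\<Sum>i\<in>UNIV. x $ i * pd i (\<lambda>y. euler g (?B y)) x)
          + (- (\<Sum>i\<in>UNIV. x $ i * pd i m x) * D g (?B x) + - m x * (\<Sum>i\<in>UNIV. x $ i * pd i (\<lambda>y. D g (?B y)) x))"
      unfolding sum_distrib_left sum_distrib_right sum_negf[symmetric] sum.distrib[symmetric]
      by (rule sum.cong) (auto simp: pm m'_def algebra_simps)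
    also have "\<dots> = euler (\<lambda>y. euler g (?B y)) x + (- (euler m x) * D g (?B x) - m x * euler (\<lambda>y. D g (?B y)) x)"
      by (simp add: euler_def)
    finally show ?thesis
      by (simp add: eulerB sD sE S ED power2_eq_square algebra_simps)
  qed
  have Em: "euler m x = - m x * (1 - 1 / (hgt x)\<^sup>2)"
  proof -
    have "euler m x = - sinh t * (x \<bullet> x) / (hgt x)^3"
      by (simp add: euler_def pdm inner_vec_def sum_distrib_left sum_divide_distrib sum_negf mult_ac)
    then show ?thesis by (simp add: inner_self_hgt m_def field_simps power2_eq_square power3_eq_cube)
  qed
  have k2: "(\<Sum>i\<in>UNIV. pd i (k i) x) = m x * (real CARD('n) - 1 + 1 / (hgt x)\<^sup>2)"
  proof -
    have "(\<Sum>i\<in>UNIV. pd i (k i) x) = sinh t * (real CARD('n) / hgt x - (x \<bullet> x) / (hgt x)^3)"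
      by (simp add: k_def[abs_def] pd_pd_boost_len right_diff_distrib sum_subtractf inner_vec_def
          sum_distrib_left sum_divide_distrib)
    then show ?thesis by (simp add: inner_self_hgt m_def field_simps power2_eq_square power3_eq_cube)
  qed
  have k1: "(\<Sum>i\<in>UNIV. k i x * D (pd i g) (?B x)) = (cosh t - 1) * D (D g) (?B x) + m x * (x \<bullet> a)"
    using sum_pd_boost_len_mult[of t x a] unfolding ea k_def m_def by (simp add: a_def)
  have id: "2 * (cosh t - 1) - 2 * m x * boost_len e t x + (m x)\<^sup>2 + (\<Sum>i\<in>UNIV. (k i x)\<^sup>2) = 0"
    using boost_len_identity[of t x] by (simp add: m_def k_def)
  define K where "K = (\<Sum>i\<in>UNIV. (k i x)\<^sup>2)"
  have "(\<Sum>i\<in>UNIV. pd i (pd i (\<lambda>x. g (?B x))) x) = (\<Sum>i\<in>UNIV. pd i (pd i g) (?B x))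
      + 2 * ((cosh t - 1) * D (D g) (?B x) + m x * (x \<bullet> a))
      + m x * (real CARD('n) - 1 + 1 / (hgt x)\<^sup>2) * D g (?B x) + K * D (D g) (?B x)"
    unfolding 1 by (simp add: sum.distrib k1 k2 K_def flip: sum_distrib_left sum_distrib_right)
  then have "hyp_laplacian (\<lambda>x. g (?B x)) x - hyp_laplacian g (?B x)
    = (2 * (cosh t - 1) - 2 * m x * boost_len e t x + (m x)\<^sup>2 + K) * D (D g) (?B x)"
    by (simp add: hyp_laplacian_eq[OF _ gB[OF S]] hyp_laplacian_eq[OF _ S] 2 eulerB[OF S] Em xa)
      (simp add: algebra_simps)
  then show ?thesis using id by (simp add: K_def)
qed

end

section \<open>Test functions, distance and radial derivative about a pole\<close>

lemma test_functions_iff: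
  "u \<in> test_functions p \<longleftrightarrow> smooth_on UNIV u \<and> (\<exists>R. \<forall>x. norm x > R \<longrightarrow> u x = 0)
     \<and> (\<exists>d>0. \<forall>x. dist x p < d \<longrightarrow> u x = 0)"
proof -
  have "compact (closure {x. u x \<noteq> 0}) \<longleftrightarrow> (\<exists>R. \<forall>x. norm x > R \<longrightarrow> u x = 0)"
    unfolding compact_closure bounded_iff by (auto simp: not_le[symmetric])
  moreover have "p \<notin> closure {x. u x \<noteq> 0} \<longleftrightarrow> (\<exists>d>0. \<forall>x. dist x p < d \<longrightarrow> u x = 0)"
    unfolding closure_approachable by auto
  ultimately show ?thesis
    by (simp add: test_functions_def smooth_iff_smooth_on)
qed

lemma hgt_zero [simp]: "hgt 0 = 1"
  by (simp add: hgt_def)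

lemma hyp_dist_zero: "hyp_dist y 0 = arcosh (hgt y)"
  by (simp add: hyp_dist_def lorentz_def hyperboloid_hgt)

lemma hyp_dist_zero_nonneg: "hyp_dist y 0 \<ge> 0"
  unfolding hyp_dist_zero by (intro arcosh_nonneg_real hgt_ge_1)

lemma cosh_hyp_dist_zero [simp]: "cosh (hyp_dist y 0) = hgt y"
  unfolding hyp_dist_zero by (intro cosh_arcosh_real hgt_ge_1)

lemma sinh_hyp_dist_zero [simp]: "sinh (hyp_dist y 0) = norm y"
proof (rule power2_eq_imp_eq)
  show "(sinh (hyp_dist y 0))\<^sup>2 = (norm y)\<^sup>2"
    by (simp add: sinh_square_eq hgt_sq power2_norm_eq_inner)
qed (simp_all add: hyp_dist_zero_nonneg)

lemma hgt_sinh_scaleR: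
  assumes "norm w = 1"
  shows "hgt (sinh s *\<^sub>R w) = cosh s"
proof (rule power2_eq_imp_eq)
  have "w \<bullet> w = 1" using assms by (simp add: norm_eq_sqrt_inner)
  then show "(hgt (sinh s *\<^sub>R w))\<^sup>2 = (cosh s)\<^sup>2"
    by (simp add: hgt_sq cosh_square_eq flip: power2_eq_square)
qed auto

abbreviation rad :: "real^'n \<Rightarrow> real" where
  "rad y \<equiv> hyp_dist y 0"

text \<open>Since norm y = sinh r, d/dr is cosh r times d/d(norm y), and the latter is the Euler
  field divided by norm y. At y = 0 the division makes the value 0.\<close>

definition dr :: "(real^'n \<Rightarrow> real) \<Rightarrow> real^'n \<Rightarrow> real" where
  "dr f y = (hgt y / norm y) * euler f y"

lemma dr_line_derivative:
  fixes f :: "real^'n \<Rightarrow> real"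
  assumes "y \<noteq> 0" "f differentiable (at y)"
  shows "((\<lambda>t. f (sinh t *\<^sub>R (y /\<^sub>R norm y))) has_real_derivative dr f y) (at (rad y))"
proof -
  have "((\<lambda>t. f (0 + t *\<^sub>R (y /\<^sub>R norm y))) has_real_derivative
      (\<Sum>i\<in>UNIV. pd i f (0 + norm y *\<^sub>R (y /\<^sub>R norm y)) * (y /\<^sub>R norm y) $ i)) (at (norm y))"
    by (rule pd_line_derivative) (use assms in simp)
  moreover have "(\<Sum>i\<in>UNIV. pd i f y * (y /\<^sub>R norm y) $ i) = euler f y / norm y"
    unfolding euler_def sum_divide_distrib by (rule sum.cong) (auto simp: field_simps)
  ultimately have "((\<lambda>t. f (t *\<^sub>R (y /\<^sub>R norm y))) has_real_derivative euler f y / norm y)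
      (at (sinh (rad y)))"
    using assms(1) by simp
  moreover have "(sinh has_real_derivative hgt y) (at (rad y))"
    by (auto intro!: derivative_eq_intros)
  ultimately show ?thesis
    using DERIV_chain2 by (fastforce simp: dr_def mult.commute)
qed

lemma isCont_boost: "isCont (boost e s) (x :: real^'n)"
  unfolding boost_def[abs_def] boost_len_def
  by (intro continuous_intros isCont_scaleR)
    (auto intro!: continuous_intros differentiable_imp_continuous_within differentiable_hgt)

lemma test_functions_boost:
  assumes e: "norm e = 1" and "u \<in> test_functions q"
  shows "(\<lambda>x. u (boost e s x)) \<in> test_functions (boost e (- s) q)"
proof -
  obtain R d where u: "smooth_on UNIV u" "\<And>x. norm x > R \<Longrightarrow> u x = 0" "d > 0" "\<And>x. dist x q < d \<Longrightarrow> u x = 0"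
    using assms(2) unfolding test_functions_iff by blast
  have "smooth_on UNIV (\<lambda>x. u (boost e s x))"
    by (rule smooth_on_map[OF _ _ smooth_on_boost[OF e] _ u(1)]) auto
  moreover have "u (boost e s x) = 0" if "norm x > cosh \<bar>s\<bar> * (2 * R + 1)" for x
  proof (rule u(2), rule ccontr)
    assume "\<not> norm (boost e s x) > R"
    then have "norm (boost e (- s) (boost e s x)) \<le> cosh \<bar>s\<bar> * (2 * R + 1)"
      by (intro norm_boost_le e) auto
    then show False using that by (simp add: boost_inverse[OF e])
  qed
  moreover have "\<exists>d'>0. \<forall>x. dist x (boost e (- s) q) < d' \<longrightarrow> u (boost e s x) = 0"
  proof -
    have "isCont (boost e s) (boost e (- s) q)" by (rule isCont_boost)
    from this[unfolded continuous_at_eps_delta, rule_format, OF u(3)]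
    show ?thesis using u(4) by (simp add: boost_inverse[OF e]) blast
  qed
  ultimately show ?thesis unfolding test_functions_iff by blast
qed

context
  fixes e :: "real^'n" and t :: real and p :: "real^'n"
  assumes e: "norm e = 1" and p: "boost e t p = 0"
begin

lemma hyp_dist_pole: "hyp_dist x p = rad (boost e t x)"
  using hyp_dist_boost[OF e, of t x p] by (simp add: p)

lemma pole_eq: "p = boost e (- t) 0"
  using boost_inverse(2)[OF e, of t p] by (simp add: p)

text \<open>Boosts are linear on Minkowski space, so they carry the geodesic cosh s (1, 0) + sinh s
  (0, w) from the origin of the chart to the geodesic from p with the transported direction.\<close>

lemma polar_point_pole:
  assumes "x \<noteq> p"
  shows "polar_point p s (polar_angle p x)
    = boost e (- t) (sinh s *\<^sub>R (boost e t x /\<^sub>R norm (boost e t x)))"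
proof -
  let ?M = "lorentz_boost e (- t)"
  define y where "y = boost e t x"
  have x: "x = boost e (- t) y" by (simp add: y_def boost_inverse[OF e])
  have y0: "y \<noteq> 0" using assms by (auto simp: x pole_eq)
  have hp: "hyperboloid p = ?M (1, 0)"
    by (simp add: pole_eq hyperboloid_boost[OF e]) (simp add: hyperboloid_hgt)
  have hx: "hyperboloid x = ?M (hgt y, y)"
    by (simp add: x hyperboloid_boost[OF e]) (simp add: hyperboloid_hgt)
  have hh: "hyp_dist x p = rad y" by (simp add: hyp_dist_pole y_def)
  have "polar_angle p x = ((1 / norm y) *\<^sub>R ?M (hgt y, y) + (- hgt y / norm y) *\<^sub>R ?M (1, 0))"
    by (simp add: polar_angle_def hp hx hh scaleR_diff_right divide_inverse mult.commute)
  also have "\<dots> = ?M ((1 / norm y) *\<^sub>R (hgt y, y) + (- hgt y / norm y) *\<^sub>R (1, 0))"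
    by (simp only: lorentz_boost_add lorentz_boost_scaleR)
  also have "\<dots> = ?M (0, y /\<^sub>R norm y)"
    using y0 by (simp add: divide_inverse)
  finally have "cosh s *\<^sub>R hyperboloid p + sinh s *\<^sub>R polar_angle p x
      = ?M (cosh s *\<^sub>R (1, 0) + sinh s *\<^sub>R (0, y /\<^sub>R norm y))"
    by (simp only: hp lorentz_boost_add lorentz_boost_scaleR)
  also have "cosh s *\<^sub>R (1, 0) + sinh s *\<^sub>R (0, y /\<^sub>R norm y) = (cosh s, sinh s *\<^sub>R (y /\<^sub>R norm y))"
    by simp
  also have "\<dots> = hyperboloid (sinh s *\<^sub>R (y /\<^sub>R norm y))"
  proof -
    have "hgt (sinh s *\<^sub>R (y /\<^sub>R norm y)) = cosh s"
      by (rule hgt_sinh_scaleR) (use y0 in simp)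
    then show ?thesis by (simp only: hyperboloid_hgt)
  qed
  finally have "cosh s *\<^sub>R hyperboloid p + sinh s *\<^sub>R polar_angle p x
      = hyperboloid (boost e (- t) (sinh s *\<^sub>R (y /\<^sub>R norm y)))"
    by (simp only: hyperboloid_boost[OF e])
  then show ?thesis by (simp add: polar_point_def y_def hyperboloid_hgt)
qed

lemma radial_deriv_pole:
  assumes "u \<in> test_functions p"
  shows "radial_deriv p u x = dr (\<lambda>y. u (boost e (- t) y)) (boost e t x)"
proof (cases "x = p")
  \<comment> \<open>At the pole \<open>polar_angle\<close> divides by sinh 0 and is therefore 0. The
    curve degenerates to cosh s p, which stays where u vanishes for small s, so both sides are
    0.\<close>
  case True
  obtain d where d: "d > 0" "\<And>x. dist x p < d \<Longrightarrow> u x = 0"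
    using assms unfolding test_functions_iff by blast
  have "isCont (\<lambda>s. cosh s *\<^sub>R p) 0" by (intro continuous_intros)
  then obtain d' where d': "d' > 0" "\<And>s. dist s 0 < d' \<Longrightarrow> dist (cosh s *\<^sub>R p) p < d"
    using d(1) unfolding continuous_at_eps_delta by (metis cosh_0 scaleR_one)
  have "((\<lambda>s. u (cosh s *\<^sub>R p)) has_real_derivative 0) (at 0)"
    by (rule has_field_derivative_transform_within[of "\<lambda>_. 0" _ _ _ d'])
      (use d d' in \<open>auto simp: dist_norm\<close>)
  moreover have "hyp_dist p p = 0"
    using hyp_dist_pole[of p] by (simp add: p hyp_dist_zero)
  moreover have "polar_point p s (polar_angle p p) = cosh s *\<^sub>R p" for s
    using \<open>hyp_dist p p = 0\<close> by (simp add: polar_point_def polar_angle_def hyperboloid_hgt)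
  ultimately show ?thesis
    by (simp add: True radial_deriv_def DERIV_imp_deriv p dr_def)
next
  case False
  define y where "y = boost e t x"
  have y0: "y \<noteq> 0" using False pole_eq boost_inverse[OF e, of t x] by (auto simp: y_def)
  have "(\<lambda>y. u (boost e (- t) y)) \<in> test_functions (boost e t p)"
    using test_functions_boost[OF e assms, of "- t"] by simp
  then have "(\<lambda>y. u (boost e (- t) y)) differentiable (at y)"
    unfolding test_functions_iff by (auto intro: smooth_on_differentiable[of UNIV])
  from DERIV_imp_deriv[OF dr_line_derivative[OF y0 this]]
  show ?thesis
    by (simp add: radial_deriv_def polar_point_pole[OF False] hyp_dist_pole flip: y_def)
qed

end

text \<open>The change of variables theorem of the library needs a well-ordered index type. Instead, the
  derivative of the left-hand side in the rapidity \<open>t\<close> is the Euclidean integral of the derivative of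
  \<open>f \<circ> boost e t\<close> in the direction \<open>e\<close>, hence zero.\<close>

lemma integral_boost:
  fixes f :: "real^'n \<Rightarrow> real"
  assumes e: "norm e = 1" and f: "Ck_on (Suc 0) UNIV f" and supp: "\<And>y. norm y > R \<Longrightarrow> f y = 0"
  shows "(LINT y|lborel. f (boost e t y) / hgt y) = (LINT y|lborel. f y / hgt y)"
proof -
  have d: "f differentiable (at y)" for y
    using f by (auto simp: differentiable_on_def)
  have cont_pd: "continuous_on UNIV (pd i f)" for i using f by auto
  have cont_f: "continuous_on UNIV f" using Ck_on_SucD[OF f] by simp
  define D where "D y = (\<Sum>i\<in>UNIV. e $ i * pd i f y)" for y
  have contD: "continuous_on UNIV D"
    unfolding D_def[abs_def] by (intro continuous_intros cont_pd)
  have contB: "continuous_on UNIV (\<lambda>(s, y). boost e s y)"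
    unfolding boost_def boost_len_def split_beta cosh_def sinh_def by (intro continuous_intros)
  have suppB: "f (boost e s y) = 0" if "\<bar>s\<bar> \<le> T" "norm y > cosh T * (2 * R + 1)" for s T y
  proof (rule supp, rule ccontr)
    assume "\<not> norm (boost e s y) > R"
    then have "norm (boost e (- s) (boost e s y)) \<le> cosh T * (2 * R + 1)"
      using that(1) by (intro norm_boost_le e) auto
    then show False using that by (simp add: boost_inverse[OF e])
  qed
  have der: "((\<lambda>s. f (boost e s y) / hgt y) has_real_derivative hgt (boost e s y) * D (boost e s y) / hgt y) (at s)"
    for s y
  proof -
    \<comment> \<open>In the rapidity the boosts are the flow of the field \<open>hgt\<close> times
      e.\<close>
    have "((\<lambda>s. boost e s y) has_derivative (\<lambda>h. h *\<^sub>R (hgt (boost e s y) *\<^sub>R e))) (at s)"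
      unfolding hgt_boost[OF e] unfolding boost_def[abs_def] boost_len_def
      by (auto intro!: derivative_eq_intros simp: fun_eq_iff algebra_simps)
    from has_derivative_compose[OF this has_derivative_pd[OF d]]
    have "((\<lambda>s. f (boost e s y)) has_real_derivative hgt (boost e s y) * D (boost e s y)) (at s)"
      unfolding has_field_derivative_def
      by (rule has_derivative_eq_rhs) (auto simp: fun_eq_iff D_def sum_distrib_left mult_ac)
    then show ?thesis by (rule DERIV_cdivide)
  qed
  have "((\<lambda>s. LINT y|lborel. f (boost e s y) / hgt y) has_real_derivative 0) (at s)" for s
  proof -
    let ?T = "\<bar>s\<bar> + 1"
    obtain q where q: "cball (0::real^'n) (cosh ?T * (2 * R + 1)) \<subseteq> cbox (- q) q"
      using bounded_subset_cbox_symmetric[of "cball (0::real^'n) (cosh ?T * (2 * R + 1))"] by auto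
    have "((\<lambda>s. LINT y|lborel. f (boost e s y) / hgt y) has_real_derivative
        (LINT y|lborel. hgt (boost e s y) * D (boost e s y) / hgt y)) (at s)"
    proof (rule has_real_derivative_integral_lborel[where T = ?T, OF der])
      have cB: "continuous_on UNIV (boost e s)" for s
        by (simp add: continuous_on_eq_continuous_at isCont_boost)
      show "continuous_on UNIV (\<lambda>y. f (boost e s y) / hgt y)" for s
        by (intro continuous_intros continuous_on_compose2[OF cont_f cB]) auto
      show "continuous_on UNIV (\<lambda>(s, y). hgt (boost e s y) * D (boost e s y) / hgt y)"
        unfolding split_beta
        by (intro continuous_intros continuous_on_compose2[OF contD] contB[unfolded split_beta]) auto
      show "f (boost e s y) / hgt y = 0" if "\<bar>s\<bar> \<le> ?T" "y \<notin> cbox (- q) q" for s y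
        using suppB[OF that(1), of y] q that(2) by (auto simp: subset_eq not_le[symmetric])
    qed auto
    \<comment> \<open>Differentiating f o \<open>boost e s\<close> along e multiplies D by the same
      factor hgt (boost e s y) / hgt y, so the integrand is a Euclidean divergence.\<close>
    also have "(LINT y|lborel. hgt (boost e s y) * D (boost e s y) / hgt y)
        = (LINT y|lborel. (\<Sum>i\<in>UNIV. e $ i * pd i (\<lambda>y. f (boost e s y)) y))"
    proof (rule Bochner_Integration.integral_cong[OF refl])
      fix y
      have "(\<Sum>i\<in>UNIV. e $ i * pd i (\<lambda>y. f (boost e s y)) y)
          = D (boost e s y) + (\<Sum>i\<in>UNIV. pd i (boost_len e s) y * e $ i) * D (boost e s y)"
        unfolding D_def[of "boost e s y"] sum_distrib_right sum.distrib[symmetric]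
        by (rule sum.cong) (auto simp: boost_chain(2)[OF e d] algebra_simps)
      also have "\<dots> = (1 + (cosh s - 1) + (sinh s / hgt y) * (y \<bullet> e)) * D (boost e s y)"
        by (simp only: sum_pd_boost_len_mult[OF e] inner_e[OF e]) (simp add: algebra_simps)
      also have "1 + (cosh s - 1) + (sinh s / hgt y) * (y \<bullet> e) = hgt (boost e s y) / hgt y"
        by (simp add: hgt_boost[OF e] inner_commute field_simps)
      finally show "hgt (boost e s y) * D (boost e s y) / hgt y
          = (\<Sum>i\<in>UNIV. e $ i * pd i (\<lambda>y. f (boost e s y)) y)" by simp
    qed
    also have "\<dots> = 0"
    proof -
      have c: "continuous_on UNIV (pd i (\<lambda>y. f (boost e s y)))" for i
      proof -
        have cB: "continuous_on UNIV (boost e s)"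
          by (simp add: continuous_on_eq_continuous_at isCont_boost)
        show ?thesis
          unfolding boost_chain(2)[OF e d] pd_boost_len[OF e] D_def[symmetric]
          by (intro continuous_intros continuous_on_compose2[OF contD cB] continuous_on_compose2[OF cont_pd cB]) auto
      qed
      have sup: "f (boost e s y) = 0" if "norm y > cosh \<bar>s\<bar> * (2 * R + 1)" for y
        using suppB[of s "\<bar>s\<bar>"] that by simp
      have "integrable lborel (pd i (\<lambda>y. f (boost e s y)))" for i
      proof -
        obtain q where q: "cball (0::real^'n) (cosh \<bar>s\<bar> * (2 * R + 1)) \<subseteq> cbox (- q) q"
          using bounded_subset_cbox_symmetric[of "cball (0::real^'n) (cosh \<bar>s\<bar> * (2 * R + 1))"] by auto
        show ?thesis
        proof (rule integral_lborel_cbox(1)[OF c, of "- q" q])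
          fix y assume y: "y \<notin> cbox (- q) q"
          have "pd i (\<lambda>y. f (boost e s y)) y = pd i (\<lambda>_. 0) y"
          proof (rule pd_cong_open)
            show "open (- cball (0::real^'n) (cosh \<bar>s\<bar> * (2 * R + 1)))" by auto
          qed (use y q sup in \<open>auto simp: not_le\<close>)
          then show "pd i (\<lambda>y. f (boost e s y)) y = 0" by simp
        qed
      qed
      then have "(LINT y|lborel. (\<Sum>i\<in>UNIV. e $ i * pd i (\<lambda>y. f (boost e s y)) y))
          = (\<Sum>i\<in>UNIV. e $ i * (LINT y|lborel. pd i (\<lambda>y. f (boost e s y)) y))"
        by (subst Bochner_Integration.integral_sum) auto
      also have "\<dots> = 0"
        using integral_pd_eq_0[OF boost_chain(1)[OF e d] c sup] by simp
      finally show ?thesis .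
    qed
    finally show ?thesis .
  qed
  then have "(LINT y|lborel. f (boost e t y) / hgt y) = (LINT y|lborel. f (boost e 0 y) / hgt y)"
    using DERIV_isconst_all by blast
  then show ?thesis by (simp add: boost_zero[OF e])
qed

lemma pole_boost_exists:
  fixes p :: "real^'n"
  obtains e t where "norm e = 1" "boost e t p = 0"
proof (cases "p = 0")
  case True
  have "norm (axis undefined 1 :: real^'n) = 1" by simp
  moreover have "boost (axis undefined 1 :: real^'n) 0 p = 0" by (simp add: True boost_def boost_len_def)
  ultimately show ?thesis by (rule that)
next
  case False
  define e where "e = p /\<^sub>R norm p"
  \<comment> \<open>The distance from p to the origin, as norm p = sinh a; the boost has rapidity
    -a.\<close>
  define a where "a = arsinh (norm p)"
  have e: "norm e = 1" using False by (simp add: e_def)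
  have p: "p = sinh a *\<^sub>R e" using False by (simp add: a_def e_def)
  have h: "hgt p = cosh a"
  proof (rule power2_eq_imp_eq)
    show "(hgt p)\<^sup>2 = (cosh a)\<^sup>2"
      by (simp add: hgt_sq cosh_square_eq a_def power2_norm_eq_inner)
  qed auto
  have "e \<bullet> p = sinh a" by (simp add: p inner_e[OF e])
  then have "boost e (- a) p = (sinh a + ((cosh a - 1) * sinh a - sinh a * cosh a)) *\<^sub>R e"
    by (simp add: boost_def boost_len_def h) (simp add: p scaleR_add_left)
  also have "\<dots> = 0" by (simp add: algebra_simps)
  finally show ?thesis by (rule that[OF e])
qed

section \<open>Radial and angular derivatives at the pole 0\<close>

text \<open>\<open>ang j f\<close> is the \<open>j\<close>-th Cartesian component of the spherical gradient of \<open>f\<close>.\<close>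

definition ang :: "'n \<Rightarrow> (real^'n \<Rightarrow> real) \<Rightarrow> real^'n \<Rightarrow> real" where
  "ang j f y = norm y * pd j f y - (y $ j / norm y) * euler f y"

lemma open_Compl_0: "open (- {0::real^'n})"
  by (simp add: open_Compl)

lemma smooth_on_norm: "smooth_on (- {0}) (norm :: real^'n \<Rightarrow> real)"
  unfolding norm_eq_sqrt_inner[abs_def] by (intro smooth_on_intros open_Compl_0) auto

text \<open>Since f vanishes near the pole, a singularity of w there does no harm.\<close>

lemma Ck_on_weight:
  assumes "Ck_on k (- {0}) w" "Ck_on k UNIV f" "d > 0" "\<And>x. dist x 0 < d \<Longrightarrow> f x = 0"
  shows "Ck_on k UNIV (\<lambda>x. w x * f x)"
proof -
  have "Ck_on k (- {0}) (\<lambda>x. w x * f x)"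
    by (rule Ck_on_mult[OF open_Compl_0 assms(1) Ck_on_subset[OF assms(2)]]) auto
  moreover have "Ck_on k (ball 0 d) (\<lambda>x. w x * f x)"
    by (rule Ck_on_cong[OF _ _ Ck_on_const[of _ _ 0]]) (use assms(4) in \<open>auto simp: dist_commute\<close>)
  ultimately have "Ck_on k (- {0} \<union> ball 0 d) (\<lambda>x. w x * f x)"
    by (rule Ck_on_Un[OF open_Compl_0 open_ball])
  moreover have "- {0} \<union> ball (0::real^'n) d = UNIV" using assms(3) by auto
  ultimately show ?thesis by metis
qed

lemma pd_zero_on:
  assumes "open S" "\<And>x. x \<in> S \<Longrightarrow> f x = 0" "x \<in> S"
  shows "pd i f x = 0"
  using pd_cong_open[of S x f "\<lambda>_. 0" i] assms by simp

lemma test_smooth: "f \<in> test_functions p \<Longrightarrow> smooth_on UNIV f"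
  by (simp add: test_functions_iff)

lemma test_differentiable: "f \<in> test_functions p \<Longrightarrow> f differentiable (at y)"
  using smooth_on_differentiable[OF open_UNIV test_smooth] by blast

lemma test_weight:
  assumes "smooth_on (- {0}) w" "f \<in> test_functions 0"
  shows "(\<lambda>x. w x * f x) \<in> test_functions 0"
proof -
  obtain R d where f: "smooth_on UNIV f" "\<And>x. norm x > R \<Longrightarrow> f x = 0" "d > 0" "\<And>x. dist x 0 < d \<Longrightarrow> f x = 0"
    using assms(2) unfolding test_functions_iff by blast
  have "smooth_on UNIV (\<lambda>x. w x * f x)"
    unfolding smooth_on_def
    by (intro allI Ck_on_weight[OF _ _ f(3,4)]) (use assms(1) f(1) in \<open>auto simp: smooth_on_def\<close>)
  then show ?thesis
    unfolding test_functions_iff using f(2-4)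
    by (intro conjI exI[of _ R] exI[of _ d]) auto
qed

lemma test_add:
  assumes "f \<in> test_functions p" "g \<in> test_functions p"
  shows "(\<lambda>x. f x + g x) \<in> test_functions p"
proof -
  obtain R d where f: "smooth_on UNIV f" "\<And>x. norm x > R \<Longrightarrow> f x = 0" "d > 0" "\<And>x. dist x p < d \<Longrightarrow> f x = 0"
    using assms(1) unfolding test_functions_iff by blast
  obtain R' d' where g: "smooth_on UNIV g" "\<And>x. norm x > R' \<Longrightarrow> g x = 0" "d' > 0" "\<And>x. dist x p < d' \<Longrightarrow> g x = 0"
    using assms(2) unfolding test_functions_iff by blast
  have "smooth_on UNIV (\<lambda>x. f x + g x)" by (intro smooth_on_add f g) auto
  moreover have "\<exists>R. \<forall>x. norm x > R \<longrightarrow> f x + g x = 0"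
    using f g by (intro exI[of _ "max R R'"]) auto
  moreover have "\<exists>d>0. \<forall>x. dist x p < d \<longrightarrow> f x + g x = 0"
    using f g by (intro exI[of _ "min d d'"]) auto
  ultimately show ?thesis unfolding test_functions_iff by blast
qed

lemma test_zero: "(\<lambda>x. 0) \<in> test_functions p"
  unfolding test_functions_iff by (auto intro: smooth_on_const exI[of _ 1])

lemma test_sum: "finite I \<Longrightarrow> (\<And>i. i \<in> I \<Longrightarrow> f i \<in> test_functions p) \<Longrightarrow> (\<lambda>x. \<Sum>i\<in>I. f i x) \<in> test_functions p"
  by (induction I rule: finite_induct) (auto intro: test_zero test_add)

lemma test_pd:
  assumes "f \<in> test_functions p"
  shows "pd i f \<in> test_functions p"
proof -
  obtain R d where f: "smooth_on UNIV f" "\<And>x. norm x > R \<Longrightarrow> f x = 0" "d > 0" "\<And>x. dist x p < d \<Longrightarrow> f x = 0"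
    using assms(1) unfolding test_functions_iff by blast
  have "pd i f x = 0" if "norm x > R" for x
    by (rule pd_zero_on[of "- cball 0 R"]) (use f that in auto)
  moreover have "pd i f x = 0" if "dist x p < d" for x
    by (rule pd_zero_on[of "ball p d"]) (use f that in \<open>auto simp: dist_commute\<close>)
  ultimately show ?thesis
    using smooth_on_pd[OF f(1)] f(3) unfolding test_functions_iff by blast
qed

lemma test_euler: "f \<in> test_functions 0 \<Longrightarrow> euler f \<in> test_functions 0"
  unfolding euler_def[abs_def]
  by (intro test_sum test_weight test_pd smooth_on_component open_Compl_0) auto

lemma smooth_on_coth: "smooth_on (- {0}) (\<lambda>y::real^'n. hgt y / norm y)"
  by (intro smooth_on_divide smooth_on_hgt smooth_on_norm open_Compl_0) auto

lemma smooth_on_theta: "smooth_on (- {0}) (\<lambda>y::real^'n. y $ j / norm y)"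
  by (intro smooth_on_divide smooth_on_component smooth_on_norm open_Compl_0) auto

lemma test_dr: "f \<in> test_functions 0 \<Longrightarrow> dr f \<in> test_functions 0"
  unfolding dr_def[abs_def] by (intro test_weight smooth_on_coth test_euler)

lemma test_ang: "f \<in> test_functions 0 \<Longrightarrow> ang j f \<in> test_functions 0"
proof -
  assume f: "f \<in> test_functions 0"
  have "(\<lambda>y. norm y * pd j f y + (- (y $ j / norm y)) * euler f y) \<in> test_functions 0"
    by (intro test_add test_weight smooth_on_norm smooth_on_uminus smooth_on_theta open_Compl_0 test_euler test_pd f)
  then show ?thesis by (simp add: ang_def[abs_def])
qed

subsection \<open>Derivation rules\<close>

lemma euler_add: "f differentiable (at y) \<Longrightarrow> g differentiable (at y) \<Longrightarrow>
    euler (\<lambda>x. f x + g x) y = euler f y + euler g y"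
  unfolding euler_def sum.distrib[symmetric] by (rule sum.cong) (auto simp: pd_add algebra_simps)

lemma euler_mult: "f differentiable (at y) \<Longrightarrow> g differentiable (at y) \<Longrightarrow>
    euler (\<lambda>x. f x * g x) y = euler f y * g y + f y * euler g y"
  unfolding euler_def sum_distrib_left sum_distrib_right sum.distrib[symmetric]
  by (rule sum.cong) (auto simp: pd_mult algebra_simps)

lemma ang_add: "f differentiable (at y) \<Longrightarrow> g differentiable (at y) \<Longrightarrow>
    ang j (\<lambda>x. f x + g x) y = ang j f y + ang j g y"
  by (simp add: ang_def euler_add pd_add algebra_simps)

lemma ang_mult: "f differentiable (at y) \<Longrightarrow> g differentiable (at y) \<Longrightarrow>
    ang j (\<lambda>x. f x * g x) y = ang j f y * g y + f y * ang j g y"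
  by (simp add: ang_def euler_mult pd_mult algebra_simps)

lemma dr_mult: "f differentiable (at y) \<Longrightarrow> g differentiable (at y) \<Longrightarrow>
    dr (\<lambda>x. f x * g x) y = dr f y * g y + f y * dr g y"
  by (simp add: dr_def euler_mult algebra_simps)

lemma differentiable_hyp_dist: "y \<noteq> 0 \<Longrightarrow> (\<lambda>y. rad y) differentiable (at y)"
  and pd_hyp_dist: "y \<noteq> 0 \<Longrightarrow> pd i (\<lambda>y. rad y) y = y $ i / (norm y * hgt y)"
proof -
  assume y: "y \<noteq> 0"
  then have h1: "hgt y > 1"
    using hgt_sq[of y] by (intro power2_less_imp_less[of 1]) auto
  have s: "sqrt ((hgt y)\<^sup>2 - 1) = norm y" by (simp add: hgt_sq norm_eq_sqrt_inner)
  have "(arcosh has_real_derivative 1 / norm y) (at (hgt y))"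
    using arcosh_real_has_field_derivative[OF h1, of UNIV] by (simp add: s)
  note * = pd_comp1[OF differentiable_hgt this]
  show "(\<lambda>y. rad y) differentiable (at y)" using *(2) by (simp add: hyp_dist_zero)
  show "pd i (\<lambda>y. rad y) y = y $ i / (norm y * hgt y)"
    using *(1)[of i] by (simp add: hyp_dist_zero pd_hgt)
qed

lemma hyp_dist_zero_pos: "y \<noteq> 0 \<Longrightarrow> rad y > 0"
  using sinh_hyp_dist_zero[of y] hyp_dist_zero_nonneg[of y] by (metis less_eq_real_def norm_eq_zero sinh_0)

lemma radial_derivs:
  assumes y: "(y::real^'n) \<noteq> 0" and F: "(F has_real_derivative d) (at (rad y))"
  shows "dr (\<lambda>y. F (rad y)) y = d" "ang j (\<lambda>y. F (rad y)) y = 0"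
    "(\<lambda>y. F (rad y)) differentiable (at y)"
proof -
  note * = pd_comp1[OF differentiable_hyp_dist[OF y] F]
  have "euler (\<lambda>y. F (rad y)) y = (\<Sum>i\<in>UNIV. (d / (norm y * hgt y)) * (y $ i * y $ i))"
    unfolding euler_def by (rule sum.cong) (auto simp: *(1) pd_hyp_dist[OF y])
  also have "\<dots> = d / (norm y * hgt y) * (norm y)\<^sup>2"
    by (simp add: power2_norm_eq_inner inner_vec_def sum_distrib_left)
  finally have E: "euler (\<lambda>y. F (rad y)) y = d * norm y / hgt y"
    using y by (simp add: power2_eq_square)
  show "dr (\<lambda>y. F (rad y)) y = d" using y by (simp add: dr_def E)
  show "ang j (\<lambda>y. F (rad y)) y = 0" using y by (simp add: ang_def E *(1) pd_hyp_dist[OF y])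
  show "(\<lambda>y. F (rad y)) differentiable (at y)" by (rule *(2))
qed

lemma pd_norm: "(y::real^'n) \<noteq> 0 \<Longrightarrow> pd i norm y = y $ i / norm y"
proof -
  assume y: "y \<noteq> 0"
  have "(norm has_derivative (\<lambda>h. sgn y \<bullet> h)) (at y)"
    using has_derivative_norm[of y] y by (simp add: inner_commute)
  from pd_eq[OF this] show ?thesis by (simp add: inner_axis sgn_div_norm divide_inverse mult.commute)
qed

lemma differentiable_norm: "(y::real^'n) \<noteq> 0 \<Longrightarrow> norm differentiable (at y)"
  by (rule smooth_on_differentiable[OF open_Compl_0 smooth_on_norm]) simp

lemma norm_mult_self: "norm y * norm y = (\<Sum>i\<in>UNIV. y $ i * y $ (i::'n::finite))" for y :: "real^'n"
  using power2_norm_eq_inner[of y] by (simp add: inner_vec_def power2_eq_square)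

lemma differentiable_theta: "(y::real^'n) \<noteq> 0 \<Longrightarrow> (\<lambda>y. y $ k / norm y) differentiable (at y)"
  by (rule smooth_on_differentiable[OF open_Compl_0 smooth_on_theta]) simp

lemma pd_theta:
  assumes y: "(y::real^'n) \<noteq> 0"
  shows "pd j (\<lambda>y. y $ k / norm y) y = (if j = k then 1 else 0) / norm y - y $ j * y $ k / (norm y)^3"
proof -
  have inv: "((\<lambda>t. inverse t) has_real_derivative - (1 / (norm y)\<^sup>2)) (at (norm y))"
    using y by (auto intro!: derivative_eq_intros simp: field_simps power2_eq_square)
  have "pd j (\<lambda>y. y $ k * inverse (norm y)) y
      = (if j = k then 1 else 0) * inverse (norm y) + y $ k * (- (1 / (norm y)\<^sup>2) * (y $ j / norm y))"
    using pd_mult[OF differentiable_component pd_comp1(2)[OF differentiable_norm[OF y] inv]]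
    by (simp add: pd_component pd_comp1(1)[OF differentiable_norm[OF y] inv] pd_norm[OF y])
  then show ?thesis by (simp add: divide_inverse power2_eq_square power3_eq_cube mult_ac)
qed

lemma euler_theta:
  assumes y: "(y::real^'n) \<noteq> 0"
  shows "euler (\<lambda>y. y $ k / norm y) y = 0"
proof -
  have "euler (\<lambda>y. y $ k / norm y) y
    = (\<Sum>j\<in>UNIV. (if j = k then y $ k / norm y else 0) - y $ k / (norm y)^3 * (y $ j * y $ j))"
    unfolding euler_def by (rule sum.cong) (auto simp: pd_theta[OF y] algebra_simps)
  also have "\<dots> = y $ k / norm y - y $ k / (norm y)^3 * (norm y * norm y)"
    unfolding sum_subtractf norm_mult_self sum_distrib_left by simp
  finally show ?thesis using y by (simp add: power3_eq_cube)
qed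

lemma euler_norm: "(y::real^'n) \<noteq> 0 \<Longrightarrow> euler norm y = norm y"
  by (simp add: euler_def pd_norm norm_mult_self flip: sum_divide_distrib)
    (simp add: norm_mult_self[symmetric])

lemma ang_theta:
  assumes y: "(y::real^'n) \<noteq> 0"
  shows "ang j (\<lambda>y. y $ k / norm y) y = (if j = k then 1 else 0) - (y $ j / norm y) * (y $ k / norm y)"
  using y by (simp add: ang_def pd_theta euler_theta power3_eq_cube field_simps)

lemma sum_theta_ang:
  assumes y: "(y::real^'n) \<noteq> 0"
  shows "(\<Sum>j\<in>UNIV. (y $ j / norm y) * ang j f y) = 0"
proof -
  have "(\<Sum>j\<in>UNIV. (y $ j / norm y) * ang j f y)
      = (\<Sum>j\<in>UNIV. y $ j * pd j f y - euler f y / (norm y * norm y) * (y $ j * y $ j))"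
    by (rule sum.cong) (use y in \<open>auto simp: ang_def field_simps\<close>)
  also have "\<dots> = euler f y - euler f y / (norm y * norm y) * (norm y * norm y)"
    unfolding sum_subtractf sum_distrib_left norm_mult_self[of y] euler_def ..
  finally show ?thesis using y by simp
qed

lemma sum_theta_sq: "(y::real^'n) \<noteq> 0 \<Longrightarrow> (\<Sum>j\<in>UNIV. (y $ j / norm y) * (y $ j / norm y)) = 1"
  by (simp add: norm_mult_self flip: sum_divide_distrib)
    (simp add: norm_mult_self[symmetric])

section \<open>Commutation rules and the polar form of the Laplacian\<close>

context
  fixes u :: "real^'n \<Rightarrow> real" and y :: "real^'n"
  assumes u: "smooth_on UNIV u" and y: "y \<noteq> 0"
begin

lemma polar_differentiable:
  "u differentiable (at y)" "pd i u differentiable (at y)" "euler u differentiable (at y)"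
  "ang j u differentiable (at y)" "dr u differentiable (at y)"
proof -
  show "u differentiable (at y)" "pd i u differentiable (at y)" "euler u differentiable (at y)"
    by (auto intro!: smooth_on_differentiable[OF open_UNIV] u smooth_on_pd smooth_on_euler)
  have "smooth_on (- {0}) f" if "smooth_on UNIV f" for f :: "real^'n \<Rightarrow> real"
    using smooth_on_subset[OF that] by auto
  note * = this[OF u] this[OF smooth_on_pd[OF u]] this[OF smooth_on_euler[OF open_UNIV u]]
  have "smooth_on (- {0}) (ang j u)"
    unfolding ang_def[abs_def]
    by (intro smooth_on_diff smooth_on_mult smooth_on_norm smooth_on_theta * open_Compl_0)
  then show "ang j u differentiable (at y)"
    by (rule smooth_on_differentiable[OF open_Compl_0]) (use y in simp)
  have "smooth_on (- {0}) (dr u)"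
    unfolding dr_def[abs_def]
    by (intro smooth_on_mult smooth_on_coth * open_Compl_0)
  then show "dr u differentiable (at y)"
    by (rule smooth_on_differentiable[OF open_Compl_0]) (use y in simp)
qed

lemma pd_euler: "pd j (euler u) y = pd j u y + euler (pd j u) y"
proof -
  have "pd j (euler u) y = (\<Sum>i\<in>UNIV. (if j = i then pd i u y else 0) + y $ i * pd i (pd j u) y)"
    unfolding euler_def[abs_def]
    by (subst pd_sum) (auto simp: pd_mult polar_differentiable pd_component differentiable_component pd_commute[OF open_UNIV u]
        intro!: differentiable_mult sum.cong)
  then show ?thesis by (simp add: sum.distrib euler_def)
qed

lemma euler_euler: "euler (euler u) y = euler u y + (\<Sum>j\<in>UNIV. y $ j * euler (pd j u) y)"
proof -
  have "euler (euler u) y = (\<Sum>j\<in>UNIV. y $ j * pd j u y + y $ j * euler (pd j u) y)"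
    unfolding euler_def[of "euler u"] pd_euler distrib_left ..
  then show ?thesis by (simp add: sum.distrib euler_def[of u])
qed

lemma pd_ang:
  "pd j (ang k u) y = (y $ j / norm y) * pd k u y + norm y * pd j (pd k u) y
    - ((if j = k then 1 else 0) / norm y - y $ j * y $ k / (norm y)^3) * euler u y
    - (y $ k / norm y) * (pd j u y + euler (pd j u) y)"
proof -
  define E where "E y = - euler u y" for y
  define th where "th y = y $ k / norm y" for y :: "real^'n"
  have e: "ang k u = (\<lambda>y. norm y * pd k u y + th y * E y)"
    by (auto simp: ang_def th_def E_def)
  have E: "E differentiable (at y)" "pd j E y = - pd j (euler u) y"
    using polar_differentiable pd_mult[of "\<lambda>_. - 1" y "euler u" j] by (auto simp: E_def[abs_def] intro!: derivative_intros)
  have th: "th differentiable (at y)"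
    "pd j th y = (if j = k then 1 else 0) / norm y - y $ j * y $ k / (norm y)^3"
    using differentiable_theta[OF y] pd_theta[OF y] by (simp_all add: th_def[abs_def])
  have "pd j (ang k u) y = (y $ j / norm y) * pd k u y + norm y * pd j (pd k u) y
      + (((if j = k then 1 else 0) / norm y - y $ j * y $ k / (norm y)^3) * E y + th y * (- pd j (euler u) y))"
    unfolding e using y
    by (simp add: pd_add pd_mult polar_differentiable differentiable_norm differentiable_mult E th pd_norm)
  then show ?thesis
    unfolding pd_euler E_def th_def by (simp add: algebra_simps diff_divide_distrib add_divide_distrib)
qed

lemma euler_ang: "euler (ang k u) y = norm y * pd k u y + norm y * euler (pd k u) y - (y $ k / norm y) * euler (euler u) y"
proof -
  define E where "E y = - euler u y" for y
  define th where "th y = y $ k / norm y" for y :: "real^'n"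
  have e: "ang k u = (\<lambda>y. norm y * pd k u y + th y * E y)"
    by (auto simp: ang_def th_def E_def)
  have E: "E differentiable (at y)" "euler E y = - euler (euler u) y"
    using polar_differentiable euler_mult[of "\<lambda>_. - 1" y "euler u"]
    by (auto simp: E_def[abs_def] euler_def[of "\<lambda>_. - 1"] intro!: derivative_intros)
  have th: "th differentiable (at y)" "euler th y = 0"
    using differentiable_theta[OF y] euler_theta[OF y] by (simp_all add: th_def[abs_def])
  have "euler (ang k u) y = norm y * pd k u y + norm y * euler (pd k u) y + th y * (- euler (euler u) y)"
    unfolding e using y
    by (simp add: euler_add euler_mult polar_differentiable differentiable_norm differentiable_mult E th euler_norm)
  then show ?thesis by (simp add: th_def)
qed

lemma ang_ang:
  "ang j (ang k u) y = (norm y)\<^sup>2 * pd j (pd k u) y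
    - ((if j = k then 1 else 0) - (y $ j / norm y) * (y $ k / norm y)) * euler u y
    - y $ k * pd j u y - y $ k * euler (pd j u) y - y $ j * euler (pd k u) y
    + (y $ j / norm y) * (y $ k / norm y) * euler (euler u) y"
  using y by (simp add: ang_def[of j] pd_ang euler_ang power2_eq_square power3_eq_cube field_simps)

text \<open>Tangential projections of constant vectors do not commute; their bracket is a rotation
  field, written here through the fields themselves.\<close>

lemma ang_commutator:
  "ang j (ang k u) y = ang k (ang j u) y + (y $ j / norm y) * ang k u y - (y $ k / norm y) * ang j u y"
proof -
  have "pd j (pd k u) y = pd k (pd j u) y" by (rule pd_commute[OF open_UNIV u]) simp
  then show ?thesis using y by (simp add: ang_ang) (simp add: ang_def field_simps)
qed

text \<open>The derivative of the tangency relation \<open>sum_theta_ang\<close>, obtained by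
  exchanging the two angular derivatives. It expresses the second fundamental form of the
  sphere.\<close>

lemma sum_theta_ang_ang: "(\<Sum>k\<in>UNIV. (y $ k / norm y) * ang j (ang k u) y) = - ang j u y"
proof -
  have "(\<Sum>k\<in>UNIV. (y $ k / norm y) * ang j (ang k u) y)
    = (\<Sum>k\<in>UNIV. (y $ k / norm y) * ang k (ang j u) y + (y $ j / norm y) * ((y $ k / norm y) * ang k u y)
        - ang j u y * ((y $ k / norm y) * (y $ k / norm y)))"
  proof (rule sum.cong)
    show "(y $ k / norm y) * ang j (ang k u) y
      = (y $ k / norm y) * ang k (ang j u) y + (y $ j / norm y) * ((y $ k / norm y) * ang k u y)
        - ang j u y * ((y $ k / norm y) * (y $ k / norm y))" for k
      unfolding ang_commutator[of j k] by (simp add: algebra_simps)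
  qed simp
  also have "\<dots> = - ang j u y"
    unfolding sum_subtractf sum.distrib sum_distrib_left[symmetric]
    by (simp only: sum_theta_ang[OF y] sum_theta_sq[OF y])
  finally show ?thesis .
qed

lemma hyp_dist_has_derivative_coth:
  "((\<lambda>s. cosh s / sinh s) has_real_derivative - 1 / (norm y)\<^sup>2) (at (rad y))"
proof -
  have n: "sinh (rad y) \<noteq> 0" using y by simp
  have "hgt y * hgt y = 1 + norm y * norm y"
    using hgt_sq[of y] by (simp add: power2_eq_square flip: power2_norm_eq_inner)
  then have "(norm y * norm y - hgt y * hgt y) / (norm y * norm y) = - 1 / (norm y)\<^sup>2"
    by (simp add: power2_eq_square)
  moreover have "((\<lambda>s. cosh s / sinh s) has_real_derivative (norm y * norm y - hgt y * hgt y) / (norm y * norm y))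
      (at (rad y))"
    using n by (auto intro!: derivative_eq_intros)
  ultimately show ?thesis by simp
qed

lemma coth_derivs:
  "dr (\<lambda>y. hgt y / norm y) y = - 1 / (norm y)\<^sup>2" "ang j (\<lambda>y. hgt y / norm y) y = 0"
  "(\<lambda>y. hgt y / norm y) differentiable (at y)"
  using radial_derivs[OF y hyp_dist_has_derivative_coth] by simp_all

text \<open>The factor norm y in \<open>ang\<close> makes the field homogeneous of degree 0, so it
  commutes with \<open>euler\<close>; the remaining factor hgt / norm of \<open>dr\<close> is
  radial, hence annihilated by \<open>ang j\<close>.\<close>

lemma ang_dr: "ang j (dr u) y = dr (ang j u) y"
proof -
  have "ang j (dr u) y = (hgt y / norm y) * ang j (euler u) y"
  proof -
    have "ang j (dr u) y = ang j (\<lambda>y. hgt y / norm y) y * euler u y + (hgt y / norm y) * ang j (euler u) y"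
      unfolding dr_def[abs_def] by (rule ang_mult) (auto intro: coth_derivs polar_differentiable)
    then show ?thesis by (simp add: coth_derivs)
  qed
  also have "ang j (euler u) y = euler (ang j u) y"
    by (simp add: ang_def[of j "euler u"] pd_euler euler_ang distrib_left)
  finally show ?thesis unfolding dr_def[of "ang j u"] .
qed

lemma dr_dr: "dr (dr u) y = ((hgt y)\<^sup>2 * euler (euler u) y - euler u y) / (norm y)\<^sup>2"
proof -
  have "dr (dr u) y = dr (\<lambda>y. hgt y / norm y) y * euler u y + (hgt y / norm y) * dr (euler u) y"
    unfolding dr_def[of u, abs_def] by (rule dr_mult) (auto intro: coth_derivs polar_differentiable)
  then show ?thesis
    using y by (simp add: coth_derivs dr_def[of "euler u"] field_simps power2_eq_square)
qed

text \<open>The Euclidean polar decomposition of the Laplacian, solved for its spherical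
  part.\<close>

lemma sum_ang_ang: "(\<Sum>j\<in>UNIV. ang j (ang j u) y)
    = (norm y)\<^sup>2 * (\<Sum>j\<in>UNIV. pd j (pd j u) y) - euler (euler u) y - (real CARD('n) - 2) * euler u y"
proof -
  have "(\<Sum>j\<in>UNIV. ang j (ang j u) y) = (\<Sum>j\<in>UNIV. (norm y)\<^sup>2 * pd j (pd j u) y
     - euler u y + ((y $ j / norm y) * (y $ j / norm y)) * (euler u y + euler (euler u) y) - y $ j * pd j u y
     - 2 * (y $ j * euler (pd j u) y))"
    by (rule sum.cong) (auto simp: ang_ang add_divide_distrib algebra_simps)
  also have "\<dots> = (norm y)\<^sup>2 * (\<Sum>j\<in>UNIV. pd j (pd j u) y) - real CARD('n) * euler u y
      + (\<Sum>j\<in>UNIV. (y $ j / norm y) * (y $ j / norm y)) * (euler u y + euler (euler u) y)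
      - euler u y - 2 * (\<Sum>j\<in>UNIV. y $ j * euler (pd j u) y)"
    unfolding sum_subtractf sum.distrib sum_distrib_left[symmetric] sum_distrib_right[symmetric] euler_def[of u]
    by simp
  also have "(\<Sum>j\<in>UNIV. y $ j * euler (pd j u) y) = euler (euler u) y - euler u y"
    by (simp add: euler_euler)
  finally show ?thesis by (simp only: sum_theta_sq[OF y]) (simp add: algebra_simps)
qed

lemma hyp_laplacian_polar:
  "hyp_laplacian u y = dr (dr u) y + (real CARD('n) - 1) * (hgt y / norm y) * dr u y
    + (\<Sum>j\<in>UNIV. ang j (ang j u) y) / (norm y)\<^sup>2"
proof -
  have h: "(hgt y)\<^sup>2 = 1 + (norm y)\<^sup>2" by (simp add: hgt_sq power2_norm_eq_inner)
  have "dr (dr u) y + (real CARD('n) - 1) * (hgt y / norm y) * dr u y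
    + (\<Sum>j\<in>UNIV. ang j (ang j u) y) / (norm y)\<^sup>2
    = (((hgt y)\<^sup>2 * euler (euler u) y - euler u y) + (real CARD('n) - 1) * (hgt y)\<^sup>2 * euler u y
       + ((norm y)\<^sup>2 * (\<Sum>j\<in>UNIV. pd j (pd j u) y) - euler (euler u) y - (real CARD('n) - 2) * euler u y)) / (norm y)\<^sup>2"
    unfolding dr_dr sum_ang_ang add_divide_distrib dr_def[of u] by (simp add: power2_eq_square)
  also have "\<dots> = ((norm y)\<^sup>2 * ((\<Sum>j\<in>UNIV. pd j (pd j u) y) + euler (euler u) y + (real CARD('n) - 1) * euler u y)) / (norm y)\<^sup>2"
    unfolding h by (rule arg_cong[where f = "\<lambda>z. z / (norm y)\<^sup>2"]) (simp add: algebra_simps)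
  also have "\<dots> = hyp_laplacian u y"
    using y by (simp add: hyp_laplacian_eq[OF open_UNIV u])
  finally show ?thesis ..
qed

end

text \<open>Algebraic in the values of the partial derivatives at y, so it applies to arbitrary f,
  including quotients by \<open>Psi\<close>.\<close>

lemma hyp_grad2_polar:
  fixes y :: "real^'n"
  assumes y: "y \<noteq> 0"
  shows "hyp_grad2 f y = (dr f y)\<^sup>2 + (\<Sum>j\<in>UNIV. (ang j f y)\<^sup>2) / (norm y)\<^sup>2"
proof -
  have h: "(hgt y)\<^sup>2 = 1 + (norm y)\<^sup>2" by (simp add: hgt_sq power2_norm_eq_inner)
  have "(\<Sum>j\<in>UNIV. (ang j f y)\<^sup>2) = (\<Sum>j\<in>UNIV. (norm y)\<^sup>2 * (pd j f y)\<^sup>2 - 2 * euler f y * (y $ j * pd j f y)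
      + (euler f y)\<^sup>2 * ((y $ j / norm y) * (y $ j / norm y)))"
    by (rule sum.cong) (use y in \<open>auto simp: ang_def power2_eq_square field_simps\<close>)
  also have "\<dots> = (norm y)\<^sup>2 * (\<Sum>j\<in>UNIV. (pd j f y)\<^sup>2) - 2 * euler f y * euler f y
      + (euler f y)\<^sup>2 * (\<Sum>j\<in>UNIV. (y $ j / norm y) * (y $ j / norm y))"
    unfolding sum.distrib sum_subtractf sum_distrib_left[symmetric] euler_def ..
  finally have "(\<Sum>j\<in>UNIV. (ang j f y)\<^sup>2) = (norm y)\<^sup>2 * (\<Sum>j\<in>UNIV. (pd j f y)\<^sup>2) - (euler f y)\<^sup>2"
    by (simp only: sum_theta_sq[OF y]) (simp add: power2_eq_square)
  moreover have "(dr f y)\<^sup>2 = (1 + (norm y)\<^sup>2) * (euler f y)\<^sup>2 / (norm y)\<^sup>2"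
    by (simp add: dr_def power_mult_distrib power_divide h)
  ultimately show ?thesis
    using y by (simp add: hyp_grad2_eq field_simps)
qed

section \<open>Integration by parts at the pole 0\<close>

text \<open>A class closed under weights that are continuous off the pole, and on which all the
  integrals below are finite and linear.\<close>

definition cc0 :: "(real^'n \<Rightarrow> real) \<Rightarrow> bool" where
  "cc0 f \<longleftrightarrow> continuous_on UNIV f \<and> (\<exists>R. \<forall>x. norm x > R \<longrightarrow> f x = 0)
     \<and> (\<exists>d>0. \<forall>x. dist x 0 < d \<longrightarrow> f x = 0)"

definition hyp_int :: "(real^'n \<Rightarrow> real) \<Rightarrow> real" where
  "hyp_int f = (LINT y|lborel. f y / hgt y)"

lemma cc0_at_0: "cc0 f \<Longrightarrow> f 0 = 0"
  by (auto simp: cc0_def)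

lemma cc0_test: "f \<in> test_functions 0 \<Longrightarrow> cc0 f"
  unfolding cc0_def test_functions_iff using smooth_on_continuous by blast

lemma cc0_weight:
  assumes "continuous_on (- {0}) w" "cc0 f"
  shows "cc0 (\<lambda>y. w y * f y)"
proof -
  obtain R d where f: "continuous_on UNIV f" "\<And>x. norm x > R \<Longrightarrow> f x = 0" "d > 0" "\<And>x. dist x 0 < d \<Longrightarrow> f x = 0"
    using assms(2) unfolding cc0_def by blast
  have "continuous_on UNIV (\<lambda>y. w y * f y)"
    using Ck_on_weight[of 0 w f d] assms(1) f by simp
  moreover have "\<exists>R. \<forall>x. norm x > R \<longrightarrow> w x * f x = 0" using f(2) by (intro exI[of _ R]) auto
  moreover have "\<exists>d>0. \<forall>x. dist x 0 < d \<longrightarrow> w x * f x = 0" using f(3,4) by (intro exI[of _ d]) auto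
  ultimately show ?thesis unfolding cc0_def by blast
qed

lemma cc0_add:
  assumes "cc0 f" "cc0 g"
  shows "cc0 (\<lambda>x. f x + g x)"
proof -
  obtain R d where f: "continuous_on UNIV f" "\<And>x. norm x > R \<Longrightarrow> f x = 0" "d > 0" "\<And>x. dist x 0 < d \<Longrightarrow> f x = 0"
    using assms(1) unfolding cc0_def by blast
  obtain R' d' where g: "continuous_on UNIV g" "\<And>x. norm x > R' \<Longrightarrow> g x = 0" "d' > 0" "\<And>x. dist x 0 < d' \<Longrightarrow> g x = 0"
    using assms(2) unfolding cc0_def by blast
  have "continuous_on UNIV (\<lambda>x. f x + g x)" by (intro continuous_intros f g)
  moreover have "\<exists>R. \<forall>x. norm x > R \<longrightarrow> f x + g x = 0"
    using f g by (intro exI[of _ "max R R'"]) auto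
  moreover have "\<exists>d>0. \<forall>x. dist x 0 < d \<longrightarrow> f x + g x = 0"
    using f g by (intro exI[of _ "min d d'"]) auto
  ultimately show ?thesis unfolding cc0_def by blast
qed

lemma cc0_cmult: "cc0 f \<Longrightarrow> cc0 (\<lambda>x. c * f x)"
  by (rule cc0_weight) auto

lemma cc0_diff: "cc0 f \<Longrightarrow> cc0 g \<Longrightarrow> cc0 (\<lambda>x. f x - g x)"
  using cc0_add[OF _ cc0_cmult[of g "-1"]] by simp

lemma cc0_continuous: "cc0 f \<Longrightarrow> continuous_on S f"
  unfolding cc0_def by (auto intro: continuous_on_subset)

lemma cc0_power2: "cc0 f \<Longrightarrow> cc0 (\<lambda>x. (f x)\<^sup>2)"
  unfolding power2_eq_square by (rule cc0_weight[OF cc0_continuous])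

lemma cc0_divide:
  assumes "cc0 f" "continuous_on (- {0}) w" "\<And>y. y \<noteq> 0 \<Longrightarrow> w y \<noteq> 0"
  shows "cc0 (\<lambda>y. f y / w y)"
proof -
  have "continuous_on (- {0}) (\<lambda>y. 1 / w y)" by (intro continuous_intros assms) (use assms(3) in auto)
  from cc0_weight[OF this assms(1)] show ?thesis by simp
qed

lemma cc0_zero: "cc0 (\<lambda>x. 0)"
  by (intro cc0_test test_zero)

lemma cc0_sum: "(\<And>i. i \<in> I \<Longrightarrow> cc0 (f i)) \<Longrightarrow> cc0 (\<lambda>x. \<Sum>i\<in>I. f i x)"
  by (induction I rule: infinite_finite_induct) (auto intro: cc0_zero cc0_add)

lemmas continuous_on_polar [continuous_intros] =
  smooth_on_continuous[OF smooth_on_theta] smooth_on_continuous[OF smooth_on_coth]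

lemma continuous_on_test: "f \<in> test_functions 0 \<Longrightarrow> continuous_on S f"
  by (meson continuous_on_subset smooth_on_continuous subset_UNIV test_smooth)

lemma cc0_integrable:
  fixes f :: "real^'n \<Rightarrow> real"
  assumes "cc0 f"
  shows "integrable lborel (\<lambda>y. f y / hgt y)"
proof -
  obtain R where R: "\<And>x. norm x > R \<Longrightarrow> f x = 0" using assms unfolding cc0_def by blast
  obtain q where q: "cball (0::real^'n) R \<subseteq> cbox (- q) q"
    using bounded_subset_cbox_symmetric[of "cball (0::real^'n) R"] by auto
  show ?thesis
  proof (rule integral_lborel_cbox(1))
    show "continuous_on UNIV (\<lambda>y. f y / hgt y)"
      by (intro continuous_intros cc0_continuous assms) auto
    show "f y / hgt y = 0" if "y \<notin> cbox (- q) q" for y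
      using R[of y] q that by (auto simp: subset_eq not_le[symmetric])
  qed
qed

lemma hyp_int_add: "cc0 f \<Longrightarrow> cc0 g \<Longrightarrow> hyp_int (\<lambda>x. f x + g x) = hyp_int f + hyp_int g"
  unfolding hyp_int_def add_divide_distrib by (intro Bochner_Integration.integral_add cc0_integrable)

lemma hyp_int_diff: "cc0 f \<Longrightarrow> cc0 g \<Longrightarrow> hyp_int (\<lambda>x. f x - g x) = hyp_int f - hyp_int g"
  unfolding hyp_int_def diff_divide_distrib by (intro Bochner_Integration.integral_diff cc0_integrable)

lemma hyp_int_cmult: "hyp_int (\<lambda>x. c * f x) = c * hyp_int f"
  unfolding hyp_int_def by (simp flip: times_divide_eq_right)

lemma hyp_int_sum: "(\<And>i. i \<in> I \<Longrightarrow> cc0 (f i)) \<Longrightarrow> hyp_int (\<lambda>x. \<Sum>i\<in>I. f i x) = (\<Sum>i\<in>I. hyp_int (f i))"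
  unfolding hyp_int_def sum_divide_distrib by (intro Bochner_Integration.integral_sum cc0_integrable)

text \<open>Integrands may be compared off the pole only, where polar formulas hold; at the pole
  both vanish.\<close>

lemma hyp_int_cong: "cc0 f \<Longrightarrow> cc0 g \<Longrightarrow> (\<And>y. y \<noteq> 0 \<Longrightarrow> f y = g y) \<Longrightarrow> hyp_int f = hyp_int g"
  unfolding hyp_int_def by (rule Bochner_Integration.integral_cong) (auto, metis cc0_at_0)

lemma hyp_int_mono: "cc0 f \<Longrightarrow> cc0 g \<Longrightarrow> (\<And>y. y \<noteq> 0 \<Longrightarrow> f y \<le> g y) \<Longrightarrow> hyp_int f \<le> hyp_int g"
  unfolding hyp_int_def
proof (rule integral_mono)
  fix y assume *: "cc0 f" "cc0 g" "\<And>y. y \<noteq> 0 \<Longrightarrow> f y \<le> g y"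
  show "f y / hgt y \<le> g y / hgt y"
    using * by (cases "y = 0") (auto simp: cc0_at_0 intro!: divide_right_mono)
qed (auto intro: cc0_integrable)

lemma hyp_int_nonneg: "(\<And>y. y \<noteq> 0 \<Longrightarrow> f y \<ge> 0) \<Longrightarrow> cc0 f \<Longrightarrow> hyp_int f \<ge> 0"
  using hyp_int_mono[OF cc0_zero, of f] by (simp add: hyp_int_def)

text \<open>Each integration by parts is stated as such a null integrand. An identity between
  integrals then becomes a pointwise identity with a linear combination of null integrands.\<close>

definition int_zero :: "(real^'n \<Rightarrow> real) \<Rightarrow> bool" where
  "int_zero f \<longleftrightarrow> cc0 f \<and> hyp_int f = 0"

lemma int_zero_add: "int_zero f \<Longrightarrow> int_zero g \<Longrightarrow> int_zero (\<lambda>x. f x + g x)"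
  by (simp add: int_zero_def cc0_add hyp_int_add)

lemma int_zero_diff: "int_zero f \<Longrightarrow> int_zero g \<Longrightarrow> int_zero (\<lambda>x. f x - g x)"
  by (simp add: int_zero_def cc0_diff hyp_int_diff)

lemma int_zero_cmult: "int_zero f \<Longrightarrow> int_zero (\<lambda>x. c * f x)"
  by (simp add: int_zero_def cc0_cmult hyp_int_cmult)

lemma int_zero_sum: "(\<And>i. i \<in> I \<Longrightarrow> int_zero (f i)) \<Longrightarrow> int_zero (\<lambda>x. \<Sum>i\<in>I. f i x)"
  by (simp add: int_zero_def cc0_sum hyp_int_sum)

lemma int_zero_cong: "int_zero g \<Longrightarrow> cc0 f \<Longrightarrow> (\<And>y. y \<noteq> 0 \<Longrightarrow> f y = g y) \<Longrightarrow> int_zero f"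
  using hyp_int_cong[of f g] by (simp add: int_zero_def)

section \<open>The divergence theorem in polar form\<close>

definition c1 :: "(real^'n \<Rightarrow> real) \<Rightarrow> bool" where
  "c1 f \<longleftrightarrow> Ck_on (Suc 0) UNIV f \<and> cc0 f"

lemma c1_cc0: "c1 f \<Longrightarrow> cc0 f"
  by (simp add: c1_def)

lemma c1_differentiable: "c1 f \<Longrightarrow> f differentiable (at y)"
  by (auto simp: c1_def differentiable_on_def)

lemma c1_test: "f \<in> test_functions 0 \<Longrightarrow> c1 f"
  by (simp add: c1_def cc0_test) (metis Ck_on.simps smooth_on_def test_smooth)

lemma c1_weight:
  assumes "Ck_on (Suc 0) (- {0}) w" "c1 f"
  shows "c1 (\<lambda>y. w y * f y)"
proof -
  obtain d where f: "Ck_on (Suc 0) UNIV f" "d > 0" "\<And>x. dist x 0 < d \<Longrightarrow> f x = 0"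
    using assms(2) unfolding c1_def cc0_def by blast
  have "continuous_on (- {0}) w" using Ck_on_SucD[OF assms(1)] by simp
  then show ?thesis
    using Ck_on_weight[OF assms(1) f] cc0_weight assms(2) unfolding c1_def by blast
qed

lemma c1_weight_smooth: "smooth_on (- {0}) w \<Longrightarrow> c1 f \<Longrightarrow> c1 (\<lambda>y. w y * f y)"
  by (rule c1_weight) (auto simp: smooth_on_def simp del: Ck_on.simps)

lemma c1_mult:
  assumes "c1 f" "c1 g"
  shows "c1 (\<lambda>y. f y * g y)"
proof (rule c1_weight[OF _ assms(2)])
  show "Ck_on (Suc 0) (- {0}) f"
    using assms(1) unfolding c1_def by (blast intro: Ck_on_subset)
qed

lemma cc0_pd: "c1 f \<Longrightarrow> cc0 (pd i f)"
proof -
  assume f: "c1 f"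
  then obtain R d where z: "\<And>x. norm x > R \<Longrightarrow> f x = 0" "d > 0" "\<And>x. dist x 0 < d \<Longrightarrow> f x = 0"
    unfolding c1_def cc0_def by blast
  have "pd i f x = 0" if "norm x > R" for x
    by (rule pd_zero_on[of "- cball 0 R"]) (use z that in auto)
  moreover have "pd i f x = 0" if "dist x 0 < d" for x
    by (rule pd_zero_on[of "ball 0 d"]) (use z that in \<open>auto simp: dist_commute\<close>)
  ultimately show ?thesis using f z(2) unfolding c1_def cc0_def by auto
qed

lemma hgt_weight_cc0: "cc0 f \<Longrightarrow> cc0 (\<lambda>y. hgt y * f y)"
  by (rule cc0_weight) (auto intro!: continuous_intros)

text \<open>The factor \<open>hgt\<close> undoes the volume density, leaving a Euclidean partial
  derivative.\<close>

lemma int_zero_pd: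
  assumes "c1 f"
  shows "int_zero (\<lambda>y. hgt y * pd i f y)"
proof -
  obtain R where R: "\<And>x. norm x > R \<Longrightarrow> f x = 0" using assms unfolding c1_def cc0_def by blast
  have "(LINT y|lborel. pd i f y) = 0"
    by (rule integral_pd_eq_0[OF c1_differentiable[OF assms] cc0_continuous[OF cc0_pd[OF assms]] R])
  then show ?thesis
    using hgt_weight_cc0[OF cc0_pd[OF assms]] by (simp add: int_zero_def hyp_int_def)
qed

lemma cc0_euler: "c1 f \<Longrightarrow> cc0 (euler f)"
  unfolding euler_def[abs_def] by (intro cc0_sum cc0_weight cc0_pd) (auto intro!: continuous_intros)

lemma cc0_dr: "c1 f \<Longrightarrow> cc0 (dr f)"
  unfolding dr_def[abs_def]
  by (intro cc0_weight cc0_euler smooth_on_continuous smooth_on_coth)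

lemma cc0_ang: "c1 f \<Longrightarrow> cc0 (ang j f)"
  unfolding ang_def[abs_def]
  by (intro cc0_diff cc0_weight cc0_euler cc0_pd smooth_on_continuous smooth_on_theta smooth_on_norm)

text \<open>The divergence of X d/dr. In the chart d/dr is (hgt / norm) y, and with the density 1 /
  hgt it becomes y / norm y.\<close>

lemma int_zero_dr:
  fixes X :: "real^'n \<Rightarrow> real"
  assumes X: "c1 X"
  shows "int_zero (\<lambda>y. dr X y + (real CARD('n) - 1) * ((hgt y / norm y) * X y))"
proof (rule int_zero_cong)
  show "int_zero (\<lambda>y. \<Sum>i\<in>UNIV. hgt y * pd i (\<lambda>y. (y $ i / norm y) * X y) y)"
    by (intro int_zero_sum int_zero_pd c1_weight_smooth smooth_on_theta X)
  show "cc0 (\<lambda>y. dr X y + (real CARD('n) - 1) * ((hgt y / norm y) * X y))"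
    by (intro cc0_add cc0_cmult cc0_weight cc0_dr c1_cc0 X smooth_on_continuous smooth_on_coth)
  fix y :: "real^'n" assume y: "y \<noteq> 0"
  have "(\<Sum>i\<in>UNIV. hgt y * pd i (\<lambda>y. (y $ i / norm y) * X y) y)
      = (\<Sum>i\<in>UNIV. (hgt y / norm y) * X y - hgt y * X y / (norm y)^3 * (y $ i * y $ i)
          + (hgt y / norm y) * (y $ i * pd i X y))"
  proof (rule sum.cong)
    fix i
    show "hgt y * pd i (\<lambda>y. (y $ i / norm y) * X y) y = (hgt y / norm y) * X y
        - hgt y * X y / (norm y)^3 * (y $ i * y $ i) + (hgt y / norm y) * (y $ i * pd i X y)"
      unfolding pd_mult[OF differentiable_theta[OF y] c1_differentiable[OF X]] pd_theta[OF y]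
      by (simp add: algebra_simps diff_divide_distrib)
  qed simp
  also have "\<dots> = real CARD('n) * ((hgt y / norm y) * X y) - hgt y * X y / (norm y)^3 * (norm y * norm y)
      + (hgt y / norm y) * euler X y"
    unfolding sum.distrib sum_subtractf sum_distrib_left[symmetric] norm_mult_self[of y] euler_def by simp
  also have "\<dots> = dr X y + (real CARD('n) - 1) * ((hgt y / norm y) * X y)"
    using y by (simp add: dr_def power3_eq_cube left_diff_distrib diff_divide_distrib)
  finally show "dr X y + (real CARD('n) - 1) * ((hgt y / norm y) * X y)
    = (\<Sum>i\<in>UNIV. hgt y * pd i (\<lambda>y. (y $ i / norm y) * X y) y)" ..
qed

text \<open>The divergence of X times the field of \<open>ang j\<close>. That field is the spherical
  gradient of y_j / norm y, a spherical harmonic with eigenvalue N - 1, whence the second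
  term.\<close>

lemma int_zero_ang_div:
  fixes X :: "real^'n \<Rightarrow> real"
  assumes X: "c1 X"
  shows "int_zero (\<lambda>y. ang j X y - (real CARD('n) - 1) * ((y $ j / norm y) * X y))"
proof (rule int_zero_cong)
  \<comment> \<open>Z carries the volume density; the chart field norm y e_j - (y_j / norm y) y
    times Z then has a Euclidean divergence.\<close>
  define Z where "Z y = (1 / hgt y) * X y" for y
  have wh: "smooth_on (- {0}) (\<lambda>y::real^'n. 1 / hgt y)"
    by (intro smooth_on_divide smooth_on_hgt smooth_on_const open_Compl_0) auto
  have Z: "c1 Z" unfolding Z_def[abs_def] by (intro c1_weight_smooth wh X)
  have wt: "smooth_on (- {0}) (\<lambda>y::real^'n. (y $ j / norm y) * y $ i)" for i
    by (intro smooth_on_mult smooth_on_theta smooth_on_component open_Compl_0)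
  show "int_zero (\<lambda>y. hgt y * pd j (\<lambda>y. norm y * Z y) y
      - (\<Sum>i\<in>UNIV. hgt y * pd i (\<lambda>y. ((y $ j / norm y) * y $ i) * Z y) y))"
    by (intro int_zero_diff int_zero_sum int_zero_pd c1_weight_smooth smooth_on_norm wt Z)
  show "cc0 (\<lambda>y. ang j X y - (real CARD('n) - 1) * ((y $ j / norm y) * X y))"
    by (intro cc0_diff cc0_cmult cc0_weight cc0_ang c1_cc0 X smooth_on_continuous smooth_on_theta)
  fix y :: "real^'n" assume y: "y \<noteq> 0"
  note dZ = c1_differentiable[OF Z] and dth = differentiable_theta[OF y, of j]
  have 1: "pd j (\<lambda>y. norm y * Z y) y = (y $ j / norm y) * Z y + norm y * pd j Z y"
    using pd_mult[OF differentiable_norm[OF y] dZ] by (simp add: pd_norm[OF y])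
  have "(\<Sum>i\<in>UNIV. pd i (\<lambda>y. ((y $ j / norm y) * y $ i) * Z y) y)
      = (\<Sum>i\<in>UNIV. (y $ i * pd i (\<lambda>y. y $ j / norm y) y) * Z y + (y $ j / norm y) * Z y
          + (y $ j / norm y) * (y $ i * pd i Z y))"
  proof (rule sum.cong)
    fix i
    have "pd i (\<lambda>y. (y $ j / norm y) * y $ i) y = pd i (\<lambda>y. y $ j / norm y) y * y $ i + (y $ j / norm y)"
      using pd_mult[OF dth differentiable_component] by (simp add: pd_component)
    then show "pd i (\<lambda>y. ((y $ j / norm y) * y $ i) * Z y) y
        = (y $ i * pd i (\<lambda>y. y $ j / norm y) y) * Z y + (y $ j / norm y) * Z y
          + (y $ j / norm y) * (y $ i * pd i Z y)"
      using pd_mult[OF differentiable_mult[OF dth differentiable_component] dZ, of i i]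
      by (simp add: algebra_simps)
  qed simp
  also have "\<dots> = euler (\<lambda>y. y $ j / norm y) y * Z y + real CARD('n) * ((y $ j / norm y) * Z y)
      + (y $ j / norm y) * euler Z y"
    unfolding sum.distrib sum_distrib_left[symmetric] sum_distrib_right[symmetric] euler_def by simp
  finally have 2: "(\<Sum>i\<in>UNIV. pd i (\<lambda>y. ((y $ j / norm y) * y $ i) * Z y) y)
      = real CARD('n) * ((y $ j / norm y) * Z y) + (y $ j / norm y) * euler Z y"
    by (simp add: euler_theta[OF y])
  have "((\<lambda>s. 1 / cosh s) has_real_derivative - norm y / (hgt y)\<^sup>2) (at (rad y))"
    by (auto intro!: derivative_eq_intros simp: power2_eq_square)
  from radial_derivs(2,3)[OF y this]
  have 3: "ang j Z y = (1 / hgt y) * ang j X y"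
    unfolding Z_def[abs_def] using ang_mult[of "\<lambda>y. 1 / hgt y" y X j] c1_differentiable[OF X] by simp
  have "hgt y * pd j (\<lambda>y. norm y * Z y) y - (\<Sum>i\<in>UNIV. hgt y * pd i (\<lambda>y. ((y $ j / norm y) * y $ i) * Z y) y)
      = hgt y * (ang j Z y - (real CARD('n) - 1) * ((y $ j / norm y) * Z y))"
    unfolding sum_distrib_left[symmetric] 1 2 ang_def[of j Z] by (simp add: algebra_simps diff_divide_distrib)
  also have "\<dots> = ang j X y - (real CARD('n) - 1) * ((y $ j / norm y) * X y)"
    unfolding 3 by (simp add: Z_def right_diff_distrib)
  finally show "ang j X y - (real CARD('n) - 1) * ((y $ j / norm y) * X y)
    = hgt y * pd j (\<lambda>y. norm y * Z y) y - (\<Sum>i\<in>UNIV. hgt y * pd i (\<lambda>y. ((y $ j / norm y) * y $ i) * Z y) y)" ..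
qed

lemma continuous_on_hyp_dist: "continuous_on (- {0}) (\<lambda>y::real^'n. rad y)"
  by (intro continuous_at_imp_continuous_on ballI differentiable_imp_continuous_within)
    (auto intro: differentiable_hyp_dist)

lemma continuous_on_radial:
  assumes "continuous_on {0<..} F"
  shows "continuous_on (- {0}) (\<lambda>y::real^'n. F (rad y))"
  by (rule continuous_on_compose2[OF assms continuous_on_hyp_dist]) (auto intro: hyp_dist_zero_pos)

lemma Ck_on_radial:
  fixes F F' :: "real \<Rightarrow> real"
  assumes F: "\<And>s. s > 0 \<Longrightarrow> (F has_real_derivative F' s) (at s)" and F': "continuous_on {0<..} F'"
  shows "Ck_on (Suc 0) (- {0}) (\<lambda>y::real^'n. F (rad y))"
proof -
  have "(\<lambda>y::real^'n. F (rad y)) differentiable_on - {0}"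
    unfolding differentiable_on_eq_differentiable_at[OF open_Compl_0]
    using radial_derivs(3)[OF _ F[OF hyp_dist_zero_pos]] by auto
  moreover have "continuous_on (- {0}) (pd i (\<lambda>y::real^'n. F (rad y)))" for i
  proof -
    have "continuous_on (- {0}) (\<lambda>y::real^'n. F' (rad y) * (y $ i / (norm y * hgt y)))"
      by (intro continuous_intros continuous_on_radial F') auto
    moreover have "F' (rad y) * (y $ i / (norm y * hgt y)) = pd i (\<lambda>y. F (rad y)) y"
      if "y \<in> - {0}" for y :: "real^'n"
      using pd_comp1(1)[OF differentiable_hyp_dist F[OF hyp_dist_zero_pos], of y i] that
      by (simp add: pd_hyp_dist)
    ultimately show ?thesis by (metis (no_types, lifting) continuous_on_cong)
  qed
  ultimately show ?thesis by simp
qed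

lemma DERIV_continuous_on_pos:
  assumes "\<And>s::real. s > 0 \<Longrightarrow> (F has_real_derivative F' s) (at s)"
  shows "continuous_on {0<..} F"
  using assms by (intro continuous_at_imp_continuous_on) (auto intro: DERIV_isCont)

text \<open>The divergence of F(r) f g d/dr, from which all radial integrations by parts below are
  built.\<close>

lemma int_zero_rad:
  fixes f g :: "real^'n \<Rightarrow> real"
  assumes f: "f \<in> test_functions 0" and g: "g \<in> test_functions 0"
    and F: "\<And>s. s > 0 \<Longrightarrow> (F has_real_derivative F' s) (at s)" and F': "continuous_on {0<..} F'"
  shows "int_zero (\<lambda>y. (F' (rad y) + (real CARD('n) - 1) * (hgt y / norm y) * F (rad y)) * (f y * g y)
    + F (rad y) * (dr f y * g y + f y * dr g y))"
proof (rule int_zero_cong[OF int_zero_dr])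
  let ?X = "\<lambda>y. F (rad y) * (f y * g y)"
  note cF = continuous_on_radial[OF DERIV_continuous_on_pos[OF F]]
  have fg: "c1 (\<lambda>y. f y * g y)"
    by (intro c1_mult c1_test f g)
  show "c1 ?X" by (rule c1_weight[OF Ck_on_radial[OF F F'] fg])
  show "cc0 (\<lambda>y. (F' (rad y) + (real CARD('n) - 1) * (hgt y / norm y) * F (rad y)) * (f y * g y)
    + F (rad y) * (dr f y * g y + f y * dr g y))"
    by (intro cc0_add cc0_weight cF continuous_on_radial F' cc0_test f g test_dr continuous_on_test
        continuous_on_add continuous_on_mult continuous_on_const continuous_on_polar)
  fix y :: "real^'n" assume y: "y \<noteq> 0"
  note d = radial_derivs[OF y F[OF hyp_dist_zero_pos[OF y]]]
  show "(F' (rad y) + (real CARD('n) - 1) * (hgt y / norm y) * F (rad y)) * (f y * g y)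
    + F (rad y) * (dr f y * g y + f y * dr g y)
    = dr ?X y + (real CARD('n) - 1) * ((hgt y / norm y) * ?X y)"
    using dr_mult[OF d(3) c1_differentiable[OF fg]] dr_mult[OF test_differentiable[OF f] test_differentiable[OF g], of y]
    by (simp add: d(1) algebra_simps)
qed

text \<open>A radial weight passes through \<open>ang j\<close>. The term with y_j / norm y
  disappears once it is summed over j against a tangential field.\<close>

lemma int_zero_ang:
  fixes f g :: "real^'n \<Rightarrow> real"
  assumes f: "f \<in> test_functions 0" and g: "g \<in> test_functions 0"
    and F: "\<And>s. s > 0 \<Longrightarrow> (F has_real_derivative F' s) (at s)" and F': "continuous_on {0<..} F'"
  shows "int_zero (\<lambda>y. F (rad y) * (ang j f y * g y + f y * ang j g y
    - (real CARD('n) - 1) * ((y $ j / norm y) * (f y * g y))))"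
proof (rule int_zero_cong[OF int_zero_ang_div])
  let ?X = "\<lambda>y. F (rad y) * (f y * g y)"
  note cF = continuous_on_radial[OF DERIV_continuous_on_pos[OF F]]
  have fg: "c1 (\<lambda>y. f y * g y)"
    by (intro c1_mult c1_test f g)
  show "c1 ?X" by (rule c1_weight[OF Ck_on_radial[OF F F'] fg])
  show "cc0 (\<lambda>y. F (rad y) * (ang j f y * g y + f y * ang j g y
    - (real CARD('n) - 1) * ((y $ j / norm y) * (f y * g y))))"
    by (intro cc0_add cc0_diff cc0_cmult cc0_weight cF cc0_test f g test_ang continuous_on_test
        continuous_on_polar)
  fix y :: "real^'n" assume y: "y \<noteq> 0"
  note d = radial_derivs[OF y F[OF hyp_dist_zero_pos[OF y]]]
  show "F (rad y) * (ang j f y * g y + f y * ang j g y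
    - (real CARD('n) - 1) * ((y $ j / norm y) * (f y * g y)))
    = ang j ?X y - (real CARD('n) - 1) * ((y $ j / norm y) * ?X y)"
    using ang_mult[OF d(3) c1_differentiable[OF fg]] ang_mult[OF test_differentiable[OF f] test_differentiable[OF g], of j y]
    by (simp add: d(2) algebra_simps)
qed

section \<open>The Poincare inequality for the angular gradient\<close>

lemma ang_cong_open:
  assumes "open S" "y \<in> S" "\<And>x. x \<in> S \<Longrightarrow> f x = g x"
  shows "ang j f y = ang j g y"
  using pd_cong_open[OF assms] by (simp add: ang_def euler_def)

context
  fixes u :: "real^'n \<Rightarrow> real"
  assumes u: "u \<in> test_functions 0"
begin

text \<open>N - 2 is the Ricci curvature of the unit sphere, and one more unit is lost because the
  components of the gradient are Cartesian. The last term is normal to the sphere and vanishes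
  against a tangential field.\<close>

lemma angular_bochner_commutator:
  assumes y: "y \<noteq> 0"
  defines "L \<equiv> \<lambda>y. \<Sum>k\<in>UNIV. ang k (ang k u) y"
  shows "(\<Sum>k\<in>UNIV. ang k (ang k (ang j u)) y)
    = ang j L y + (real CARD('n) - 3) * ang j u y - 2 * (y $ j / norm y) * L y"
proof -
  define g where "g k = ang k u" for k
  define th where "th k y = y $ k / norm y" for k and y :: "real^'n"
  have g: "g k \<in> test_functions 0" for k unfolding g_def by (intro test_ang u)
  have dg: "g k differentiable (at y)" for k using test_differentiable[OF g] .
  have dth: "th k differentiable (at y)" for k
    using differentiable_theta[OF y] by (simp add: th_def[abs_def])
  have ath: "ang i (th k) y = (if i = k then 1 else 0) - th i y * th k y" for i k
    using ang_theta[OF y] by (simp add: th_def[abs_def])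
  have comm: "ang i (ang k f) x = ang k (ang i f) x + th i x * ang k f x - th k x * ang i f x"
    if "f \<in> test_functions 0" "x \<noteq> 0" for i k f x
    unfolding th_def by (rule ang_commutator[OF test_smooth[OF that(1)] that(2)])
  have tg: "(\<Sum>k\<in>UNIV. th k y * g k y) = 0" "(\<Sum>k\<in>UNIV. th k y * ang k f y) = 0" for f
    unfolding th_def g_def by (rule sum_theta_ang[OF y])+
  have tt: "(\<Sum>k\<in>UNIV. th k y * th k y) = 1" using sum_theta_sq[OF y] by (simp add: th_def)
  have tga: "(\<Sum>k\<in>UNIV. th k y * ang j (g k) y) = - g j y"
    using sum_theta_ang_ang[OF test_smooth[OF u] y] by (simp add: th_def g_def)
  have dag: "ang i (g k) differentiable (at y)" for i k
    by (rule test_differentiable[OF test_ang[OF g]])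
  have Lj: "ang j L y = (\<Sum>k\<in>UNIV. ang j (ang k (g k)) y)"
  proof -
    have "ang j (\<lambda>y. \<Sum>k\<in>K. ang k (g k) y) y = (\<Sum>k\<in>K. ang j (ang k (g k)) y)
        \<and> (\<lambda>y. \<Sum>k\<in>K. ang k (g k) y) differentiable (at y)" if "finite K" for K
      using that
    proof (induction K rule: finite_induct)
      case empty
      then show ?case by (simp add: ang_def euler_def)
    next
      case (insert x F)
      then show ?case
        by (auto simp: ang_add dag intro!: differentiable_add dag)
    qed
    then show ?thesis by (simp add: L_def g_def)
  qed
  have Ly: "L y = (\<Sum>k\<in>UNIV. ang k (g k) y)" by (simp add: L_def g_def)
  \<comment> \<open>The commutator is used twice, on u inside \<open>ang k\<close> and then on g k;
    derivatives of the angle produce the lower-order terms.\<close>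
  have "ang k (ang k (g j)) y = ang j (ang k (g k)) y + 2 * (th k y * ang j (g k) y) - 2 * th j y * ang k (g k) y
      + g j y - (if k = j then g k y else 0) - g j y * (th k y * th k y) + th j y * (th k y * g k y)
      + th k y * ang k (g j) y - th k y * ang j (g k) y" for k
  proof -
    have "ang k (ang k (g j)) y = ang k (\<lambda>x. ang j (g k) x + (th k x * g j x + (- th j x) * g k x)) y"
    proof (rule ang_cong_open[OF open_Compl_0])
      show "ang k (g j) x = ang j (g k) x + (th k x * g j x + (- th j x) * g k x)" if "x \<in> - {0}" for x
        using comm[OF u, of x k j] that by (simp add: g_def)
    qed (use y in simp)
    also have "\<dots> = ang k (ang j (g k)) y + ((ang k (th k) y * g j y + th k y * ang k (g j) y)
        + (ang k (\<lambda>x. - th j x) y * g k y + (- th j y) * ang k (g k) y))"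
    proof -
      define m where "m x = - th j x" for x
      have n: "m differentiable (at y)" using dth by (auto simp: m_def[abs_def] intro!: derivative_intros)
      show ?thesis
        unfolding m_def[symmetric]
        by (simp add: ang_add ang_mult dag dth dg n differentiable_add differentiable_mult)
    qed
    also have "ang k (\<lambda>x. - th j x) y = - ang k (th j) y"
    proof -
      have c: "ang k (\<lambda>_. - 1) y = 0" by (simp add: ang_def euler_def)
      show ?thesis using ang_mult[of "\<lambda>_. - 1" y "th j" k] dth c by simp
    qed
    also have "ang k (ang j (g k)) y = ang j (ang k (g k)) y + th k y * ang j (g k) y - th j y * ang k (g k) y"
      by (rule comm[OF g y])
    finally show ?thesis by (cases "k = j") (simp_all add: ath algebra_simps)
  qed
  then have "(\<Sum>k\<in>UNIV. ang k (ang k (g j)) y) = ang j L y + 2 * (\<Sum>k\<in>UNIV. th k y * ang j (g k) y)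
      - 2 * th j y * L y + real CARD('n) * g j y - g j y - g j y * (\<Sum>k\<in>UNIV. th k y * th k y)
      + th j y * (\<Sum>k\<in>UNIV. th k y * g k y) + (\<Sum>k\<in>UNIV. th k y * ang k (g j) y)
      - (\<Sum>k\<in>UNIV. th k y * ang j (g k) y)"
    by (simp add: sum.distrib sum_subtractf Lj Ly flip: sum_distrib_left)
  then show ?thesis
    unfolding tg tt tga by (simp add: g_def th_def algebra_simps)
qed

text \<open>The spherical Hessian is \<open>ang k (ang j u) + ang k u * y j / norm y\<close>; the bound says that the
  square norm of its trace-free part is nonnegative.\<close>

lemma angular_hessian_bound:
  assumes y: "y \<noteq> 0" and N: "CARD('n) \<ge> 2"
  shows "(\<Sum>k\<in>UNIV. \<Sum>j\<in>UNIV. (ang k (ang j u) y)\<^sup>2)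
    \<ge> (\<Sum>j\<in>UNIV. (ang j u y)\<^sup>2) + (\<Sum>k\<in>UNIV. ang k (ang k u) y)\<^sup>2 / (real CARD('n) - 1)"
proof -
  define th where "th k = y $ k / norm y" for k
  define g where "g k = ang k u y" for k
  define h where "h k j = ang k (ang j u) y" for k j
  define L where "L = (\<Sum>k\<in>UNIV. h k k)"
  define M where "M = real CARD('n) - 1"
  define t where "t = L / M"
  have M: "M > 0" using N by (simp add: M_def)
  have tt: "(\<Sum>k\<in>UNIV. th k * th k) = 1" using sum_theta_sq[OF y] by (simp add: th_def)
  have tg: "(\<Sum>k\<in>UNIV. th k * g k) = 0" using sum_theta_ang[OF y] by (simp add: th_def g_def)
  have th1: "(\<Sum>k\<in>UNIV. th k * h k j) = 0" for j using sum_theta_ang[OF y] by (simp add: th_def h_def)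
  have th2: "(\<Sum>j\<in>UNIV. th j * h k j) = - g k" for k
    using sum_theta_ang_ang[OF test_smooth[OF u] y] by (simp add: th_def h_def g_def)
  \<comment> \<open>P is the projection onto the tangent space of the sphere, of trace M, and t is
    the mean eigenvalue of the Hessian there; the square expanded below is that of the Hessian minus
    t P.\<close>
  define P where "P k j = (if k = j then 1 else 0) - th k * th j" for k j
  have Ph: "(\<Sum>j\<in>UNIV. P k j * h k j) = h k k + th k * g k" for k
  proof -
    have "(\<Sum>j\<in>UNIV. P k j * h k j) = (\<Sum>j\<in>UNIV. (if k = j then h k j else 0) - th k * (th j * h k j))"
      by (rule sum.cong) (auto simp: P_def algebra_simps)
    then show ?thesis by (simp add: sum_subtractf th2 flip: sum_distrib_left)
  qed
  have Pt: "(\<Sum>j\<in>UNIV. P k j * th j) = 0" for k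
  proof -
    have "(\<Sum>j\<in>UNIV. P k j * th j) = (\<Sum>j\<in>UNIV. (if k = j then th j else 0) - th k * (th j * th j))"
      by (rule sum.cong) (auto simp: P_def algebra_simps)
    then show ?thesis by (simp add: sum_subtractf tt flip: sum_distrib_left)
  qed
  have PP: "(\<Sum>j\<in>UNIV. P k j * P k j) = 1 - th k * th k" for k
  proof -
    have "(\<Sum>j\<in>UNIV. P k j * P k j) = (\<Sum>j\<in>UNIV. (if k = j then P k j else 0) - th k * (P k j * th j))"
      by (rule sum.cong) (auto simp: P_def[of k] algebra_simps)
    then show ?thesis by (simp add: sum_subtractf Pt flip: sum_distrib_left) (simp add: P_def)
  qed
  have "0 \<le> (\<Sum>k\<in>UNIV. \<Sum>j\<in>UNIV. (h k j + g k * th j - t * P k j)\<^sup>2)"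
    by (intro sum_nonneg) auto
  also have "\<dots> = (\<Sum>k\<in>UNIV. (\<Sum>j\<in>UNIV. (h k j)\<^sup>2) - g k * g k - 2 * t * (h k k + th k * g k) + t\<^sup>2 * (1 - th k * th k))"
  proof (rule sum.cong)
    fix k
    have "(\<Sum>j\<in>UNIV. (h k j + g k * th j - t * P k j)\<^sup>2)
      = (\<Sum>j\<in>UNIV. (h k j)\<^sup>2 + (g k)\<^sup>2 * (th j * th j) + t\<^sup>2 * (P k j * P k j) + 2 * g k * (th j * h k j)
          - 2 * t * (P k j * h k j) - 2 * g k * t * (P k j * th j))"
      by (rule sum.cong) (auto simp: power2_eq_square algebra_simps)
    also have "\<dots> = (\<Sum>j\<in>UNIV. (h k j)\<^sup>2) + (g k)\<^sup>2 * 1 + t\<^sup>2 * (1 - th k * th k) + 2 * g k * (- g k)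
          - 2 * t * (h k k + th k * g k) - 2 * g k * t * 0"
      unfolding sum_subtractf sum.distrib sum_distrib_left[symmetric] tt PP Ph Pt th2 ..
    finally show "(\<Sum>j\<in>UNIV. (h k j + g k * th j - t * P k j)\<^sup>2)
      = (\<Sum>j\<in>UNIV. (h k j)\<^sup>2) - g k * g k - 2 * t * (h k k + th k * g k) + t\<^sup>2 * (1 - th k * th k)"
      by (simp add: power2_eq_square)
  qed simp
  also have "\<dots> = (\<Sum>k\<in>UNIV. \<Sum>j\<in>UNIV. (h k j)\<^sup>2) - (\<Sum>k\<in>UNIV. g k * g k) - 2 * t * L + t\<^sup>2 * M"
    unfolding sum_subtractf sum.distrib sum_distrib_left[symmetric]
    by (simp add: tt tg L_def M_def)
  also have "2 * t * L = 2 * (L\<^sup>2 / M)" by (simp add: t_def power2_eq_square)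
  also have "t\<^sup>2 * M = L\<^sup>2 / M" using M by (simp add: t_def power2_eq_square)
  finally show ?thesis by (simp add: h_def g_def L_def M_def power2_eq_square)
qed

text \<open>The integrated Bochner formula equates the integral of L^2 with that of the squared
  second derivatives plus M - 2 times the squared gradient, and \<open>angular_hessian_bound\<close>
  estimates the second derivatives from below. The radial weight is constant on spheres and does not
  disturb this.\<close>

lemma angular_poincare:
  assumes N: "CARD('n) \<ge> 3" and F: "\<And>s. s > 0 \<Longrightarrow> (F has_real_derivative F' s) (at s)"
    and F': "continuous_on {0<..} F'" and pos: "\<And>s. s > 0 \<Longrightarrow> F s \<ge> 0"
  shows "hyp_int (\<lambda>y. F (rad y) * ((\<Sum>k\<in>UNIV. ang k (ang k u) y)\<^sup>2
    - (real CARD('n) - 1) * (\<Sum>j\<in>UNIV. (ang j u y)\<^sup>2))) \<ge> 0"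
proof -
  define L where "L y = (\<Sum>k\<in>UNIV. ang k (ang k u) y)" for y
  define M where "M = real CARD('n) - 1"
  define H where "H y = (\<Sum>k\<in>UNIV. \<Sum>j\<in>UNIV. (ang k (ang j u) y)\<^sup>2)" for y
  define G where "G y = (\<Sum>j\<in>UNIV. (ang j u y)\<^sup>2)" for y
  have M: "M > 1" using N by (simp add: M_def)
  have g: "ang j u \<in> test_functions 0" for j by (intro test_ang u)
  have L: "L \<in> test_functions 0" unfolding L_def[abs_def] by (intro test_sum test_ang u) auto
  note cF = continuous_on_radial[OF DERIV_continuous_on_pos[OF F]]
  have cL: "cc0 (\<lambda>y. (L y)\<^sup>2)" by (intro cc0_power2 cc0_test L)
  have cH: "cc0 H" unfolding H_def[abs_def] by (intro cc0_sum cc0_power2 cc0_test test_ang g)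
  have cG: "cc0 G" unfolding G_def[abs_def] by (intro cc0_sum cc0_power2 cc0_test g)
  have "int_zero (\<lambda>y. F (rad y) * ((L y)\<^sup>2 - H y - (M - 2) * G y))"
  proof (rule int_zero_cong)
    \<comment> \<open>?Z1 comes from moving an angular derivative off L, ?Z2 from moving one off the
      second derivatives; in the difference the third-order terms cancel.\<close>
    let ?Z1 = "\<lambda>j y. F (rad y) * (ang j (ang j u) y * L y + ang j u y * ang j L y - M * ((y $ j / norm y) * (ang j u y * L y)))"
    let ?Z2 = "\<lambda>j k y. F (rad y) * (ang k (ang j u) y * ang k (ang j u) y + ang j u y * ang k (ang k (ang j u)) y
      - M * ((y $ k / norm y) * (ang j u y * ang k (ang j u) y)))"
    show "int_zero (\<lambda>y. (\<Sum>j\<in>UNIV. ?Z1 j y) - (\<Sum>j\<in>UNIV. \<Sum>k\<in>UNIV. ?Z2 j k y))"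
      unfolding M_def by (intro int_zero_diff int_zero_sum int_zero_ang[OF _ _ F F'] g L test_ang)
    show "cc0 (\<lambda>y. F (rad y) * ((L y)\<^sup>2 - H y - (M - 2) * G y))"
      by (intro cc0_weight[OF cF] cc0_diff cc0_cmult cL cH cG)
    fix y :: "real^'n" assume y: "y \<noteq> 0"
    have 1: "(\<Sum>j\<in>UNIV. ?Z1 j y) = F (rad y) * ((L y)\<^sup>2 + (\<Sum>j\<in>UNIV. ang j u y * ang j L y))"
    proof -
      have "(\<Sum>j\<in>UNIV. ?Z1 j y) = F (rad y) * (\<Sum>j\<in>UNIV. L y * ang j (ang j u) y + ang j u y * ang j L y
          - M * L y * ((y $ j / norm y) * ang j u y))"
        unfolding sum_distrib_left by (rule sum.cong) (auto simp: mult_ac)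
      also have "\<dots> = F (rad y) * (L y * L y + (\<Sum>j\<in>UNIV. ang j u y * ang j L y) - M * L y * 0)"
        unfolding sum.distrib sum_subtractf sum_distrib_left[symmetric] sum_theta_ang[OF y] L_def[of y] ..
      finally show ?thesis by (simp add: power2_eq_square)
    qed
    have 2: "(\<Sum>j\<in>UNIV. \<Sum>k\<in>UNIV. ?Z2 j k y)
        = F (rad y) * (H y + (\<Sum>j\<in>UNIV. ang j u y * ang j L y) + (M - 2) * G y)"
    proof -
      have "(\<Sum>k\<in>UNIV. ?Z2 j k y) = F (rad y) * ((\<Sum>k\<in>UNIV. (ang k (ang j u) y)\<^sup>2)
          + (ang j u y * ang j L y + (M - 2) * (ang j u y)\<^sup>2 - 2 * L y * ((y $ j / norm y) * ang j u y)))" for j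
      proof -
        have "(\<Sum>k\<in>UNIV. ?Z2 j k y) = F (rad y) * (\<Sum>k\<in>UNIV. (ang k (ang j u) y)\<^sup>2
            + ang j u y * ang k (ang k (ang j u)) y - M * ang j u y * ((y $ k / norm y) * ang k (ang j u) y))"
          unfolding sum_distrib_left by (rule sum.cong) (auto simp: mult_ac power2_eq_square)
        also have "\<dots> = F (rad y) * ((\<Sum>k\<in>UNIV. (ang k (ang j u) y)\<^sup>2)
            + ang j u y * (\<Sum>k\<in>UNIV. ang k (ang k (ang j u)) y) - M * ang j u y * 0)"
          unfolding sum.distrib sum_subtractf sum_distrib_left[symmetric] sum_theta_ang[OF y] ..
        also have "(\<Sum>k\<in>UNIV. ang k (ang k (ang j u)) y) = ang j L y + (M - 2) * ang j u y - 2 * (y $ j / norm y) * L y"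
          using angular_bochner_commutator[OF y, of j] by (simp add: L_def[abs_def] M_def)
        finally show ?thesis by (simp add: power2_eq_square algebra_simps)
      qed
      then have "(\<Sum>j\<in>UNIV. \<Sum>k\<in>UNIV. ?Z2 j k y) = F (rad y) * (\<Sum>j\<in>UNIV. (\<Sum>k\<in>UNIV. (ang k (ang j u) y)\<^sup>2)
          + (ang j u y * ang j L y + (M - 2) * (ang j u y)\<^sup>2 - 2 * L y * ((y $ j / norm y) * ang j u y)))"
        by (simp add: sum_distrib_left)
      also have "\<dots> = F (rad y) * ((\<Sum>j\<in>UNIV. \<Sum>k\<in>UNIV. (ang k (ang j u) y)\<^sup>2)
          + ((\<Sum>j\<in>UNIV. ang j u y * ang j L y) + (M - 2) * G y - 2 * L y * 0))"
        unfolding sum.distrib sum_subtractf sum_distrib_left[symmetric] sum_theta_ang[OF y] G_def ..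
      also have "(\<Sum>j\<in>UNIV. \<Sum>k\<in>UNIV. (ang k (ang j u) y)\<^sup>2) = H y" unfolding H_def by (rule sum.swap)
      finally show ?thesis by (simp add: algebra_simps)
    qed
    show "F (rad y) * ((L y)\<^sup>2 - H y - (M - 2) * G y)
      = (\<Sum>j\<in>UNIV. ?Z1 j y) - (\<Sum>j\<in>UNIV. \<Sum>k\<in>UNIV. ?Z2 j k y)"
      unfolding 1 2 by (simp add: algebra_simps)
  qed
  then have z: "hyp_int (\<lambda>y. F (rad y) * ((L y)\<^sup>2 - H y - (M - 2) * G y)) = 0"
    by (simp add: int_zero_def)
  \<comment> \<open>After the Hessian bound L^2 carries 1 - 1/M and the gradient M - 1; the factor M
    / (M - 1) normalises the former to 1 and the latter to M.\<close>
  have "0 = hyp_int (\<lambda>y. (M / (M - 1)) * (F (rad y) * ((L y)\<^sup>2 - H y - (M - 2) * G y)))"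
    unfolding hyp_int_cmult z by simp
  also have "\<dots> \<le> hyp_int (\<lambda>y. F (rad y) * ((L y)\<^sup>2 - M * G y))"
  proof (rule hyp_int_mono)
    show "cc0 (\<lambda>y. (M / (M - 1)) * (F (rad y) * ((L y)\<^sup>2 - H y - (M - 2) * G y)))"
      by (intro cc0_cmult cc0_weight[OF cF] cc0_diff cL cH cG)
    show "cc0 (\<lambda>y. F (rad y) * ((L y)\<^sup>2 - M * G y))"
      by (intro cc0_weight[OF cF] cc0_diff cc0_cmult cL cG)
    fix y :: "real^'n" assume y: "y \<noteq> 0"
    have b: "H y \<ge> G y + (L y)\<^sup>2 / M"
      using angular_hessian_bound[OF y] N by (simp add: H_def G_def L_def M_def)
    have "(M / (M - 1)) * ((L y)\<^sup>2 - H y - (M - 2) * G y)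
        \<le> (M / (M - 1)) * ((L y)\<^sup>2 - (G y + (L y)\<^sup>2 / M) - (M - 2) * G y)"
      using M b by (intro mult_left_mono) auto
    also have "\<dots> = (L y)\<^sup>2 - M * G y"
      using M by (simp add: field_simps)
    finally show "(M / (M - 1)) * (F (rad y) * ((L y)\<^sup>2 - H y - (M - 2) * G y))
        \<le> F (rad y) * ((L y)\<^sup>2 - M * G y)"
      using mult_left_mono[OF _ pos[OF hyp_dist_zero_pos[OF y]]] by (metis mult.left_commute)
  qed
  finally show ?thesis by (simp add: L_def M_def G_def)
qed

end

section \<open>The inequality at the pole 0\<close>

lemma radial_weight_derivs:
  fixes s :: real
  assumes "s > 0"
  shows "((\<lambda>s. 1 / (sinh s)\<^sup>2) has_real_derivative - 2 * cosh s / (sinh s)^3) (at s)"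
    "((\<lambda>s. 1 / (sinh s)^4) has_real_derivative - 4 * cosh s / (sinh s)^5) (at s)"
    "((\<lambda>s. cosh s / sinh s) has_real_derivative - 1 / (sinh s)\<^sup>2) (at s)"
    "((\<lambda>s. cosh s / (sinh s)^3) has_real_derivative - 2 / (sinh s)\<^sup>2 - 3 / (sinh s)^4) (at s)"
proof -
  define S where "S = sinh s"
  define C where "C = cosh s"
  have n: "S \<noteq> 0" using assms by (simp add: S_def)
  have C: "C * C = 1 + S * S" using cosh_square_eq[of s] by (simp add: S_def C_def power2_eq_square)
  have "((\<lambda>s. 1 / (sinh s)\<^sup>2) has_real_derivative (0 * S\<^sup>2 - 1 * (2 * S ^ 1 * C)) / (S\<^sup>2 * S\<^sup>2)) (at s)"
    using n unfolding S_def C_def by (auto intro!: derivative_eq_intros)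
  then show "((\<lambda>s. 1 / (sinh s)\<^sup>2) has_real_derivative - 2 * cosh s / (sinh s)^3) (at s)"
    using n by (simp add: eval_nat_numeral field_simps flip: S_def C_def)
  have "((\<lambda>s. 1 / (sinh s)^4) has_real_derivative (0 * S^4 - 1 * (4 * S ^ 3 * C)) / (S^4 * S^4)) (at s)"
    using n unfolding S_def C_def by (auto intro!: derivative_eq_intros)
  then show "((\<lambda>s. 1 / (sinh s)^4) has_real_derivative - 4 * cosh s / (sinh s)^5) (at s)"
    using n by (simp add: eval_nat_numeral field_simps flip: S_def C_def)
  have "((\<lambda>s. cosh s / sinh s) has_real_derivative (S * S - C * C) / (S * S)) (at s)"
    using n unfolding S_def C_def by (auto intro!: derivative_eq_intros)
  then show "((\<lambda>s. cosh s / sinh s) has_real_derivative - 1 / (sinh s)\<^sup>2) (at s)"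
    using n unfolding C by (simp add: power2_eq_square flip: S_def C_def)
  have "((\<lambda>s. cosh s / (sinh s)^3) has_real_derivative (S * S^3 - C * (3 * S ^ 2 * C)) / (S^3 * S^3)) (at s)"
    using n unfolding S_def C_def by (auto intro!: derivative_eq_intros)
  moreover have "(S * S^3 - C * (3 * S ^ 2 * C)) / (S^3 * S^3) = - 2 / S\<^sup>2 - 3 / S^4"
  proof -
    have "S * S^3 - C * (3 * S ^ 2 * C) = S * S^3 - 3 * S\<^sup>2 * (C * C)"
      by (simp add: mult_ac)
    also have "\<dots> = S * S^3 - 3 * S\<^sup>2 * (1 + S * S)" by (simp only: C)
    finally have *: "S * S^3 - C * (3 * S ^ 2 * C) = \<dots>" .
    show ?thesis unfolding * using n by (simp add: field_simps eval_nat_numeral)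
  qed
  ultimately show "((\<lambda>s. cosh s / (sinh s)^3) has_real_derivative - 2 / (sinh s)\<^sup>2 - 3 / (sinh s)^4) (at s)"
    by (simp add: S_def)
qed

lemma continuous_on_radial_weights:
  "continuous_on {0<..} (\<lambda>s::real. 1 / (sinh s)\<^sup>2)"
  "continuous_on {0<..} (\<lambda>s::real. - 2 * cosh s / (sinh s)^3)"
  "continuous_on {0<..} (\<lambda>s::real. - 4 * cosh s / (sinh s)^5)"
  "continuous_on {0<..} (\<lambda>s::real. - 1 / (sinh s)\<^sup>2)"
  "continuous_on {0<..} (\<lambda>s::real. - 2 / (sinh s)\<^sup>2 - 3 / (sinh s)^4)"
  by (auto intro!: continuous_intros)

lemmas continuous_on_weights = continuous_on_mult continuous_on_add continuous_on_diff continuous_on_divide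
  continuous_on_const continuous_on_power continuous_on_hgt continuous_on_norm continuous_on_id

lemma coth_sq: "(y::real^'n) \<noteq> 0 \<Longrightarrow> (hgt y / norm y) * (hgt y / norm y) = 1 + 1 / (norm y)\<^sup>2"
  using hgt_sq[of y] by (simp add: power2_eq_square[symmetric] power_divide add_divide_distrib power2_norm_eq_inner)

section \<open>Integral identities for the squared Laplacian and the Hardy squares\<close>

context
  fixes u :: "real^'n \<Rightarrow> real" and a b :: "real^'n \<Rightarrow> real" and M :: real
  assumes u: "u \<in> test_functions 0"
  defines "a \<equiv> dr u" and "b \<equiv> dr (dr u)" and "M \<equiv> real CARD('n) - 1"
begin

lemma radial_tests: "a \<in> test_functions 0" "b \<in> test_functions 0" "dr a = b"
  unfolding a_def b_def by (auto intro: test_dr u)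

text \<open>The cross term 2 M coth a b is M coth times the radial derivative of a^2. Integrated by
  parts it cancels M^2 coth^2 a^2 and leaves M a^2 / sinh^2 from the derivative of coth.\<close>

lemma radial_laplacian_int_zero:
  "int_zero (\<lambda>y. (b y + M * (hgt y / norm y) * a y)\<^sup>2 - ((b y)\<^sup>2 + M * ((a y)\<^sup>2 / (norm y)\<^sup>2)))"
proof (rule int_zero_cong[OF int_zero_cmult[OF int_zero_rad[OF radial_tests(1) radial_tests(1) radial_weight_derivs(3) continuous_on_radial_weights(4)], of M]])
  show "cc0 (\<lambda>y. (b y + M * (hgt y / norm y) * a y)\<^sup>2 - ((b y)\<^sup>2 + M * ((a y)\<^sup>2 / (norm y)\<^sup>2)))"
    by (intro cc0_diff cc0_add cc0_power2 cc0_cmult cc0_weight cc0_divide cc0_test radial_tests continuous_on_weights) auto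
  fix y :: "real^'n" assume y: "y \<noteq> 0"
  define w where "w = hgt y / norm y"
  define q where "q = 1 / (norm y)\<^sup>2"
  have w: "w * w = 1 + q" using coth_sq[OF y] by (simp add: w_def q_def)
  have "(b y + M * w * a y)\<^sup>2 - ((b y)\<^sup>2 + M * ((a y)\<^sup>2 * q))
    = M * ((M * (w * w) - q) * (a y * a y) + w * (b y * a y + a y * b y))"
    by (simp add: power2_eq_square algebra_simps)
  then show "(b y + M * (hgt y / norm y) * a y)\<^sup>2 - ((b y)\<^sup>2 + M * ((a y)\<^sup>2 / (norm y)\<^sup>2))
    = M * ((- 1 / (sinh (rad y))\<^sup>2 + (real CARD('n) - 1) * (hgt y / norm y)
         * (cosh (rad y) / sinh (rad y))) * (a y * a y)
      + cosh (rad y) / sinh (rad y) * (dr a y * a y + a y * dr a y))"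
    by (simp add: radial_tests(3) M_def w_def q_def)
qed

definition "ang_part y = (\<Sum>k\<in>UNIV. ang k (ang k u) y)"

lemma ang_part_test: "ang_part \<in> test_functions 0"
  unfolding ang_part_def[abs_def] by (intro test_sum test_ang u) auto

text \<open>Three integrations by parts: ?Z1 moves an angular derivative from L onto the radial part
  A, ?Z2 removes the second radial derivative of g_j that this creates, and ?Z3 turns the remaining
  product coth g_j g_j' / sinh^2 into a multiple of g_j^2.\<close>

lemma mixed_term_int_zero:
  "int_zero (\<lambda>y. (b y + M * (hgt y / norm y) * a y) * ang_part y / (norm y)\<^sup>2
    - (\<Sum>j\<in>UNIV. (dr (ang j u) y)\<^sup>2 / (norm y)\<^sup>2
        + ((M - 2) / (norm y)\<^sup>2 + (M - 3) / (norm y)^4) * (ang j u y)\<^sup>2))"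
proof -
  define A where "A y = b y + (M * (hgt y / norm y)) * a y" for y
  have wM: "smooth_on (- {0}) (\<lambda>y::real^'n. M * (hgt y / norm y))"
    by (intro smooth_on_mult smooth_on_coth smooth_on_const open_Compl_0)
  have A: "A \<in> test_functions 0"
    unfolding A_def[abs_def] by (intro test_add test_weight wM radial_tests)
  have g: "ang j u \<in> test_functions 0" "dr (ang j u) \<in> test_functions 0" for j
    by (intro test_ang test_dr u)+
  let ?Z1 = "\<lambda>j y. 1 / (sinh (rad y))\<^sup>2 * (ang j A y * ang j u y + A y * ang j (ang j u) y
    - (real CARD('n) - 1) * ((y $ j / norm y) * (A y * ang j u y)))"
  let ?Z2 = "\<lambda>j y. (- 2 * cosh (rad y) / (sinh (rad y))^3 + (real CARD('n) - 1) * (hgt y / norm y)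
      * (1 / (sinh (rad y))\<^sup>2)) * (dr (ang j u) y * ang j u y)
    + 1 / (sinh (rad y))\<^sup>2 * (dr (dr (ang j u)) y * ang j u y + dr (ang j u) y * dr (ang j u) y)"
  let ?Z3 = "\<lambda>j y. (- 2 / (sinh (rad y))\<^sup>2 - 3 / (sinh (rad y))^4
      + (real CARD('n) - 1) * (hgt y / norm y) * (cosh (rad y) / (sinh (rad y))^3)) * (ang j u y * ang j u y)
    + cosh (rad y) / (sinh (rad y))^3 * (dr (ang j u) y * ang j u y + ang j u y * dr (ang j u) y)"
  have "int_zero (\<lambda>y. \<Sum>j\<in>UNIV. ?Z1 j y - ?Z2 j y - ?Z3 j y)"
    by (intro int_zero_sum int_zero_diff int_zero_ang[OF A g(1) radial_weight_derivs(1) continuous_on_radial_weights(2)]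
      int_zero_rad[OF g(2) g(1) radial_weight_derivs(1) continuous_on_radial_weights(2)]
      int_zero_rad[OF g(1) g(1) radial_weight_derivs(4) continuous_on_radial_weights(5)])
  then show ?thesis
  proof (rule int_zero_cong)
    show "cc0 (\<lambda>y. (b y + M * (hgt y / norm y) * a y) * ang_part y / (norm y)\<^sup>2
      - (\<Sum>j\<in>UNIV. (dr (ang j u) y)\<^sup>2 / (norm y)\<^sup>2
        + ((M - 2) / (norm y)\<^sup>2 + (M - 3) / (norm y)^4) * (ang j u y)\<^sup>2))"
      by (intro cc0_diff cc0_add cc0_sum cc0_power2 cc0_divide cc0_weight cc0_test radial_tests ang_part_test g
          continuous_on_test[OF radial_tests(1)] continuous_on_test[OF radial_tests(2)] continuous_on_weights) auto
    fix y :: "real^'n" assume y: "y \<noteq> 0"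
    define w where "w = hgt y / norm y"
    define q where "q = 1 / (norm y)\<^sup>2"
    have w: "w * w = 1 + q" using coth_sq[OF y] by (simp add: w_def q_def)
    have sh: "1 / (sinh (rad y))\<^sup>2 = q" "cosh (rad y) / (sinh (rad y))^3 = w * q"
      "- 2 * cosh (rad y) / (sinh (rad y))^3 = - 2 * (w * q)"
      "- 2 / (sinh (rad y))\<^sup>2 - 3 / (sinh (rad y))^4 = - 2 * q - 3 * q\<^sup>2"
      by (simp_all add: w_def q_def power2_eq_square power3_eq_cube eval_nat_numeral)
    have angA: "ang j A y = dr (dr (ang j u)) y + M * w * dr (ang j u) y" for j
    proof -
      note sm = test_smooth[OF u]
      have "ang j A y = ang j b y + ang j (\<lambda>y. (M * (hgt y / norm y)) * a y) y"
        unfolding A_def[abs_def]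
        by (intro ang_add test_differentiable[OF radial_tests(2)] differentiable_mult test_differentiable[OF radial_tests(1)]
            smooth_on_differentiable[OF open_Compl_0 wM]) (use y in simp)
      also have "ang j (\<lambda>y. (M * (hgt y / norm y)) * a y) y = ang j (\<lambda>y. M * (hgt y / norm y)) y * a y + (M * w) * ang j a y"
        unfolding w_def
        by (intro ang_mult test_differentiable[OF radial_tests(1)] smooth_on_differentiable[OF open_Compl_0 wM]) (use y in simp)
      also have "ang j (\<lambda>y. M * (hgt y / norm y)) y = 0"
        using ang_mult[of "\<lambda>_. M" y "\<lambda>y. hgt y / norm y" j] coth_derivs(2,3)[OF test_smooth[OF u] y]
        by (simp add: ang_def[of j "\<lambda>_. M"] euler_def[of "\<lambda>_. M"])
      also have "ang j a y = dr (ang j u) y" unfolding a_def by (rule ang_dr[OF sm y])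
      also have "ang j b y = dr (dr (ang j u)) y"
      proof -
        have "ang j b y = dr (ang j (dr u)) y"
          unfolding b_def by (rule ang_dr[OF test_smooth[OF test_dr[OF u]] y])
        \<comment> \<open>\<open>ang_dr\<close> holds on the open complement of the pole, so both
          sides have the same partial derivatives at y.\<close>
        also have "\<dots> = dr (dr (ang j u)) y"
        proof -
          have "pd i (ang j (dr u)) y = pd i (dr (ang j u)) y" for i
            by (rule pd_cong_open[OF open_Compl_0]) (use y ang_dr[OF sm] in auto)
          then show ?thesis by (simp add: dr_def[of "ang j (dr u)"] dr_def[of "dr (ang j u)"] euler_def)
        qed
        finally show ?thesis .
      qed
      finally show ?thesis by simp
    qed
    have Ay: "b y + M * (hgt y / norm y) * a y = A y" by (simp add: A_def)
    have "(\<Sum>j\<in>UNIV. ?Z1 j y - ?Z2 j y - ?Z3 j y)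
      = (\<Sum>j\<in>UNIV. (q * A y) * ang j (ang j u) y - (q * M * A y) * ((y $ j / norm y) * ang j u y)
          - (q * (dr (ang j u) y)\<^sup>2 + ((M - 2) * q + (M - 3) * q\<^sup>2) * (ang j u y)\<^sup>2))"
    proof (rule sum.cong)
      fix j
      define g0 where "g0 = ang j u y"
      define g1 where "g1 = dr (ang j u) y"
      define g2 where "g2 = dr (dr (ang j u)) y"
      define X where "X = ang j (ang j u) y"
      define Y where "Y = y $ j / norm y"
      have "q * ((g2 + M * w * g1) * g0 + A y * X - M * (Y * (A y * g0)))
        - ((- 2 * (w * q) + M * w * q) * (g1 * g0) + q * (g2 * g0 + g1 * g1))
        - ((- 2 * q - 3 * q\<^sup>2 + M * w * (w * q)) * (g0 * g0) + w * q * (g1 * g0 + g0 * g1))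
        = (q * A y) * X - (q * M * A y) * (Y * g0) - (q * g1\<^sup>2 + ((- 2 * q - 3 * q\<^sup>2 + M * (w * w) * q)) * g0\<^sup>2)"
        by (simp add: power2_eq_square algebra_simps)
      also have "- 2 * q - 3 * q\<^sup>2 + M * (w * w) * q = (M - 2) * q + (M - 3) * q\<^sup>2"
        unfolding w by (simp add: power2_eq_square algebra_simps)
      finally show "?Z1 j y - ?Z2 j y - ?Z3 j y = (q * A y) * ang j (ang j u) y
          - (q * M * A y) * ((y $ j / norm y) * ang j u y)
          - (q * (dr (ang j u) y)\<^sup>2 + ((M - 2) * q + (M - 3) * q\<^sup>2) * (ang j u y)\<^sup>2)"
        unfolding sh angA w_def[symmetric] M_def[symmetric] g0_def g1_def g2_def X_def Y_def .
    qed simp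
    also have "\<dots> = q * A y * ang_part y - q * M * A y * 0
        - (\<Sum>j\<in>UNIV. q * (dr (ang j u) y)\<^sup>2 + ((M - 2) * q + (M - 3) * q\<^sup>2) * (ang j u y)\<^sup>2)"
      unfolding sum_subtractf sum_distrib_left[symmetric] sum_theta_ang[OF y] ang_part_def ..
    finally show "(b y + M * (hgt y / norm y) * a y) * ang_part y / (norm y)\<^sup>2
      - (\<Sum>j\<in>UNIV. (dr (ang j u) y)\<^sup>2 / (norm y)\<^sup>2
        + ((M - 2) / (norm y)\<^sup>2 + (M - 3) / (norm y)^4) * (ang j u y)\<^sup>2)
      = (\<Sum>j\<in>UNIV. ?Z1 j y - ?Z2 j y - ?Z3 j y)"
      unfolding Ay by (simp add: q_def power_divide mult_ac)
  qed
qed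

text \<open>\<open>k\<close> is the logarithmic derivative of a positive radial supersolution with Hardy weight \<open>W\<close>;
  the inequality is applied to \<open>dr u\<close> and to \<open>ang j u / sinh\<close>.\<close>

context
  fixes k k' W :: "real \<Rightarrow> real"
  assumes k: "\<And>s. s > 0 \<Longrightarrow> (k has_real_derivative k' s) (at s)" and k': "continuous_on {0<..} k'"
    and W: "\<And>s. s > 0 \<Longrightarrow> W s = - k' s - (k s)\<^sup>2 - M * (cosh s / sinh s) * k s"
begin

lemma continuous_on_k: "continuous_on {0<..} k"
  by (rule DERIV_continuous_on_pos[OF k])

lemma continuous_on_W: "continuous_on {0<..} W"
proof -
  have "continuous_on {0<..} (\<lambda>s. - k' s - (k s)\<^sup>2 - M * (cosh s / sinh s) * k s)"
    by (intro continuous_intros continuous_on_k k') auto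
  then show ?thesis using W by (metis (no_types, lifting) continuous_on_cong greaterThan_iff)
qed

text \<open>The cross term -2 k a b of the square is integrated by parts; the Riccati expression W
  collects all resulting multiples of a^2.\<close>

lemma radial_hardy_int_zero:
  "int_zero (\<lambda>y. (b y - k (rad y) * a y)\<^sup>2 - ((b y)\<^sup>2 - W (rad y) * (a y)\<^sup>2))"
proof (rule int_zero_cong[OF int_zero_cmult[OF int_zero_rad[OF radial_tests(1) radial_tests(1) k k'], of "-1"]])
  show "cc0 (\<lambda>y. (b y - k (rad y) * a y)\<^sup>2 - ((b y)\<^sup>2 - W (rad y) * (a y)\<^sup>2))"
    by (intro cc0_diff cc0_power2 cc0_weight cc0_test radial_tests continuous_on_radial continuous_on_k continuous_on_W)
  fix y :: "real^'n" assume y: "y \<noteq> 0"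
  show "(b y - k (rad y) * a y)\<^sup>2 - ((b y)\<^sup>2 - W (rad y) * (a y)\<^sup>2)
    = - 1 * ((k' (rad y) + (real CARD('n) - 1) * (hgt y / norm y) * k (rad y)) * (a y * a y)
      + k (rad y) * (dr a y * a y + a y * dr a y))"
  proof -
    define w where "w = hgt y / norm y"
    have Wy: "W (rad y) = - k' (rad y) - (k (rad y))\<^sup>2 - M * w * k (rad y)"
      using W[OF hyp_dist_zero_pos[OF y]] by (simp add: w_def)
    show ?thesis
      unfolding radial_tests(3) M_def[symmetric] w_def[symmetric] Wy by (simp add: power2_eq_square algebra_simps)
  qed
qed

text \<open>The Hardy square of f = g_j / sinh, since f' - k f = (g_j' - (coth + k) g_j) / sinh. The
  terms with M - 1 and M - 2 are the contribution of the factor 1 / sinh.\<close>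

lemma angular_hardy_int_zero:
  "int_zero (\<lambda>y. (dr (ang j u) y - (hgt y / norm y + k (rad y)) * ang j u y)\<^sup>2 / (norm y)\<^sup>2
    - ((dr (ang j u) y)\<^sup>2 / (norm y)\<^sup>2
        + ((M - 1) / (norm y)\<^sup>2 + (M - 2) / (norm y)^4 - W (rad y) / (norm y)\<^sup>2) * (ang j u y)\<^sup>2))"
proof -
  have g: "ang j u \<in> test_functions 0" "dr (ang j u) \<in> test_functions 0"
    by (intro test_ang test_dr u)+
  \<comment> \<open>The cross term splits: F takes the part with k, the weight cosh / sinh^3 the
    part with coth.\<close>
  define F where "F s = k s * (1 / (sinh s)\<^sup>2)" for s
  define F' where "F' s = k s * (- 2 * cosh s / (sinh s)^3) + k' s * (1 / (sinh s)\<^sup>2)" for s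
  have F: "(F has_real_derivative F' s) (at s)" if "s > 0" for s
    unfolding F_def[abs_def] F'_def by (rule DERIV_mult'[OF k radial_weight_derivs(1)]) (use that in auto)
  have cF': "continuous_on {0<..} F'"
    unfolding F'_def[abs_def] by (intro continuous_intros continuous_on_k k') auto
  let ?Z3 = "\<lambda>y. (- 2 / (sinh (rad y))\<^sup>2 - 3 / (sinh (rad y))^4
      + (real CARD('n) - 1) * (hgt y / norm y) * (cosh (rad y) / (sinh (rad y))^3)) * (ang j u y * ang j u y)
    + cosh (rad y) / (sinh (rad y))^3 * (dr (ang j u) y * ang j u y + ang j u y * dr (ang j u) y)"
  let ?Z6 = "\<lambda>y. (F' (rad y) + (real CARD('n) - 1) * (hgt y / norm y) * F (rad y)) * (ang j u y * ang j u y)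
    + F (rad y) * (dr (ang j u) y * ang j u y + ang j u y * dr (ang j u) y)"
  have "int_zero (\<lambda>y. - 1 * (?Z3 y + ?Z6 y))"
    by (intro int_zero_cmult int_zero_add int_zero_rad[OF g(1) g(1) radial_weight_derivs(4) continuous_on_radial_weights(5)]
      int_zero_rad[OF g(1) g(1) F cF'])
  then show ?thesis
  proof (rule int_zero_cong)
    show "cc0 (\<lambda>y. (dr (ang j u) y - (hgt y / norm y + k (rad y)) * ang j u y)\<^sup>2 / (norm y)\<^sup>2
      - ((dr (ang j u) y)\<^sup>2 / (norm y)\<^sup>2
        + ((M - 1) / (norm y)\<^sup>2 + (M - 2) / (norm y)^4 - W (rad y) / (norm y)\<^sup>2) * (ang j u y)\<^sup>2))"
      by (intro cc0_diff cc0_add cc0_power2 cc0_divide cc0_weight cc0_test g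
          continuous_on_radial[OF continuous_on_k] continuous_on_radial[OF continuous_on_W]
          continuous_on_weights) auto
    fix y :: "real^'n" assume y: "y \<noteq> 0"
    define w where "w = hgt y / norm y"
    define q where "q = 1 / (norm y)\<^sup>2"
    define K where "K = k (rad y)"
    define K' where "K' = k' (rad y)"
    have w: "w * w = 1 + q" using coth_sq[OF y] by (simp add: w_def q_def)
    have sh: "1 / (sinh (rad y))\<^sup>2 = q" "cosh (rad y) / (sinh (rad y))^3 = w * q"
      "- 2 * cosh (rad y) / (sinh (rad y))^3 = - 2 * (w * q)"
      "- 2 / (sinh (rad y))\<^sup>2 - 3 / (sinh (rad y))^4 = - 2 * q - 3 * q\<^sup>2"
      by (simp_all add: w_def q_def power2_eq_square power3_eq_cube eval_nat_numeral)
    have Wy: "W (rad y) = - K' - K\<^sup>2 - M * w * K"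
      using W[OF hyp_dist_zero_pos[OF y]] by (simp add: K_def K'_def w_def)
    define g0 where "g0 = ang j u y"
    define g1 where "g1 = dr (ang j u) y"
    have "(g1 - (w + K) * g0)\<^sup>2 * q
        - (g1\<^sup>2 * q + ((M - 1) * q + (M - 2) * q\<^sup>2 - (- K' - K\<^sup>2 - M * w * K) * q) * g0\<^sup>2)
        - - 1 * (((- 2 * q - 3 * q\<^sup>2 + M * w * (w * q)) * (g0 * g0) + w * q * (g1 * g0 + g0 * g1))
        + ((K * (- 2 * (w * q)) + K' * q + M * w * (K * q)) * (g0 * g0) + K * q * (g1 * g0 + g0 * g1)))
        = g0\<^sup>2 * q * ((M + 1) * (w * w) - (M + 1) - (M + 1) * q)"
      by (simp add: power2_eq_square algebra_simps)
    also have "\<dots> = 0" unfolding w by (simp add: algebra_simps)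
    finally have "(g1 - (w + K) * g0)\<^sup>2 * q
        - (g1\<^sup>2 * q + ((M - 1) * q + (M - 2) * q\<^sup>2 - W (rad y) * q) * g0\<^sup>2)
        = - 1 * (?Z3 y + ?Z6 y)"
      unfolding Wy F_def F'_def sh w_def[symmetric] M_def[symmetric] K_def[symmetric] K'_def[symmetric]
        g0_def[symmetric] g1_def[symmetric] by linarith
    then show "(dr (ang j u) y - (hgt y / norm y + k (rad y)) * ang j u y)\<^sup>2 / (norm y)\<^sup>2
      - ((dr (ang j u) y)\<^sup>2 / (norm y)\<^sup>2
        + ((M - 1) / (norm y)\<^sup>2 + (M - 2) / (norm y)^4 - W (rad y) / (norm y)\<^sup>2) * (ang j u y)\<^sup>2)
      = - 1 * (?Z3 y + ?Z6 y)"
      by (simp add: q_def power_divide g0_def g1_def w_def K_def)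
  qed
qed

definition "grad_part y = (a y)\<^sup>2 + (\<Sum>j\<in>UNIV. (ang j u y)\<^sup>2) / (norm y)\<^sup>2"

text \<open>For k = Psi' / Psi this is Psi^2 times the squared gradient of u_r / Psi, by
  \<open>remainder_pole\<close>.\<close>

definition "remainder_part y = (b y - k (rad y) * a y)\<^sup>2 + (\<Sum>j\<in>UNIV. (dr (ang j u) y)\<^sup>2) / (norm y)\<^sup>2"

definition "lap_part y = b y + M * (hgt y / norm y) * a y + ang_part y / (norm y)\<^sup>2"

lemma cc0_parts: "cc0 grad_part" "cc0 remainder_part" "cc0 lap_part" "cc0 (\<lambda>y. (\<Sum>j\<in>UNIV. (ang j u y)\<^sup>2))"
  unfolding grad_part_def[abs_def] remainder_part_def[abs_def] lap_part_def[abs_def]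
  by ((intro cc0_diff cc0_add cc0_sum cc0_power2 cc0_divide cc0_weight cc0_test radial_tests ang_part_test test_ang test_dr u
          continuous_on_radial[OF continuous_on_k] continuous_on_weights; simp)+)

text \<open>With q = 1 / sinh^2, the mixed term gives 2 (M-2) q + 2 (M-3) q^2 as coefficient of
  sum_j g_j^2, the Poincare inequality adds M q^2, and the Hardy identity subtracts (M-1) q + (M-2)
  q^2 and adds W q. The weighted gradient takes W q + M q^2, so (M-3) q + (M-4) q^2 remains.\<close>

lemma rellich_pole:
  assumes N: "CARD('n) \<ge> 5"
  shows "hyp_int (\<lambda>y. (W (rad y) + M / (norm y)\<^sup>2) * grad_part y) + hyp_int remainder_part
    \<le> hyp_int (\<lambda>y. (lap_part y)\<^sup>2)"
proof -
  define G where "G y = (\<Sum>j\<in>UNIV. (ang j u y)\<^sup>2)" for y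
  define G1 where "G1 y = (\<Sum>j\<in>UNIV. (dr (ang j u) y)\<^sup>2)" for y
  define A where "A y = b y + M * (hgt y / norm y) * a y" for y
  define H where "H j y = (dr (ang j u) y - (hgt y / norm y + k (rad y)) * ang j u y)\<^sup>2 / (norm y)\<^sup>2" for j y
  \<comment> \<open>Z combines the four identities and integrates to zero; P is the Poincare
    surplus, and T consists of the Hardy squares and the leftover zero-order terms.\<close>
  define Z where "Z y = ((A y)\<^sup>2 - ((b y)\<^sup>2 + M * ((a y)\<^sup>2 / (norm y)\<^sup>2)))
    + 2 * (A y * ang_part y / (norm y)\<^sup>2 - (\<Sum>j\<in>UNIV. (dr (ang j u) y)\<^sup>2 / (norm y)\<^sup>2
        + ((M - 2) / (norm y)\<^sup>2 + (M - 3) / (norm y)^4) * (ang j u y)\<^sup>2))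
    - ((b y - k (rad y) * a y)\<^sup>2 - ((b y)\<^sup>2 - W (rad y) * (a y)\<^sup>2))
    - (\<Sum>j\<in>UNIV. H j y - ((dr (ang j u) y)\<^sup>2 / (norm y)\<^sup>2
        + ((M - 1) / (norm y)\<^sup>2 + (M - 2) / (norm y)^4 - W (rad y) / (norm y)\<^sup>2) * (ang j u y)\<^sup>2))" for y
  define P where "P y = 1 / (sinh (rad y))^4 * ((ang_part y)\<^sup>2 - M * G y)" for y
  define T where "T y = (\<Sum>j\<in>UNIV. H j y) + ((M - 3) / (norm y)\<^sup>2 + (M - 4) / (norm y)^4) * G y" for y
  have Z: "int_zero Z"
    unfolding Z_def[abs_def] A_def H_def
    by (intro int_zero_add int_zero_diff int_zero_cmult int_zero_sum radial_laplacian_int_zero mixed_term_int_zero radial_hardy_int_zero angular_hardy_int_zero)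
  have P: "hyp_int P \<ge> 0"
    using angular_poincare[OF u _ radial_weight_derivs(2) continuous_on_radial_weights(3)] N
    by (simp add: P_def[abs_def] ang_part_def G_def M_def)
  have cW: "continuous_on (- {0}) (\<lambda>y::real^'n. W (rad y) + M / (norm y)\<^sup>2)"
    by (intro continuous_on_radial[OF continuous_on_W] continuous_on_weights) auto
  have cG: "cc0 G" unfolding G_def[abs_def] by (rule cc0_parts)
  have "continuous_on {0<..} (\<lambda>s::real. 1 / (sinh s)^4)"
    by (rule DERIV_continuous_on_pos[OF radial_weight_derivs(2)])
  from continuous_on_radial[OF this] have cP: "cc0 P"
    unfolding P_def[abs_def] by (intro cc0_weight cc0_diff cc0_cmult cc0_power2 cc0_test ang_part_test cG)
  have cT: "cc0 T"
    unfolding T_def[abs_def] H_def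
    by (intro cc0_diff cc0_add cc0_sum cc0_power2 cc0_divide cc0_weight cc0_test test_ang test_dr u cG
          continuous_on_radial[OF continuous_on_k] continuous_on_weights) auto
  have T: "hyp_int T \<ge> 0"
  proof (rule hyp_int_nonneg[OF _ cT])
    \<comment> \<open>The one place where the dimension must be at least 5: the coefficient M - 4 =
      N - 5 has to be nonnegative.\<close>
    have "M \<ge> 4" using N by (simp add: M_def)
    then show "T y \<ge> 0" for y
      unfolding T_def G_def H_def by (intro add_nonneg_nonneg mult_nonneg_nonneg sum_nonneg) auto
  qed
  have cZ: "cc0 Z" using Z by (simp add: int_zero_def)
  have cV: "cc0 (\<lambda>y. (W (rad y) + M / (norm y)\<^sup>2) * grad_part y)"
    by (rule cc0_weight[OF cW cc0_parts(1)])
  have cL2: "cc0 (\<lambda>y. (lap_part y)\<^sup>2)" by (intro cc0_power2 cc0_parts)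
  have "hyp_int (\<lambda>y. (lap_part y)\<^sup>2 - (W (rad y) + M / (norm y)\<^sup>2) * grad_part y - remainder_part y)
      = hyp_int (\<lambda>y. Z y + (P y + T y))"
  proof (rule hyp_int_cong)
    show "cc0 (\<lambda>y. (lap_part y)\<^sup>2 - (W (rad y) + M / (norm y)\<^sup>2) * grad_part y - remainder_part y)"
      by (intro cc0_diff cL2 cV cc0_parts)
    show "cc0 (\<lambda>y. Z y + (P y + T y))" by (intro cc0_add cZ cP cT)
    fix y :: "real^'n" assume y: "y \<noteq> 0"
    define q where "q = 1 / (norm y)\<^sup>2"
    define V where "V = W (rad y)"
    define R where "R = (b y - k (rad y) * a y)\<^sup>2"
    have q: "x / (norm y)\<^sup>2 = x * q" "x / (norm y)^4 = x * q\<^sup>2" for x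
      by (simp_all add: q_def power_divide eval_nat_numeral)
    have 1: "(\<Sum>j\<in>UNIV. (dr (ang j u) y)\<^sup>2 * q + ((M - 2) * q + (M - 3) * q\<^sup>2) * (ang j u y)\<^sup>2)
        = G1 y * q + ((M - 2) * q + (M - 3) * q\<^sup>2) * G y"
      by (simp add: sum.distrib G_def G1_def flip: sum_distrib_left sum_distrib_right)
    have 2: "(\<Sum>j\<in>UNIV. H j y - ((dr (ang j u) y)\<^sup>2 * q
        + ((M - 1) * q + (M - 2) * q\<^sup>2 - V * q) * (ang j u y)\<^sup>2))
      = (\<Sum>j\<in>UNIV. H j y) - (G1 y * q + ((M - 1) * q + (M - 2) * q\<^sup>2 - V * q) * G y)"
      by (simp add: sum.distrib sum_subtractf G_def G1_def flip: sum_distrib_left sum_distrib_right)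
    define SH where "SH = (\<Sum>j\<in>UNIV. H j y)"
    have lp: "lap_part y = A y + ang_part y * q" by (simp add: lap_part_def A_def q)
    have gp: "grad_part y = (a y)\<^sup>2 + G y * q" by (simp add: grad_part_def G_def q)
    have rp: "remainder_part y = R + G1 y * q" by (simp add: remainder_part_def G1_def q R_def)
    have Pq: "P y = q\<^sup>2 * ((ang_part y)\<^sup>2 - M * G y)" by (simp add: P_def q_def power_divide eval_nat_numeral)
    show "(lap_part y)\<^sup>2 - (W (rad y) + M / (norm y)\<^sup>2) * grad_part y - remainder_part y
        = Z y + (P y + T y)"
      unfolding Z_def T_def q 1 2 V_def[symmetric] R_def[symmetric] SH_def[symmetric] lp gp rp Pq
      unfolding 1 2 SH_def[symmetric]
      by (simp add: power2_eq_square algebra_simps)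
  qed
  also have "\<dots> = hyp_int P + hyp_int T"
    using Z by (simp add: hyp_int_add cZ cP cT cc0_add int_zero_def)
  finally have "hyp_int (\<lambda>y. (lap_part y)\<^sup>2) - hyp_int (\<lambda>y. (W (rad y) + M / (norm y)\<^sup>2) * grad_part y)
      - hyp_int remainder_part = hyp_int P + hyp_int T"
    by (simp add: hyp_int_diff cc0_diff cL2 cV cc0_parts)
  then show ?thesis using P T by linarith
qed

end

end

subsection \<open>The weights of the theorem\<close>

text \<open>The logarithmic derivative of \<open>Psi\<close>; the powers of r in \<open>Psi\<close>
  combine to the exponent \<open>hN\<close>.\<close>

definition kappa :: "nat \<Rightarrow> real \<Rightarrow> real \<Rightarrow> real" where
  "kappa N l s = - ((real N - 1 + gammaN N l) / 2) * (cosh s / sinh s) + hN N l * (1 / s)"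

definition kappa' :: "nat \<Rightarrow> real \<Rightarrow> real \<Rightarrow> real" where
  "kappa' N l s = ((real N - 1 + gammaN N l) / 2) * (1 / (sinh s)\<^sup>2) - hN N l * (1 / s\<^sup>2)"

lemma kappa_derivative: "s > 0 \<Longrightarrow> (kappa N l has_real_derivative kappa' N l s) (at s)"
proof -
  assume s: "s > 0"
  have "((\<lambda>s. 1 / s) has_real_derivative - (1 / s\<^sup>2)) (at s)"
    using s by (auto intro!: derivative_eq_intros simp: power2_eq_square)
  note * = DERIV_add[OF DERIV_cmult[OF radial_weight_derivs(3)[OF s], of "- ((real N - 1 + gammaN N l) / 2)"]
      DERIV_cmult[OF this, of "hN N l"]]
  show ?thesis
    unfolding kappa_def[abs_def] by (rule DERIV_cong[OF *]) (simp add: kappa'_def)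
qed

lemma continuous_on_kappa': "continuous_on {0<..} (kappa' N l)"
  unfolding kappa'_def[abs_def] by (intro continuous_intros) auto

lemma Psi_pos: "s > 0 \<Longrightarrow> Psi N l s > 0"
  by (simp add: Psi_def)

lemma Psi_derivative:
  assumes s: "s > 0"
  shows "(Psi N l has_real_derivative kappa N l s * Psi N l s) (at s)"
proof -
  define p where "p = - ((real N - 2) / 2)"
  define q where "q = - ((real N - 1 + gammaN N l) / 2)"
  have sh: "sinh s > 0" using s by simp
  have e: "Psi N l x = exp (p * ln x + q * (ln (sinh x) - ln x))" if "x > 0" for x
    using that by (simp add: Psi_def powr_def ln_div p_def q_def mult_exp_exp)
  have "((\<lambda>x. exp (p * ln x + q * (ln (sinh x) - ln x))) has_real_derivative
      exp (p * ln s + q * (ln (sinh s) - ln s)) * (p * (1 / s) + q * (cosh s / sinh s - 1 / s))) (at s)"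
    using s sh by (auto intro!: derivative_eq_intros)
  moreover have "p * (1 / s) + q * (cosh s / sinh s - 1 / s) = kappa N l s"
    by (simp add: kappa_def p_def q_def hN_def diff_divide_distrib add_divide_distrib algebra_simps)
  ultimately have "((\<lambda>x. exp (p * ln x + q * (ln (sinh x) - ln x))) has_real_derivative kappa N l s * Psi N l s) (at s)"
    using e[OF s] by (simp add: mult.commute)
  then show ?thesis
    by (rule has_field_derivative_transform_within_open[of _ _ _ "{0<..}"]) (use s e in auto)
qed

text \<open>The Hardy weight of \<open>Psi\<close>: the weight of the theorem with (N-2)/2 in place
  of N/2. The missing (N-1)/sinh^2 is the second summand of the weight in
  \<open>rellich_pole\<close>.\<close>

definition Wgt :: "nat \<Rightarrow> real \<Rightarrow> real \<Rightarrow> real" where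
  "Wgt N l s = l + (hN N l)\<^sup>2 * (1 / s\<^sup>2) + (((real N - 2) / 2)\<^sup>2 - (hN N l)\<^sup>2) * (1 / (sinh s)\<^sup>2)
     + gammaN N l * hN N l * ((s * coth s - 1) / s\<^sup>2)"

text \<open>The upper bound on \<open>l\<close> gives gamma^2 = (N-1)^2 - 4 l. With coth^2 = 1 +
  1/sinh^2 the claim is then a comparison of coefficients.\<close>

lemma Wgt_riccati:
  assumes s: "s > 0" and l: "l \<le> ((real N - 1) / 2)\<^sup>2"
  shows "Wgt N l s = - kappa' N l s - (kappa N l s)\<^sup>2 - (real N - 1) * (cosh s / sinh s) * kappa N l s"
proof -
  define c where "c = cosh s / sinh s"
  define q where "q = 1 / (sinh s)\<^sup>2"
  define i where "i = 1 / s"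
  define g where "g = gammaN N l"
  define M where "M = real N - 1"
  have n: "sinh s \<noteq> 0" using s by simp
  have cc: "c * c = 1 + q"
  proof -
    have "cosh s * cosh s = 1 + sinh s * sinh s" using cosh_square_eq[of s] by (simp add: power2_eq_square)
    then have "c * c = (1 + sinh s * sinh s) / (sinh s * sinh s)" by (simp add: c_def)
    then show ?thesis using n by (simp add: q_def add_divide_distrib power2_eq_square)
  qed
  have gg: "g * g = M * M - 4 * l"
  proof -
    have "M\<^sup>2 - 4 * l \<ge> 0" using l by (simp add: M_def power_divide)
    then have "g\<^sup>2 = M\<^sup>2 - 4 * l" by (simp add: g_def gammaN_def M_def)
    then show ?thesis by (simp add: power2_eq_square)
  qed
  have co: "(s * coth s - 1) / s\<^sup>2 = c * i - i * i"
    using s by (simp add: coth_def c_def i_def power2_eq_square diff_divide_distrib)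
  have "- kappa' N l s - (kappa N l s)\<^sup>2 - M * c * kappa N l s
    = - ((M + g) / 2 * q - (g + 1) / 2 * (i * i)) - (- ((M + g) / 2) * c + (g + 1) / 2 * i)\<^sup>2
      - M * c * (- ((M + g) / 2) * c + (g + 1) / 2 * i)"
    by (simp add: kappa_def kappa'_def hN_def M_def g_def c_def q_def i_def power2_eq_square)
  also have "\<dots> = (M * M - g * g) / 4 * (c * c) - (M + g) / 2 * q + g * ((g + 1) / 2) * (c * i)
      + ((g + 1) / 2 - ((g + 1) / 2)\<^sup>2) * (i * i)"
    by (simp add: power2_eq_square field_simps)
  also have "\<dots> = (M * M - g * g) / 4 + ((g + 1) / 2)\<^sup>2 * (i * i)
      + (((M - 1) / 2)\<^sup>2 - ((g + 1) / 2)\<^sup>2) * q + g * ((g + 1) / 2) * (c * i - i * i)"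
    unfolding cc by (simp add: power2_eq_square field_simps)
  also have "(M * M - g * g) / 4 = l" unfolding gg by simp
  also have "l + ((g + 1) / 2)\<^sup>2 * (i * i)
      + (((M - 1) / 2)\<^sup>2 - ((g + 1) / 2)\<^sup>2) * q + g * ((g + 1) / 2) * (c * i - i * i) = Wgt N l s"
    unfolding Wgt_def co by (simp add: hN_def g_def M_def q_def i_def power2_eq_square)
  finally show ?thesis by (simp add: M_def c_def)
qed

section \<open>Reduction to the pole 0\<close>

lemma c1_add: "c1 f \<Longrightarrow> c1 g \<Longrightarrow> c1 (\<lambda>y. f y + g y)"
  unfolding c1_def using Ck_on_add[OF open_UNIV] cc0_add by blast

lemma c1_sum: "(\<And>i. i \<in> I \<Longrightarrow> c1 (f i)) \<Longrightarrow> c1 (\<lambda>y. \<Sum>i\<in>I. f i y)"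
  unfolding c1_def by (auto intro!: Ck_on_sum[OF open_UNIV] cc0_sum simp del: Ck_on.simps)

lemma c1_power2: "c1 f \<Longrightarrow> c1 (\<lambda>y. (f y)\<^sup>2)"
  unfolding power2_eq_square by (rule c1_mult)

lemma integral_hyp_vol_boost:
  fixes f g :: "real^'n \<Rightarrow> real"
  assumes e: "norm e = 1" and f: "c1 f" and g: "\<And>x. g x = f (boost e t x)"
  shows "(LINT x|hyp_vol. g x) = hyp_int f"
proof -
  obtain R where R: "\<And>x. norm x > R \<Longrightarrow> f x = 0" using f unfolding c1_def cc0_def by blast
  have B: "continuous_on UNIV (boost e t)"
    by (simp add: continuous_on_eq_continuous_at isCont_boost)
  have "continuous_on UNIV (\<lambda>x. f (boost e t x))"
    by (rule continuous_on_compose2[OF cc0_continuous[OF c1_cc0[OF f]] B]) auto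
  then have "(LINT x|hyp_vol. f (boost e t x)) = (LINT x|lborel. f (boost e t x) / hgt x)"
    by (intro integral_hyp_vol borel_measurable_continuous_onI)
  also have "\<dots> = hyp_int f"
    unfolding hyp_int_def by (rule integral_boost[OF e _ R]) (use f in \<open>simp add: c1_def\<close>)
  finally show ?thesis by (simp add: g)
qed

lemma inverse_square_weight:
  shows "s > 0 \<Longrightarrow> ((\<lambda>s::real. 1 / s\<^sup>2) has_real_derivative - 2 / s ^ 3) (at s)"
    and "continuous_on {0<..} (\<lambda>s::real. - 2 / s ^ 3)"
proof -
  show "((\<lambda>s::real. 1 / s\<^sup>2) has_real_derivative - 2 / s ^ 3) (at s)" if "s > 0"
  proof -
    have "((\<lambda>s::real. 1 / s\<^sup>2) has_real_derivative (0 * s\<^sup>2 - 1 * (2 * s)) / (s\<^sup>2 * s\<^sup>2)) (at s)"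
      using that by (auto intro!: derivative_eq_intros)
    then show ?thesis using that by (simp add: eval_nat_numeral field_simps)
  qed
qed (auto intro!: continuous_intros)

lemma coth_weight:
  shows "s > 0 \<Longrightarrow> ((\<lambda>s::real. (s * coth s - 1) / s\<^sup>2) has_real_derivative
      (((cosh s / sinh s + s * (- 1 / (sinh s)\<^sup>2)) * s\<^sup>2 - (s * (cosh s / sinh s) - 1) * (2 * s)) / (s\<^sup>2 * s\<^sup>2))) (at s)"
    and "continuous_on {0<..} (\<lambda>s::real. (((cosh s / sinh s + s * (- 1 / (sinh s)\<^sup>2)) * s\<^sup>2 - (s * (cosh s / sinh s) - 1) * (2 * s)) / (s\<^sup>2 * s\<^sup>2)))"
proof -
  show "((\<lambda>s::real. (s * coth s - 1) / s\<^sup>2) has_real_derivative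
      (((cosh s / sinh s + s * (- 1 / (sinh s)\<^sup>2)) * s\<^sup>2 - (s * (cosh s / sinh s) - 1) * (2 * s)) / (s\<^sup>2 * s\<^sup>2))) (at s)"
    if s: "s > 0"
  proof -
    have "((\<lambda>s. s * (cosh s / sinh s) - 1) has_real_derivative (cosh s / sinh s + s * (- 1 / (sinh s)\<^sup>2))) (at s)"
      by (rule derivative_eq_intros radial_weight_derivs(3)[OF s] refl | simp)+
    then show ?thesis
      unfolding coth_def using s by (intro DERIV_divide) (auto intro!: derivative_eq_intros)
  qed
qed (auto intro!: continuous_intros)

section \<open>The integrals of the theorem, carried to the pole 0\<close>

context
  fixes v :: "real^'n \<Rightarrow> real"
  assumes v: "v \<in> test_functions 0"
begin

lemma hyp_laplacian_test: "hyp_laplacian v \<in> test_functions 0"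
proof -
  have "(\<lambda>x. (\<Sum>i\<in>UNIV. pd i (pd i v) x) + (euler (euler v) x + (real CARD('n) - 1) * euler v x)) \<in> test_functions 0"
    by (intro test_add test_sum test_pd test_euler test_weight smooth_on_const open_Compl_0 v) auto
  moreover have "hyp_laplacian v = (\<lambda>x. (\<Sum>i\<in>UNIV. pd i (pd i v) x) + (euler (euler v) x + (real CARD('n) - 1) * euler v x))"
    using hyp_laplacian_eq[OF open_UNIV test_smooth[OF v]] by (auto simp: add.assoc)
  ultimately show ?thesis by simp
qed

lemma c1_hyp_grad2: "c1 (hyp_grad2 v)"
  unfolding hyp_grad2_eq[abs_def] by (intro c1_add c1_sum c1_power2 c1_test test_pd test_euler v)

lemma c1_radial_hyp_grad2:
  assumes "\<And>s. s > 0 \<Longrightarrow> (F has_real_derivative F' s) (at s)" "continuous_on {0<..} F'"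
  shows "c1 (\<lambda>y. F (rad y) * hyp_grad2 v y)"
  by (rule c1_weight[OF Ck_on_radial[OF assms] c1_hyp_grad2])

text \<open>The radial part is the quotient rule. In the angular part the radial factor 1 / Psi
  passes through \<open>ang j\<close>, which then commutes with \<open>dr\<close>; so the powers of
  \<open>Psi\<close> cancel.\<close>

lemma remainder_pole:
  "(Psi N l (rad y))\<^sup>2 * hyp_grad2 (\<lambda>y. dr v y / Psi N l (rad y)) y
    = (dr (dr v) y - kappa N l (rad y) * dr v y)\<^sup>2 + (\<Sum>j\<in>UNIV. (dr (ang j v) y)\<^sup>2) / (norm y)\<^sup>2"
proof (cases "y = 0")
  \<comment> \<open>At the pole 0 powr a = 0 and division by norm 0 gives 0, so both sides
    vanish.\<close>
  case True
  then show ?thesis by (simp add: dr_def hyp_dist_zero Psi_def)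
next
  case y: False
  define P where "P = Psi N l (rad y)"
  define K where "K = kappa N l (rad y)"
  note r = hyp_dist_zero_pos[OF y]
  have P: "P > 0" unfolding P_def by (rule Psi_pos[OF r])
  have "((\<lambda>s. inverse (Psi N l s)) has_real_derivative - (K * P) / P\<^sup>2) (at (rad y))"
    by (rule DERIV_cong[OF DERIV_inverse'[OF Psi_derivative[OF r]]])
      (use P in \<open>auto simp: P_def K_def power2_eq_square divide_inverse\<close>)
  note d = radial_derivs[OF y this]
  have e: "(\<lambda>y. dr v y / Psi N l (rad y)) = (\<lambda>y. inverse (Psi N l (rad y)) * dr v y)"
    by (simp add: divide_inverse mult.commute)
  note dv = test_differentiable[OF test_dr[OF v], of y]
  have 1: "dr (\<lambda>y. dr v y / Psi N l (rad y)) y = (dr (dr v) y - K * dr v y) / P"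
    unfolding e dr_mult[OF d(3) dv] d(1) using P
    by (simp add: P_def[symmetric] divide_inverse power2_eq_square algebra_simps)
  have 2: "ang j (\<lambda>y. dr v y / Psi N l (rad y)) y = dr (ang j v) y / P" for j
    unfolding e ang_mult[OF d(3) dv] d(2) ang_dr[OF test_smooth[OF v] y]
    by (simp add: P_def[symmetric] divide_inverse)
  have "P\<^sup>2 * hyp_grad2 (\<lambda>y. dr v y / Psi N l (rad y)) y
    = (dr (dr v) y - K * dr v y)\<^sup>2 + P\<^sup>2 * ((\<Sum>j\<in>UNIV. (dr (ang j v) y)\<^sup>2) / P\<^sup>2 / (norm y)\<^sup>2)"
    using P by (simp add: hyp_grad2_polar[OF y] 1 2 power_divide distrib_left flip: sum_divide_distrib)
  then show ?thesis using P by (simp add: P_def K_def)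
qed

lemma c1_remainder:
  "c1 (\<lambda>y. (Psi N l (rad y))\<^sup>2 * hyp_grad2 (\<lambda>y. dr v y / Psi N l (rad y)) y)"
proof -
  have K: "Ck_on (Suc 0) (- {0}) (\<lambda>y::real^'n. - kappa N l (rad y))"
    by (rule Ck_on_radial[of "\<lambda>s. - kappa N l s" "\<lambda>s. - kappa' N l s"])
      (auto intro!: DERIV_minus kappa_derivative continuous_intros continuous_on_kappa')
  have n: "smooth_on (- {0}) (\<lambda>y::real^'n. 1 / (norm y)\<^sup>2)"
    by (intro smooth_on_divide smooth_on_const smooth_on_power smooth_on_norm open_Compl_0) auto
  have "c1 (\<lambda>y. (dr (dr v) y + - kappa N l (rad y) * dr v y)\<^sup>2 + (1 / (norm y)\<^sup>2) * (\<Sum>j\<in>UNIV. (dr (ang j v) y)\<^sup>2))"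
    by (intro c1_add c1_sum c1_power2 c1_weight[OF K] c1_weight_smooth[OF n] c1_test test_dr test_ang v)
  then show ?thesis unfolding remainder_pole by simp
qed

context
  fixes e p :: "real^'n" and t :: real
  assumes e: "norm e = 1" and p: "boost e t p = 0"
begin

lemma pulled_back_test: "(\<lambda>x. v (boost e t x)) \<in> test_functions p"
  using test_functions_boost[OF e v, of t] pole_eq[OF e p] by simp

lemma pulled_back_grad2: "hyp_grad2 (\<lambda>x. v (boost e t x)) x = hyp_grad2 v (boost e t x)"
  by (rule hyp_grad2_boost[OF e test_differentiable[OF v]])

lemma pulled_back_integrals:
  defines "u \<equiv> \<lambda>x. v (boost e t x)"
  shows "(LINT x|hyp_vol. (hyp_laplacian u x)\<^sup>2) = hyp_int (\<lambda>y. (hyp_laplacian v y)\<^sup>2)"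
    and "(LINT x|hyp_vol. hyp_grad2 u x) = hyp_int (hyp_grad2 v)"
    and "(LINT x|hyp_vol. hyp_grad2 u x / (hyp_dist x p)\<^sup>2) = hyp_int (\<lambda>y. 1 / (rad y)\<^sup>2 * hyp_grad2 v y)"
    and "(LINT x|hyp_vol. hyp_grad2 u x / (sinh (hyp_dist x p))\<^sup>2) = hyp_int (\<lambda>y. 1 / (sinh (rad y))\<^sup>2 * hyp_grad2 v y)"
    and "(LINT x|hyp_vol. (hyp_dist x p * coth (hyp_dist x p) - 1) / (hyp_dist x p)\<^sup>2 * hyp_grad2 u x)
      = hyp_int (\<lambda>y. (rad y * coth (rad y) - 1) / (rad y)\<^sup>2 * hyp_grad2 v y)"
    and "(LINT x|hyp_vol. (Psi N l (hyp_dist x p))\<^sup>2 * hyp_grad2 (\<lambda>y. radial_deriv p u y / Psi N l (hyp_dist y p)) x)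
      = hyp_int (\<lambda>y. (Psi N l (rad y))\<^sup>2 * hyp_grad2 (\<lambda>y. dr v y / Psi N l (rad y)) y)"
proof -
  note r = hyp_dist_pole[OF e p]
  show "(LINT x|hyp_vol. (hyp_laplacian u x)\<^sup>2) = hyp_int (\<lambda>y. (hyp_laplacian v y)\<^sup>2)"
    by (rule integral_hyp_vol_boost[OF e c1_power2[OF c1_test[OF hyp_laplacian_test]]])
      (simp add: u_def hyp_laplacian_boost[OF e test_smooth[OF v]])
  show "(LINT x|hyp_vol. hyp_grad2 u x) = hyp_int (hyp_grad2 v)"
    by (rule integral_hyp_vol_boost[OF e c1_hyp_grad2]) (simp add: u_def pulled_back_grad2)
  show "(LINT x|hyp_vol. hyp_grad2 u x / (hyp_dist x p)\<^sup>2) = hyp_int (\<lambda>y. 1 / (rad y)\<^sup>2 * hyp_grad2 v y)"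
    by (rule integral_hyp_vol_boost[OF e c1_radial_hyp_grad2[OF inverse_square_weight]])
      (simp_all add: u_def pulled_back_grad2 r)
  show "(LINT x|hyp_vol. hyp_grad2 u x / (sinh (hyp_dist x p))\<^sup>2) = hyp_int (\<lambda>y. 1 / (sinh (rad y))\<^sup>2 * hyp_grad2 v y)"
    by (rule integral_hyp_vol_boost[OF e c1_radial_hyp_grad2[OF radial_weight_derivs(1) continuous_on_radial_weights(2)]])
      (simp_all add: u_def pulled_back_grad2 r)
  show "(LINT x|hyp_vol. (hyp_dist x p * coth (hyp_dist x p) - 1) / (hyp_dist x p)\<^sup>2 * hyp_grad2 u x)
      = hyp_int (\<lambda>y. (rad y * coth (rad y) - 1) / (rad y)\<^sup>2 * hyp_grad2 v y)"
    by (rule integral_hyp_vol_boost[OF e c1_radial_hyp_grad2[OF coth_weight]])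
      (simp_all add: u_def pulled_back_grad2 r)
  show "(LINT x|hyp_vol. (Psi N l (hyp_dist x p))\<^sup>2 * hyp_grad2 (\<lambda>y. radial_deriv p u y / Psi N l (hyp_dist y p)) x)
      = hyp_int (\<lambda>y. (Psi N l (rad y))\<^sup>2 * hyp_grad2 (\<lambda>y. dr v y / Psi N l (rad y)) y)"
  proof (rule integral_hyp_vol_boost[OF e c1_remainder])
    fix x
    define g where "g y = dr v y / Psi N l (rad y)" for y
    have "radial_deriv p u y = dr v (boost e t y)" for y
      using radial_deriv_pole[OF e p pulled_back_test, of y] by (simp add: u_def boost_inverse[OF e])
    then have "(\<lambda>y. radial_deriv p u y / Psi N l (hyp_dist y p)) = (\<lambda>y. g (boost e t y))"
      by (simp add: g_def r)
    moreover have "hyp_grad2 (\<lambda>y. g (boost e t y)) x = hyp_grad2 g (boost e t x)"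
    proof (rule hyp_grad2_boost[OF e])
      show "g differentiable (at (boost e t x))"
      proof (cases "boost e t x = 0")
        \<comment> \<open>Near the pole \<open>dr v\<close> vanishes, and with it the
          quotient.\<close>
        case True
        obtain d where d: "d > 0" "\<And>x. dist x 0 < d \<Longrightarrow> dr v x = 0"
          using test_dr[OF v] unfolding test_functions_iff by blast
        show ?thesis unfolding True
          by (rule differentiable_cong_open[of "ball 0 d" _ "\<lambda>_. 0"]) (use d in \<open>auto simp: g_def dist_commute\<close>)
      next
        case y: False
        note h = hyp_dist_zero_pos[OF y]
        show ?thesis
          unfolding g_def[abs_def]
          by (intro differentiable_divide test_differentiable[OF test_dr[OF v]] radial_derivs(3)[OF y Psi_derivative[OF h]])
            (use Psi_pos[OF h, of N l] in simp)
      qed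
    qed
    ultimately show "(Psi N l (hyp_dist x p))\<^sup>2 * hyp_grad2 (\<lambda>y. radial_deriv p u y / Psi N l (hyp_dist y p)) x
      = (Psi N l (rad (boost e t x)))\<^sup>2 * hyp_grad2 (\<lambda>y. dr v y / Psi N l (rad y)) (boost e t x)"
      by (simp add: r g_def[abs_def])
  qed
qed

end

lemma rellich_at_pole:
  fixes l :: real
  defines "N \<equiv> CARD('n)"
  assumes N: "N \<ge> 5" and l: "l \<le> ((real N - 1) / 2)\<^sup>2"
  shows "hyp_int (\<lambda>y. (hyp_laplacian v y)\<^sup>2)
    \<ge> l * hyp_int (hyp_grad2 v)
      + (hN N l)\<^sup>2 * hyp_int (\<lambda>y. 1 / (rad y)\<^sup>2 * hyp_grad2 v y)
      + ((real N / 2)\<^sup>2 - (hN N l)\<^sup>2) * hyp_int (\<lambda>y. 1 / (sinh (rad y))\<^sup>2 * hyp_grad2 v y)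
      + gammaN N l * hN N l * hyp_int (\<lambda>y. (rad y * coth (rad y) - 1) / (rad y)\<^sup>2 * hyp_grad2 v y)
      + hyp_int (\<lambda>y. (Psi N l (rad y))\<^sup>2 * hyp_grad2 (\<lambda>y. dr v y / Psi N l (rad y)) y)"
proof -
  have k: "(kappa N l has_real_derivative kappa' N l s) (at s)" if "s > 0" for s
    by (rule kappa_derivative[OF that])
  have W: "Wgt N l s = - kappa' N l s - (kappa N l s)\<^sup>2 - (real CARD('n) - 1) * (cosh s / sinh s) * kappa N l s"
    if "s > 0" for s
    using Wgt_riccati[OF that l] by (simp add: N_def)
  note core = rellich_pole[OF v k continuous_on_kappa' W]
  note parts = cc0_parts[OF v k continuous_on_kappa' W]
  have g: "hyp_grad2 v y = grad_part v y" if "y \<noteq> 0" for y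
    using hyp_grad2_polar[OF that] by (simp add: grad_part_def[OF v k continuous_on_kappa' W])
  have lap: "hyp_laplacian v y = lap_part v y" if "y \<noteq> 0" for y
    using hyp_laplacian_polar[OF test_smooth[OF v] that]
    by (simp add: lap_part_def[OF v k continuous_on_kappa' W] ang_part_def[OF v])
  have rem: "remainder_part v (kappa N l) = (\<lambda>y. (Psi N l (rad y))\<^sup>2 * hyp_grad2 (\<lambda>y. dr v y / Psi N l (rad y)) y)"
    unfolding remainder_pole by (auto simp: remainder_part_def[OF v k continuous_on_kappa' W])
  note cc = c1_cc0[OF c1_hyp_grad2] c1_cc0[OF c1_radial_hyp_grad2[OF inverse_square_weight]]
    c1_cc0[OF c1_radial_hyp_grad2[OF radial_weight_derivs(1) continuous_on_radial_weights(2)]]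
    c1_cc0[OF c1_radial_hyp_grad2[OF coth_weight]]
  have 1: "hyp_int (\<lambda>y. (lap_part v y)\<^sup>2) = hyp_int (\<lambda>y. (hyp_laplacian v y)\<^sup>2)"
  proof (rule hyp_int_cong[OF cc0_power2[OF parts(3)] cc0_power2[OF cc0_test[OF hyp_laplacian_test]]])
    fix y :: "real^'n" assume "y \<noteq> 0"
    from lap[OF this] show "(lap_part v y)\<^sup>2 = (hyp_laplacian v y)\<^sup>2" by (rule arg_cong[OF sym])
  qed
  have "hyp_int (\<lambda>y. (Wgt N l (rad y) + (real CARD('n) - 1) / (norm y)\<^sup>2) * grad_part v y)
    = hyp_int (\<lambda>y. l * hyp_grad2 v y + (hN N l)\<^sup>2 * (1 / (rad y)\<^sup>2 * hyp_grad2 v y)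
      + ((real N / 2)\<^sup>2 - (hN N l)\<^sup>2) * (1 / (sinh (rad y))\<^sup>2 * hyp_grad2 v y)
      + gammaN N l * hN N l * ((rad y * coth (rad y) - 1) / (rad y)\<^sup>2 * hyp_grad2 v y))"
  proof (rule hyp_int_cong)
    have "continuous_on (- {0}) (\<lambda>y::real^'n. Wgt N l (rad y) + (real CARD('n) - 1) / (norm y)\<^sup>2)"
      by (intro continuous_on_radial[OF continuous_on_W[OF v k continuous_on_kappa' W]] continuous_on_weights) auto
    then show "cc0 (\<lambda>y. (Wgt N l (rad y) + (real CARD('n) - 1) / (norm y)\<^sup>2) * grad_part v y)"
      by (rule cc0_weight) (rule parts)
    show "cc0 (\<lambda>y. l * hyp_grad2 v y + (hN N l)\<^sup>2 * (1 / (rad y)\<^sup>2 * hyp_grad2 v y)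
      + ((real N / 2)\<^sup>2 - (hN N l)\<^sup>2) * (1 / (sinh (rad y))\<^sup>2 * hyp_grad2 v y)
      + gammaN N l * hN N l * ((rad y * coth (rad y) - 1) / (rad y)\<^sup>2 * hyp_grad2 v y))"
      by (intro cc0_add cc0_cmult cc)
    fix y :: "real^'n" assume y: "y \<noteq> 0"
    \<comment> \<open>The extra (N-1)/sinh^2 raises the constant of the Hardy weight to that of the
      theorem.\<close>
    have "((real N - 2) / 2)\<^sup>2 + (real N - 1) = (real N / 2)\<^sup>2"
      by (simp add: power2_eq_square field_simps)
    then have "((real N / 2)\<^sup>2 - (hN N l)\<^sup>2) * (1 / (norm y)\<^sup>2)
        = (((real N - 2) / 2)\<^sup>2 - (hN N l)\<^sup>2) * (1 / (norm y)\<^sup>2) + (real N - 1) / (norm y)\<^sup>2"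
      by (metis (no_types, opaque_lifting) add_diff_eq diff_add_eq distrib_right mult_1_right times_divide_eq_right)
    then show "(Wgt N l (rad y) + (real CARD('n) - 1) / (norm y)\<^sup>2) * grad_part v y
      = l * hyp_grad2 v y + (hN N l)\<^sup>2 * (1 / (rad y)\<^sup>2 * hyp_grad2 v y)
      + ((real N / 2)\<^sup>2 - (hN N l)\<^sup>2) * (1 / (sinh (rad y))\<^sup>2 * hyp_grad2 v y)
      + gammaN N l * hN N l * ((rad y * coth (rad y) - 1) / (rad y)\<^sup>2 * hyp_grad2 v y)"
      unfolding g[OF y] Wgt_def N_def[symmetric] sinh_hyp_dist_zero mult.assoc[symmetric] distrib_right[symmetric]
      by (simp only: add_ac)
  qed
  also have "\<dots> = l * hyp_int (hyp_grad2 v)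
      + (hN N l)\<^sup>2 * hyp_int (\<lambda>y. 1 / (rad y)\<^sup>2 * hyp_grad2 v y)
      + ((real N / 2)\<^sup>2 - (hN N l)\<^sup>2) * hyp_int (\<lambda>y. 1 / (sinh (rad y))\<^sup>2 * hyp_grad2 v y)
      + gammaN N l * hN N l * hyp_int (\<lambda>y. (rad y * coth (rad y) - 1) / (rad y)\<^sup>2 * hyp_grad2 v y)"
    by (simp only: hyp_int_add hyp_int_cmult cc0_add cc0_cmult cc)
  finally show ?thesis
    using core N unfolding 1 rem by (simp add: N_def)
qed

end

section \<open>A smooth bump function\<close>

text \<open>The k-th derivative of exp (-1/x) is this polynomial at z = 1/x times exp (-z). The
  recursion is d/dx = -z^2 d/dz.\<close>

primrec flat_poly :: "nat \<Rightarrow> real poly" where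
  "flat_poly 0 = 1"
| "flat_poly (Suc k) = [:0, 0, 1:] * (flat_poly k - pderiv (flat_poly k))"

definition flat :: "nat \<Rightarrow> real \<Rightarrow> real" where
  "flat k x = (if x > 0 then poly (flat_poly k) (inverse x) * exp (- inverse x) else 0)"

lemma poly_div_exp_tendsto_0: "((\<lambda>z::real. poly p z / exp z) \<longlongrightarrow> 0) at_top"
proof -
  have "((\<lambda>z::real. \<Sum>i\<le>degree p. coeff p i * (z ^ i / exp z)) \<longlongrightarrow> (\<Sum>i\<le>degree p. coeff p i * 0)) at_top"
    by (intro tendsto_sum tendsto_mult tendsto_const tendsto_power_div_exp_0)
  then show ?thesis by (simp add: poly_altdef sum_divide_distrib)
qed

lemma flat_derivative: "(flat k has_real_derivative flat (Suc k) x) (at x)"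
proof -
  consider "x > 0" | "x < 0" | "x = 0" by linarith
  then show ?thesis
  proof cases
    case 1
    define p where "p = flat_poly k"
    have "((\<lambda>x. poly p (inverse x) * exp (- inverse x)) has_real_derivative
        (poly (pderiv p) (inverse x) * - (inverse x * inverse x)) * exp (- inverse x)
        + poly p (inverse x) * (exp (- inverse x) * (inverse x * inverse x))) (at x)"
      using 1 by (auto intro!: derivative_eq_intros poly_DERIV[THEN DERIV_chain2] simp: power2_eq_square)
    also have "(poly (pderiv p) (inverse x) * - (inverse x * inverse x)) * exp (- inverse x)
        + poly p (inverse x) * (exp (- inverse x) * (inverse x * inverse x)) = flat (Suc k) x"
      using 1 by (simp add: flat_def p_def algebra_simps)
    finally show ?thesis
      by (rule has_field_derivative_transform_within_open[of _ _ _ "{0<..}"]) (use 1 in \<open>auto simp: flat_def p_def\<close>)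
  next
    case 2
    have "((\<lambda>_. 0) has_real_derivative flat (Suc k) x) (at x)" using 2 by (simp add: flat_def)
    then show ?thesis
      by (rule has_field_derivative_transform_within_open[of _ _ _ "{..<0}"]) (use 2 in \<open>auto simp: flat_def\<close>)
  next
    \<comment> \<open>As flat k 0 = 0, the difference quotient is flat k h / h; on the right, z =
      1/h turns it into a polynomial over exp z.\<close>
    case 3
    have "((\<lambda>h. flat k h / h) \<longlongrightarrow> 0) (at_left 0)"
      by (rule tendsto_eventually) (auto simp: flat_def eventually_at_filter)
    moreover have "((\<lambda>h. flat k h / h) \<longlongrightarrow> 0) (at_right 0)"
      unfolding filterlim_at_right_to_top
    proof (rule Lim_transform_eventually[OF poly_div_exp_tendsto_0[of "pCons 0 (flat_poly k)"]])
      show "\<forall>\<^sub>F z in at_top. poly (pCons 0 (flat_poly k)) z / exp z = flat k (inverse z) / inverse z"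
        using eventually_gt_at_top[of 0] by eventually_elim (auto simp: flat_def exp_minus field_simps)
    qed
    ultimately have "((\<lambda>h. flat k h / h) \<longlongrightarrow> 0) (at 0)" by (simp add: filterlim_split_at)
    then show ?thesis by (simp add: 3 DERIV_def flat_def)
  qed
qed

lemma smooth1_flat: "smooth1 UNIV (flat 0)"
  unfolding smooth1_def by (intro exI[of _ flat]) (auto intro: flat_derivative)

text \<open>Evaluated at ln (norm y) / k, its support (-4, -1) lies off the pole but inside norm y <
  exp (-k), and leaves room for the interval [-3, -2] where it is bounded below.\<close>

definition bump :: "real \<Rightarrow> real" where
  "bump x = flat 0 (x + 4) * flat 0 (- 1 - x)"

definition bump1 :: "real \<Rightarrow> real" where
  "bump1 x = flat 1 (x + 4) * flat 0 (- 1 - x) - flat 0 (x + 4) * flat 1 (- 1 - x)"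

definition bump2 :: "real \<Rightarrow> real" where
  "bump2 x = flat 2 (x + 4) * flat 0 (- 1 - x) - 2 * flat 1 (x + 4) * flat 1 (- 1 - x)
     + flat 0 (x + 4) * flat 2 (- 1 - x)"

lemma flat_shift_derivatives:
  "((\<lambda>x. flat k (x + 4)) has_real_derivative flat (Suc k) (x + 4)) (at x)"
  "((\<lambda>x. flat k (- 1 - x)) has_real_derivative - flat (Suc k) (- 1 - x)) (at x)"
proof -
  have "((\<lambda>x::real. x + 4) has_real_derivative 1) (at x)" "((\<lambda>x::real. - 1 - x) has_real_derivative - 1) (at x)"
    by (auto intro!: derivative_eq_intros)
  from DERIV_chain2[OF flat_derivative[of k] this(1)] DERIV_chain2[OF flat_derivative[of k] this(2)]
  show "((\<lambda>x. flat k (x + 4)) has_real_derivative flat (Suc k) (x + 4)) (at x)"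
    "((\<lambda>x. flat k (- 1 - x)) has_real_derivative - flat (Suc k) (- 1 - x)) (at x)" by simp_all
qed

lemma bump_derivative: "(bump has_real_derivative bump1 x) (at x)"
  unfolding bump_def[abs_def]
  by (rule DERIV_cong[OF DERIV_mult'[OF flat_shift_derivatives(1) flat_shift_derivatives(2)]])
    (simp add: bump1_def)

lemma bump1_derivative: "(bump1 has_real_derivative bump2 x) (at x)"
  unfolding bump1_def[abs_def]
  by (rule DERIV_cong[OF DERIV_diff[OF DERIV_mult'[OF flat_shift_derivatives(1) flat_shift_derivatives(2)]
          DERIV_mult'[OF flat_shift_derivatives(1) flat_shift_derivatives(2)]]])
    (simp add: bump2_def eval_nat_numeral)

lemma bump_eq_0:
  assumes "x \<le> - 4 \<or> x \<ge> - 1"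
  shows "bump x = 0" "bump1 x = 0" "bump2 x = 0"
  using assms by (auto simp: bump_def bump1_def bump2_def flat_def)

lemma bump_pos: "- 4 < x \<Longrightarrow> x < - 1 \<Longrightarrow> bump x > 0"
  by (simp add: bump_def flat_def)

lemma bump_bounds:
  "\<exists>K>0. \<exists>c>0. (\<forall>x. \<bar>bump x\<bar> \<le> K \<and> \<bar>bump1 x\<bar> \<le> K \<and> \<bar>bump2 x\<bar> \<le> K)
    \<and> (\<forall>x. - 3 \<le> x \<and> x \<le> - 2 \<longrightarrow> bump x \<ge> c)"
proof -
  have c: "continuous_on S bump" "continuous_on S bump1" for S
    using bump_derivative bump1_derivative by (meson DERIV_isCont continuous_at_imp_continuous_on)+
  have cf: "continuous_on S (\<lambda>x. flat k (x + 4))" "continuous_on S (\<lambda>x. flat k (- 1 - x))" for k S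
    using flat_shift_derivatives by (meson DERIV_isCont continuous_at_imp_continuous_on)+
  have c2: "continuous_on S bump2" for S
    unfolding bump2_def[abs_def] by (intro continuous_intros cf)
  have "\<exists>K. \<forall>x. \<bar>f x\<bar> \<le> K" if f: "continuous_on {-4..-1} f" "\<And>x. x \<le> - 4 \<or> x \<ge> - 1 \<Longrightarrow> f x = 0" for f :: "real \<Rightarrow> real"
  proof -
    have "bounded (f ` {-4..-1})"
      by (intro compact_imp_bounded compact_continuous_image f) auto
    then have "\<exists>K. \<forall>x\<in>{-4..-1}. \<bar>f x\<bar> \<le> K" by (simp add: bounded_iff)
    then obtain K where K: "\<And>x. x \<in> {-4..-1} \<Longrightarrow> \<bar>f x\<bar> \<le> K" by blast
    then have "0 \<le> K" using order_trans[OF abs_ge_zero K[of "-1"]] by simp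
    then have "\<bar>f x\<bar> \<le> K" for x using K[of x] f(2)[of x] by (cases "x \<in> {-4..-1}") auto
    then show ?thesis by blast
  qed
  from this[OF c(1) bump_eq_0(1)] this[OF c(2) bump_eq_0(2)] this[OF c2 bump_eq_0(3)]
  obtain K0 K1 K2 where K: "\<And>x. \<bar>bump x\<bar> \<le> K0" "\<And>x. \<bar>bump1 x\<bar> \<le> K1" "\<And>x. \<bar>bump2 x\<bar> \<le> K2" by blast
  obtain z where z: "z \<in> {-3..-2}" "\<And>x. x \<in> {-3..-2} \<Longrightarrow> bump z \<le> bump x"
    using continuous_attains_inf[of "{-3..-2}" bump] c by auto
  let ?K = "max 1 (max K0 (max K1 K2))"
  have "\<bar>bump x\<bar> \<le> ?K \<and> \<bar>bump1 x\<bar> \<le> ?K \<and> \<bar>bump2 x\<bar> \<le> ?K" for x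
    by (intro conjI order_trans[OF K(1)] order_trans[OF K(2)] order_trans[OF K(3)]) auto
  moreover have "bump z > 0" using z by (intro bump_pos) auto
  moreover have "0 < ?K" by simp
  moreover have "bump z \<le> bump x" if "- 3 \<le> x \<and> x \<le> - 2" for x using z(2) that by simp
  ultimately show ?thesis by blast
qed

section \<open>Logarithmic annuli\<close>

definition ann :: "real \<Rightarrow> real \<Rightarrow> (real^'n) set" where
  "ann a b = {y. exp a \<le> norm y \<and> norm y < exp b}"

text \<open>The dilation-invariant density norm y^(-N): its integral over an annulus depends only on
  the logarithmic length b - a.\<close>

definition ann_fun :: "real \<Rightarrow> real \<Rightarrow> real^'n \<Rightarrow> real" where
  "ann_fun a b y = indicator (ann a b) y * inverse (norm y) ^ CARD('n)"

lemma ann_borel [measurable]: "ann a b \<in> sets borel"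
  unfolding ann_def by measurable

lemma ann_fun_measurable [measurable]: "ann_fun a b \<in> borel_measurable borel"
  unfolding ann_fun_def[abs_def] by measurable

lemma ann_fun_nonneg: "0 \<le> ann_fun a b y"
  by (simp add: ann_fun_def indicator_def)

lemma ann_fun_integrable: "integrable lborel (ann_fun a b :: real^'n \<Rightarrow> real)"
proof (rule Bochner_Integration.integrable_bound)
  show "integrable lborel (\<lambda>y::real^'n. indicator (cball 0 (exp b)) y *\<^sub>R inverse (exp a) ^ CARD('n))"
    by (rule borel_integrable_compact) auto
  show "AE y in lborel. norm (ann_fun a b y) \<le> norm (indicator (cball 0 (exp b)) (y::real^'n) *\<^sub>R inverse (exp a) ^ CARD('n))"
    by (rule AE_I2) (auto simp: ann_fun_def ann_def indicator_def abs_mult power_abs intro!: power_mono le_imp_inverse_le)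
qed auto

text \<open>The density norm y^(-N) cancels the Jacobian of the dilation by exp c.\<close>

lemma ann_fun_scale:
  "(LINT y|lborel. ann_fun (a + c) (b + c) (y :: real^'n)) = (LINT y|lborel. ann_fun a b (y :: real^'n))"
proof -
  define k where "k = exp c"
  have k: "k > 0" by (simp add: k_def)
  have "(LINT y|lborel. ann_fun (a + c) (b + c) (y :: real^'n))
    = (LINT y|density (distr lborel borel (\<lambda>x::real^'n. 0 + k *\<^sub>R x)) (\<lambda>_. \<bar>k\<bar>^DIM(real^'n)). ann_fun (a + c) (b + c) y)"
    using lborel_affine[of k "0::real^'n"] k by simp
  also have "\<dots> = (LINT y|distr lborel borel (\<lambda>x::real^'n. 0 + k *\<^sub>R x). \<bar>k\<bar>^DIM(real^'n) *\<^sub>R ann_fun (a + c) (b + c) y)"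
    by (subst integral_density[symmetric]) (auto simp: ennreal_power)
  also have "\<dots> = (LINT y|lborel. \<bar>k\<bar>^DIM(real^'n) *\<^sub>R ann_fun (a + c) (b + c) (0 + k *\<^sub>R y :: real^'n))"
    by (rule integral_distr) auto
  also have "\<dots> = (LINT y|lborel. ann_fun a b (y :: real^'n))"
  proof (rule Bochner_Integration.integral_cong[OF refl])
    fix y :: "real^'n"
    have "0 + k *\<^sub>R y \<in> ann (a + c) (b + c) \<longleftrightarrow> y \<in> ann a b"
      using k by (auto simp: ann_def exp_add k_def[symmetric] mult.commute[of _ k])
    then show "\<bar>k\<bar>^DIM(real^'n) *\<^sub>R ann_fun (a + c) (b + c) (0 + k *\<^sub>R y) = ann_fun a b y"
      using k by (simp add: ann_fun_def indicator_def power_mult_distrib) (simp flip: power_mult_distrib)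
  qed
  finally show ?thesis .
qed

lemma ann_fun_split:
  assumes "a \<le> b" "b \<le> c"
  shows "(LINT y|lborel. ann_fun a c (y :: real^'n)) = (LINT y|lborel. ann_fun a b (y :: real^'n)) + (LINT y|lborel. ann_fun b c (y :: real^'n))"
proof -
  have "ann_fun a c y = ann_fun a b y + ann_fun b c y" for y :: "real^'n"
  proof -
    have "exp a \<le> exp b" "exp b \<le> exp c" using assms by auto
    then show ?thesis by (auto simp: ann_fun_def indicator_def ann_def simp del: exp_le_cancel_iff)
  qed
  then show ?thesis by (simp add: ann_fun_integrable)
qed

text \<open>Integer lengths suffice, since the scale k of the cutoff is taken to be a natural
  number.\<close>

lemma ann_fun_length:
  "(LINT y|lborel. ann_fun a (a + real m) (y :: real^'n)) = real m * (LINT y|lborel. ann_fun 0 1 (y :: real^'n))"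
proof (induction m)
  case 0
  have "ann_fun a a (y :: real^'n) = 0" for y by (auto simp: ann_fun_def ann_def)
  then show ?case by simp
next
  case (Suc m)
  have "(LINT y|lborel. ann_fun a (a + real (Suc m)) (y :: real^'n))
      = (LINT y|lborel. ann_fun a (a + real m) (y :: real^'n)) + (LINT y|lborel. ann_fun (a + real m) (a + real (Suc m)) (y :: real^'n))"
    by (rule ann_fun_split) auto
  also have "(LINT y|lborel. ann_fun (a + real m) (a + real (Suc m)) (y :: real^'n)) = (LINT y|lborel. ann_fun 0 1 (y :: real^'n))"
    using ann_fun_scale[of 0 "a + real m" 1] by (simp add: add_ac)
  finally show ?case by (simp add: Suc.IH distrib_right)
qed

lemma ann_fun_pos: "0 < (LINT y|lborel. ann_fun 0 1 (y :: real^'n))"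
proof -
  fix i :: 'n
  \<comment> \<open>As e is at least 2, the ball of radius 1/4 about a point of norm 3/2 lies in the
    annulus between 1 and e.\<close>
  let ?z = "(3/2) *\<^sub>R axis i 1 :: real^'n"
  have nz: "norm ?z = 3/2" by simp
  have e2: "exp 1 \<ge> (2::real)" using exp_ge_add_one_self[of "1::real"] by simp
  have sub: "ball ?z (1/4) \<subseteq> ann 0 1"
  proof
    fix y assume "y \<in> ball ?z (1/4)"
    then have "norm (y - ?z) < 1/4" by (simp add: dist_norm norm_minus_commute)
    moreover have "\<bar>norm y - norm ?z\<bar> \<le> norm (y - ?z)" by (rule norm_triangle_ineq3)
    ultimately have "1 \<le> norm y" "norm y < 2" using nz by linarith+
    then show "y \<in> ann 0 1" using e2 by (simp add: ann_def)
  qed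
  have "0 < measure lborel (ball ?z (1/4)) * inverse (exp 1) ^ CARD('n)"
    by (simp add: content_ball_pos)
  also have "\<dots> = (LINT y|lborel. indicator (ball ?z (1/4)) y * inverse (exp 1) ^ CARD('n))"
    by simp
  also have "\<dots> \<le> (LINT y|lborel. ann_fun 0 1 (y :: real^'n))"
  proof (rule integral_mono)
    show "integrable lborel (\<lambda>y. indicator (ball ?z (1/4)) y * inverse (exp 1) ^ CARD('n) :: real)"
      using emeasure_lborel_ball_finite[of ?z "1/4"] by (intro integrable_mult_left integrable_real_indicator) auto
    show "indicator (ball ?z (1/4)) y * inverse (exp 1) ^ CARD('n) \<le> ann_fun 0 1 y" for y :: "real^'n"
    proof (cases "y \<in> ball ?z (1/4)")
      case True
      then have y: "y \<in> ann 0 1" using sub by blast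
      then have "1 \<le> norm y" "norm y \<le> exp 1" by (auto simp: ann_def)
      then have "inverse (exp 1) ^ CARD('n) \<le> inverse (norm y) ^ CARD('n)"
        by (intro power_mono le_imp_inverse_le) (auto intro: less_le_trans[of 0 1])
      then show ?thesis using y True by (simp add: ann_fun_def)
    qed (simp add: ann_fun_nonneg)
  qed (rule ann_fun_integrable)
  finally show ?thesis .
qed

section \<open>Sharpness\<close>

lemma dr_cong_open:
  assumes "open S" "y \<in> S" "\<And>x. x \<in> S \<Longrightarrow> f x = g x"
  shows "dr f y = dr g y"
  using pd_cong_open[OF assms] by (simp add: dr_def euler_def)

lemma test_functionsI:
  assumes "smooth_on (- {0}) f" "\<And>x. norm x > R \<Longrightarrow> f x = 0" "d > 0" "\<And>x. norm x < d \<Longrightarrow> f x = 0"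
  shows "f \<in> test_functions (0 :: real^'n)"
proof -
  have "smooth_on (ball 0 d) f"
    by (rule smooth_on_cong[OF _ smooth_on_const[of _ 0]]) (use assms(4) in auto)
  from smooth_on_Un[OF open_Compl_0 open_ball assms(1) this]
  have "smooth_on (- {0} \<union> ball 0 d) f" .
  moreover have "- {0} \<union> ball (0::real^'n) d = UNIV" using assms(3) by auto
  ultimately have "smooth_on UNIV f" by metis
  then show ?thesis unfolding test_functions_iff using assms(2-4) by auto
qed

section \<open>The radial test functions\<close>

context
  fixes al k :: real
  assumes k: "k > 0"
begin

text \<open>The derivative of s^(1-al) bump (ln s / k) is s^(-al) profile (ln s); each derivative
  falling on the cutoff costs a factor 1 / k.\<close>

definition profile :: "real \<Rightarrow> real" where
  "profile m = (1 - al) * bump (m / k) + bump1 (m / k) / k"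

definition profile' :: "real \<Rightarrow> real" where
  "profile' m = (1 - al) * bump1 (m / k) / k + bump2 (m / k) / k\<^sup>2"

lemma profile_derivative: "(profile has_real_derivative profile' m) (at m)"
proof -
  have "((\<lambda>m. m / k) has_real_derivative 1 / k) (at m)"
    using k by (auto intro!: derivative_eq_intros)
  note * = DERIV_chain2[OF bump_derivative this] DERIV_chain2[OF bump1_derivative this]
  show ?thesis
    unfolding profile_def[abs_def]
    by (rule DERIV_cong[OF DERIV_add[OF DERIV_cmult[OF *(1)] DERIV_cdivide[OF *(2)]]])
      (simp add: profile'_def power2_eq_square)
qed

lemma powr_bump_derivative:
  assumes "s > 0"
  shows "((\<lambda>s. s powr (1 - al) * bump (ln s / k)) has_real_derivative s powr (- al) * profile (ln s)) (at s)"
    and "((\<lambda>s. s powr (- al) * profile (ln s)) has_real_derivative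
      s powr (- al - 1) * (profile' (ln s) - al * profile (ln s))) (at s)"
proof -
  have ln: "(ln has_real_derivative 1 / s) (at s)" using assms by (auto intro!: derivative_eq_intros)
  have p: "((\<lambda>s. s powr q) has_real_derivative q * s powr (q - 1)) (at s)" for q
    using assms by (auto intro!: derivative_eq_intros)
  have s: "s powr (q - 1) = s powr q * (1 / s)" for q
    using assms by (simp add: powr_diff)
  have b: "((\<lambda>s. bump (ln s / k)) has_real_derivative bump1 (ln s / k) * (1 / s / k)) (at s)"
    by (rule DERIV_chain2[OF bump_derivative DERIV_cdivide[OF ln]])
  have "s powr (1 - al) = s powr (- al) * s" using assms by (simp add: powr_diff powr_minus_divide)
  then show "((\<lambda>s. s powr (1 - al) * bump (ln s / k)) has_real_derivative s powr (- al) * profile (ln s)) (at s)"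
    using assms by (intro DERIV_cong[OF DERIV_mult'[OF p b]]) (simp add: profile_def s algebra_simps)
  show "((\<lambda>s. s powr (- al) * profile (ln s)) has_real_derivative
      s powr (- al - 1) * (profile' (ln s) - al * profile (ln s))) (at s)"
    by (rule DERIV_cong[OF DERIV_mult'[OF p DERIV_chain2[OF profile_derivative ln]]])
      (simp add: s algebra_simps)
qed

text \<open>With \<open>al = (N - 2) / 2\<close> this is the borderline function of the Rellich inequality, cut off at
  logarithmic scale \<open>k\<close>.\<close>

definition radial_test :: "real^'n \<Rightarrow> real" where
  "radial_test y = norm y powr (1 - al) * bump (ln (norm y) / k)"

lemma radial_test_test: "radial_test \<in> test_functions (0 :: real^'n)"
proof (rule test_functionsI[where R = 1 and d = "exp (- 4 * k)"])
  have *: "smooth_on (- {0}) (\<lambda>y::real^'n. flat 0 (c + ln (norm y) * q))" for c q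
    by (rule smooth_on_comp1[OF open_Compl_0 smooth1_flat])
      (auto intro!: smooth_on_add smooth_on_const smooth_on_mult smooth_on_ln smooth_on_norm open_Compl_0)
  have "smooth_on (- {0}) (\<lambda>y::real^'n. norm y powr (1 - al) *
      (flat 0 (4 + ln (norm y) * (1 / k)) * flat 0 (- 1 + ln (norm y) * (- 1 / k))))"
    by (intro smooth_on_mult smooth_on_powr smooth_on_norm open_Compl_0 *) auto
  then show "smooth_on (- {0}) (radial_test :: real^'n \<Rightarrow> real)"
    by (simp add: radial_test_def[abs_def] bump_def add.commute)
  show "radial_test x = 0" if "norm x > 1" for x :: "real^'n"
  proof -
    have "ln (norm x) / k \<ge> 0" using that k by simp
    then show ?thesis by (simp add: radial_test_def bump_eq_0)
  qed
  show "radial_test x = 0" if "norm x < exp (- 4 * k)" for x :: "real^'n"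
  proof (cases "x = 0")
    case False
    then have "ln (norm x) < - 4 * k" using that by (metis exp_less_mono exp_ln ln_less_cancel_iff ln_exp norm_eq_zero zero_less_norm_iff exp_gt_zero)
    then have "ln (norm x) / k \<le> - 4" using k by (simp add: field_simps)
    then show ?thesis by (simp add: radial_test_def bump_eq_0)
  qed (simp add: radial_test_def)
qed simp

lemma radial_test_derivs:
  fixes y :: "real^'n"
  assumes y: "y \<noteq> 0"
  defines "s \<equiv> norm y" and "m \<equiv> ln (norm y)"
  shows "dr radial_test y = hgt y * (s powr (- al) * profile m)"
    and "ang j radial_test y = 0"
    and "dr (dr radial_test) y
      = s powr (- al - 1) * (s\<^sup>2 * profile m + (hgt y)\<^sup>2 * (profile' m - al * profile m))"
proof -
  have e: "radial_test = (\<lambda>y::real^'n. (\<lambda>t. sinh t powr (1 - al) * bump (ln (sinh t) / k)) (rad y))"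
    by (simp add: radial_test_def[abs_def])
  have sh: "(sinh has_real_derivative cosh t) (at t)" for t :: real
    by (auto intro!: derivative_eq_intros)
  have d1: "((\<lambda>t. sinh t powr (1 - al) * bump (ln (sinh t) / k)) has_real_derivative
      sinh t powr (- al) * profile (ln (sinh t)) * cosh t) (at t)" if "t > 0" for t
    by (rule DERIV_chain2[OF powr_bump_derivative(1) sh]) (use that in simp)
  have dr1: "dr radial_test x = hgt x * (norm x powr (- al) * profile (ln (norm x)))" if "x \<noteq> 0" for x :: "real^'n"
    unfolding e radial_derivs(1)[OF that d1[OF hyp_dist_zero_pos[OF that]]] by simp
  show "dr radial_test y = hgt y * (s powr (- al) * profile m)"
    unfolding s_def m_def by (rule dr1[OF y])
  show "ang j radial_test y = 0"
    unfolding e by (rule radial_derivs(2)[OF y d1[OF hyp_dist_zero_pos[OF y]]])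
  define t where "t = rad y"
  have t: "t > 0" unfolding t_def by (rule hyp_dist_zero_pos[OF y])
  have ch: "(cosh has_real_derivative sinh t) (at t)"
    by (auto intro!: derivative_eq_intros)
  have st: "sinh t > 0" using t by simp
  note d2 = DERIV_mult'[OF ch DERIV_chain2[OF powr_bump_derivative(2)[OF st] sh]]
  have "dr (dr radial_test) y = dr (\<lambda>y::real^'n. (\<lambda>t. cosh t * (sinh t powr (- al) * profile (ln (sinh t)))) (rad y)) y"
    by (rule dr_cong_open[OF open_Compl_0]) (use y dr1 in auto)
  also have "\<dots> = cosh t * (sinh t powr (- al - 1) * (profile' (ln (sinh t)) - al * profile (ln (sinh t))) * cosh t)
      + sinh t * (sinh t powr (- al) * profile (ln (sinh t)))"
    by (rule radial_derivs(1)[OF y]) (use d2 in \<open>simp add: t_def\<close>)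
  also have "sinh t = s" by (simp add: t_def s_def)
  also have "cosh t = hgt y" by (simp add: t_def)
  also have "s powr (- al) = s powr (- al - 1) * s"
    using y by (simp add: s_def powr_diff)
  finally show "dr (dr radial_test) y
      = s powr (- al - 1) * (s\<^sup>2 * profile m + (hgt y)\<^sup>2 * (profile' m - al * profile m))"
    by (simp add: s_def m_def power2_eq_square algebra_simps)
qed

lemma profile_support:
  assumes "m \<le> - 4 * k \<or> m \<ge> - k"
  shows "profile m = 0" "profile' m = 0"
proof -
  have "m / k \<le> - 4 \<or> m / k \<ge> - 1" using assms k by (auto simp: field_simps)
  then show "profile m = 0" "profile' m = 0" by (simp_all add: profile_def profile'_def bump_eq_0)
qed

end

text \<open>The exponent al = (N-2)/2 is borderline: squared second derivatives of the test function
  scale exactly like the dilation-invariant density.\<close>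

lemma norm_powr_CARD:
  fixes y :: "real^'n"
  assumes "y \<noteq> 0"
  shows "(norm y powr (- ((real CARD('n) - 2) / 2) - 1))\<^sup>2 = inverse (norm y) ^ CARD('n)"
proof -
  have "(norm y powr (- ((real CARD('n) - 2) / 2) - 1))\<^sup>2 = norm y powr (- real CARD('n))"
    by (simp add: power2_eq_square powr_add[symmetric])
  also have "\<dots> = inverse (norm y) ^ CARD('n)"
    using assms by (simp add: powr_minus powr_realpow power_inverse)
  finally show ?thesis .
qed

text \<open>After 1 + s2 is taken out, the coefficient s2 / (1 + s2) - al of z has modulus at most
  al, so the curvature correction only helps; x is then split off by Young's inequality with
  parameter et.\<close>

lemma weighted_square_bound:
  fixes x z s2 al et :: real
  assumes al: "al \<ge> 1" and s2: "s2 \<ge> 0" and et: "et > 0"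
  shows "(s2 * z + (1 + s2) * (x - al * z))\<^sup>2
    \<le> (1 + s2)\<^sup>2 * ((1 + et) * al\<^sup>2 * z\<^sup>2 + (1 + 1 / et) * x\<^sup>2)"
proof -
  define w where "w = (s2 / (1 + s2) - al) * z"
  have p: "1 + s2 > 0" using s2 by simp
  have e: "s2 * z + (1 + s2) * (x - al * z) = (1 + s2) * (x + w)"
    using p by (simp add: w_def field_simps)
  have "\<bar>s2 / (1 + s2) - al\<bar> \<le> al"
  proof -
    have "0 \<le> s2 / (1 + s2)" "s2 / (1 + s2) \<le> 1" using s2 by (auto simp: field_simps)
    then show ?thesis using al by linarith
  qed
  then have "(s2 / (1 + s2) - al)\<^sup>2 \<le> al\<^sup>2" using abs_le_square_iff[of _ al] al by simp
  then have w: "w\<^sup>2 \<le> al\<^sup>2 * z\<^sup>2" by (simp add: w_def power_mult_distrib mult_right_mono)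
  have "0 \<le> (et * w - x)\<^sup>2 / et" using et by simp
  then have "2 * x * w \<le> et * w\<^sup>2 + x\<^sup>2 / et"
    using et by (simp add: power2_eq_square field_simps)
  then have "(x + w)\<^sup>2 \<le> (1 + et) * w\<^sup>2 + (1 + 1 / et) * x\<^sup>2"
    by (simp add: power2_sum algebra_simps)
  also have "\<dots> \<le> (1 + et) * (al\<^sup>2 * z\<^sup>2) + (1 + 1 / et) * x\<^sup>2"
    using w et by (intro add_right_mono mult_left_mono) auto
  finally show ?thesis
    unfolding e power_mult_distrib by (intro mult_left_mono) (simp_all add: mult.assoc)
qed

text \<open>Near the pole the space is almost Euclidean, and for a radial function like norm
  y^(1-al) the ratio of the two integrals is close to al^2. Cut off on logarithmic scale k, the bulk
  yields a gain of order k, while derivatives of the cutoff lose only k times 1 / k^2.\<close>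

lemma sharp_at_pole:
  fixes ep :: real
  assumes N: "CARD('n) \<ge> 5" and ep: "ep > 0"
  obtains v :: "real^'n \<Rightarrow> real" where "v \<in> test_functions 0" "\<And>j y. y \<noteq> 0 \<Longrightarrow> ang j v y = 0"
    "hyp_int (\<lambda>y. (dr (dr v) y)\<^sup>2) < (((real CARD('n) - 2) / 2)\<^sup>2 + ep) * hyp_int (\<lambda>y. 1 / (norm y)\<^sup>2 * (dr v y)\<^sup>2)"
proof -
  define al where "al = (real CARD('n) - 2) / 2"
  have al: "al \<ge> 3/2" using N by (simp add: al_def)
  obtain K c where K: "K > 0" "c > 0" "\<And>x. \<bar>bump x\<bar> \<le> K" "\<And>x. \<bar>bump1 x\<bar> \<le> K" "\<And>x. \<bar>bump2 x\<bar> \<le> K"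
    "\<And>x. - 3 \<le> x \<Longrightarrow> x \<le> - 2 \<Longrightarrow> bump x \<ge> c" using bump_bounds by blast
  \<comment> \<open>Young's inequality may use up a quarter of the excess: (1 + et) al^2 = al^2 + ep
    / 4.\<close>
  define et where "et = ep / (4 * al\<^sup>2)"
  have et: "et > 0" using ep al by (simp add: et_def)
  have et_al: "(1 + et) * al\<^sup>2 = al\<^sup>2 + ep / 4" using al by (simp add: et_def distrib_right)
  \<comment> \<open>c1 is the half of ep that survives times the lower bound of ph^2; c2 / k^2 is
    the upper bound of the term with ph'.\<close>
  define c1 where "c1 = ep / 2 * (c / 4)\<^sup>2"
  define c2 where "c2 = 4 * (1 + 1 / et) * (al * K)\<^sup>2"
  have c1: "c1 > 0" and c2: "c2 > 0" using ep K et al by (simp_all add: c1_def c2_def add_pos_pos)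
  \<comment> \<open>The entries make, in order, the cutoff term in \<open>ph\<close> at most c / 4,
    the curvature correction at most ep / 4, and the gain larger than the loss; the final 1 gives k
    > 1.\<close>
  define B where "B = max (4 * K / c) (max (2 * (al\<^sup>2 + ep / 4) / ep) (5 * c2 / c1)) + 1"
  obtain n :: nat where n: "real n > B" using reals_Archimedean2 by blast
  define k where "k = real n"
  have kB: "k > 4 * K / c" "k > 2 * (al\<^sup>2 + ep / 4) / ep" "k > 5 * c2 / c1" and k1: "k > 1"
  proof -
    show "k > 4 * K / c" "k > 2 * (al\<^sup>2 + ep / 4) / ep" "k > 5 * c2 / c1" using n by (auto simp: k_def B_def)
    have "4 * K / c > 0" using K by simp
    then show "k > 1" using n by (auto simp: k_def B_def)
  qed
  then have k: "k > 0" by simp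
  define v :: "real^'n \<Rightarrow> real" where "v = radial_test al k"
  have v: "v \<in> test_functions 0" unfolding v_def by (rule radial_test_test[OF k])
  define ph where "ph = profile al k"
  define ph' where "ph' = profile' al k"
  \<comment> \<open>Here al >= 3/2 makes (al - 1) bump at least c / 2, of which the derivative of
    the cutoff takes at most c / 4.\<close>
  have ph_lower: "(ph m)\<^sup>2 \<ge> (c / 4)\<^sup>2" if "- 3 * k \<le> m" "m \<le> - 2 * k" for m
  proof -
    have "- 3 \<le> m / k" "m / k \<le> - 2" using that k by (auto simp: field_simps)
    then have b: "bump (m / k) \<ge> c" by (rule K(6))
    have "\<bar>bump1 (m / k)\<bar> / k \<le> K / k" using K(4) k by (intro divide_right_mono) auto
    also have "K / k \<le> c / 4" using kB(1) K k by (simp add: field_simps)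
    finally have "\<bar>bump1 (m / k) / k\<bar> \<le> c / 4" using k by simp
    moreover have "(al - 1) * bump (m / k) \<ge> 1/2 * c"
      using al b K(2) by (intro mult_mono) auto
    moreover have "- ph m = (al - 1) * bump (m / k) - bump1 (m / k) / k"
      unfolding ph_def profile_def[OF k] by (simp add: algebra_simps)
    ultimately have "- ph m \<ge> c / 4" by linarith
    then have "(c / 4)\<^sup>2 \<le> (- ph m)\<^sup>2" using K(2) by (intro power_mono) auto
    then show ?thesis by simp
  qed
  have ph'_upper: "(ph' m)\<^sup>2 \<le> (al * K)\<^sup>2 / k\<^sup>2" for m
  proof -
    have "\<bar>(1 - al) * bump1 (m / k) / k\<bar> \<le> (al - 1) * K / k"
      using al K(4)[of "m / k"] k by (simp add: abs_mult divide_right_mono mult_left_mono)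
    moreover have "\<bar>bump2 (m / k) / k\<^sup>2\<bar> \<le> K / k"
    proof -
      have "\<bar>bump2 (m / k) / k\<^sup>2\<bar> \<le> K / k\<^sup>2" using K(5) by (simp add: divide_right_mono)
      also have "\<dots> \<le> K / k" using k1 K(1) by (intro divide_left_mono) (auto simp: power2_eq_square)
      finally show ?thesis .
    qed
    ultimately have "\<bar>ph' m\<bar> \<le> (al - 1) * K / k + K / k"
      unfolding ph'_def profile'_def[OF k] by linarith
    also have "\<dots> = al * K / k" by (simp add: left_diff_distrib diff_divide_distrib)
    finally have "\<bar>ph' m\<bar>\<^sup>2 \<le> (al * K / k)\<^sup>2" by (rule power_mono) simp
    then show ?thesis by (simp add: power_divide)
  qed
  have supp: "ph m = 0" "ph' m = 0" if "\<not> (- 4 * k \<le> m \<and> m \<le> - k)" for m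
    using profile_support[OF k, of m al] that by (auto simp: ph_def ph'_def)
  have a_cc: "cc0 (\<lambda>y. 1 / (norm y)\<^sup>2 * (dr v y)\<^sup>2)"
    by (intro cc0_weight cc0_power2 cc0_test test_dr v continuous_on_weights) auto
  have b_cc: "cc0 (\<lambda>y. (dr (dr v) y)\<^sup>2)" by (intro cc0_power2 cc0_test test_dr v)
  define D where "D y = (al\<^sup>2 + ep) * (1 / (norm y)\<^sup>2 * (dr v y)\<^sup>2) - (dr (dr v) y)\<^sup>2" for y
  have D_cc: "cc0 D" unfolding D_def[abs_def] by (intro cc0_diff cc0_cmult a_cc b_cc)
  \<comment> \<open>The gain is counted where \<open>ph\<close> is bounded below, the loss on a
    half-open range that contains the closed support [-4 k, -k]. Both ranges have integer
    length.\<close>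
  have low: "c1 * ann_fun (- 3 * k) (- 2 * k) y - c2 / k\<^sup>2 * ann_fun (- 5 * k) 0 y \<le> D y / hgt y" for y :: "real^'n"
  proof (cases "y = 0")
    case True
    have "ann_fun a b (0 :: real^'n) = 0" for a b by (simp add: ann_fun_def ann_def)
    then show ?thesis using cc0_at_0[OF D_cc] True by simp
  next
    case False
    define s where "s = norm y"
    define m where "m = ln s"
    define Q where "Q = inverse s ^ CARD('n)"
    define H where "H = hgt y"
    have s: "s > 0" using False by (simp add: s_def)
    have em: "s = exp m" using s by (simp add: m_def)
    have Q: "Q \<ge> 0" using s by (simp add: Q_def)
    have H: "H\<^sup>2 = 1 + s\<^sup>2" "H \<ge> 1" by (simp_all add: H_def s_def hgt_sq power2_norm_eq_inner hgt_ge_1)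
    have sq: "(s powr (- al - 1))\<^sup>2 = Q" using norm_powr_CARD[OF False] by (simp add: s_def al_def Q_def)
    have a: "1 / (norm y)\<^sup>2 * (dr v y)\<^sup>2 = Q * (H\<^sup>2 * (ph m)\<^sup>2)"
    proof -
      have "s powr (- al) = s powr (- al - 1) * s" using s by (simp add: powr_diff)
      then have "dr v y = H * (s powr (- al - 1) * s * ph m)"
        unfolding v_def using radial_test_derivs(1)[OF k False, of al] by (simp add: s_def m_def H_def ph_def)
      then have "(dr v y)\<^sup>2 = s\<^sup>2 * (Q * (H\<^sup>2 * (ph m)\<^sup>2))" by (simp add: power_mult_distrib sq)
      then show ?thesis using s by (simp add: s_def[symmetric])
    qed
    have b: "(dr (dr v) y)\<^sup>2 = Q * (s\<^sup>2 * ph m + (1 + s\<^sup>2) * (ph' m - al * ph m))\<^sup>2"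
      unfolding v_def radial_test_derivs(3)[OF k False] H(1)[symmetric] sq[symmetric] power_mult_distrib
      by (simp add: s_def m_def H_def ph_def ph'_def)
    have bound: "D y / H \<ge> Q * (ep / 2 * (ph m)\<^sup>2 - 4 * (1 + 1 / et) * (ph' m)\<^sup>2)"
    proof (cases "- 4 * k \<le> m \<and> m \<le> - k")
      case True
      \<comment> \<open>On the support s is at most exp (-k), so s^2 is small compared with 1 /
        k.\<close>
      have "s\<^sup>2 = exp (2 * m)" by (simp add: em power2_eq_square flip: exp_add)
      also have "\<dots> \<le> exp (- (2 * k))" using True by simp
      also have "\<dots> \<le> 1 / (2 * k)"
      proof -
        have "2 * k \<le> exp (2 * k)" using exp_ge_add_one_self[of "2 * k"] by linarith
        then show ?thesis using k by (simp add: exp_minus field_simps)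
      qed
      finally have s2k: "s\<^sup>2 \<le> 1 / (2 * k)" .
      have s21: "s\<^sup>2 \<le> 1"
      proof -
        have "1 / (2 * k) \<le> 1" using k1 by simp
        then show ?thesis using s2k by linarith
      qed
      have s2ep: "s\<^sup>2 * (al\<^sup>2 + ep / 4) \<le> ep / 4"
      proof -
        have "s\<^sup>2 * (al\<^sup>2 + ep / 4) \<le> 1 / (2 * k) * (al\<^sup>2 + ep / 4)"
          using s2k ep by (intro mult_right_mono) auto
        also have "\<dots> \<le> ep / 4" using kB(2) k ep by (simp add: field_simps)
        finally show ?thesis .
      qed
      have "H\<^sup>2 \<le> 2\<^sup>2" unfolding H(1) using s21 by simp
      then have H2: "H \<le> 2" by (rule power2_le_imp_le) simp
      \<comment> \<open>One factor H^2 is shared with (dr v)^2; the other 1 + s^2 is absorbed into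
        the excess ep.\<close>
      have "(1 + s\<^sup>2)\<^sup>2 = H\<^sup>2 * (1 + s\<^sup>2)" unfolding H(1) by (rule power2_eq_square)
      have "(s\<^sup>2 * ph m + (1 + s\<^sup>2) * (ph' m - al * ph m))\<^sup>2
          \<le> (1 + s\<^sup>2)\<^sup>2 * ((1 + et) * al\<^sup>2 * (ph m)\<^sup>2 + (1 + 1 / et) * (ph' m)\<^sup>2)"
        using al et by (intro weighted_square_bound) auto
      also have "\<dots> = H\<^sup>2 * ((al\<^sup>2 + ep / 4 + s\<^sup>2 * (al\<^sup>2 + ep / 4)) * (ph m)\<^sup>2 + (1 + s\<^sup>2) * ((1 + 1 / et) * (ph' m)\<^sup>2))"
        unfolding \<open>(1 + s\<^sup>2)\<^sup>2 = H\<^sup>2 * (1 + s\<^sup>2)\<close> et_al by (simp add: algebra_simps add_divide_distrib)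
      also have "\<dots> \<le> H\<^sup>2 * ((al\<^sup>2 + ep / 2) * (ph m)\<^sup>2 + 2 * ((1 + 1 / et) * (ph' m)\<^sup>2))"
      proof (intro mult_left_mono[OF add_mono])
        show "(al\<^sup>2 + ep / 4 + s\<^sup>2 * (al\<^sup>2 + ep / 4)) * (ph m)\<^sup>2 \<le> (al\<^sup>2 + ep / 2) * (ph m)\<^sup>2"
          by (rule mult_right_mono) (use s2ep in linarith, simp)
        have "0 \<le> (1 + 1 / et) * (ph' m)\<^sup>2" using et by simp
        then show "(1 + s\<^sup>2) * ((1 + 1 / et) * (ph' m)\<^sup>2) \<le> 2 * ((1 + 1 / et) * (ph' m)\<^sup>2)"
          by (rule mult_right_mono[rotated]) (use s21 in linarith)
      qed simp
      finally have b2: "(s\<^sup>2 * ph m + (1 + s\<^sup>2) * (ph' m - al * ph m))\<^sup>2 \<le> \<dots>" .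
      define X where "X = ep / 2 * (ph m)\<^sup>2 - 2 * ((1 + 1 / et) * (ph' m)\<^sup>2)"
      have "D y = Q * ((al\<^sup>2 + ep) * (H\<^sup>2 * (ph m)\<^sup>2) - (s\<^sup>2 * ph m + (1 + s\<^sup>2) * (ph' m - al * ph m))\<^sup>2)"
        unfolding D_def a b by (simp add: algebra_simps)
      also have "\<dots> \<ge> Q * (H\<^sup>2 * X)"
      proof (rule mult_left_mono[OF _ Q])
        have "H\<^sup>2 * X = (al\<^sup>2 + ep) * (H\<^sup>2 * (ph m)\<^sup>2) - H\<^sup>2 * ((al\<^sup>2 + ep / 2) * (ph m)\<^sup>2 + 2 * ((1 + 1 / et) * (ph' m)\<^sup>2))"
          by (simp add: X_def algebra_simps)
        then show "H\<^sup>2 * X \<le> (al\<^sup>2 + ep) * (H\<^sup>2 * (ph m)\<^sup>2) - (s\<^sup>2 * ph m + (1 + s\<^sup>2) * (ph' m - al * ph m))\<^sup>2"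
          using b2 by linarith
      qed
      finally have "D y / H \<ge> Q * (H\<^sup>2 * X) / H" using H(2) by (intro divide_right_mono) auto
      moreover have "Q * (H\<^sup>2 * X) / H = Q * (H * X)" using H(2) by (simp add: power2_eq_square)
      \<comment> \<open>Since 1 <= H <= 2, the density is estimated by 1 in the gain and by 2 in the
        loss, which gives the factor 4.\<close>
      moreover have "H * X \<ge> ep / 2 * (ph m)\<^sup>2 - 4 * (1 + 1 / et) * (ph' m)\<^sup>2"
      proof -
        have "H * (ep / 2 * (ph m)\<^sup>2) \<ge> 1 * (ep / 2 * (ph m)\<^sup>2)"
          using H(2) ep by (intro mult_right_mono) auto
        moreover have "H * (2 * ((1 + 1 / et) * (ph' m)\<^sup>2)) \<le> 2 * (2 * ((1 + 1 / et) * (ph' m)\<^sup>2))"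
          using H2 et by (intro mult_right_mono) auto
        ultimately show ?thesis unfolding X_def right_diff_distrib by linarith
      qed
      ultimately show ?thesis using mult_left_mono[OF _ Q] by fastforce
    next
      case F: False
      then have "D y = 0" unfolding D_def a b supp[OF F] by simp
      then show ?thesis using supp[OF F] by simp
    qed
    have ann1: "ann_fun a b y = indicator {a..<b} m * Q" for a b
    proof -
      have "y \<in> ann a b \<longleftrightarrow> m \<in> {a..<b}" by (simp add: ann_def s_def[symmetric] em)
      then show ?thesis by (simp add: ann_fun_def Q_def s_def indicator_def)
    qed
    have l1: "c1 * indicator {- 3 * k..<- 2 * k} m \<le> ep / 2 * (ph m)\<^sup>2"
      using ph_lower[of m] ep by (cases "m \<in> {- 3 * k..<- 2 * k}") (auto simp: c1_def)
    have l2: "4 * (1 + 1 / et) * (ph' m)\<^sup>2 \<le> c2 / k\<^sup>2 * indicator {- 5 * k..<0} m"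
    proof (cases "- 4 * k \<le> m \<and> m \<le> - k")
      case True
      then have "m \<in> {- 5 * k..<0}" using k by auto
      moreover have "4 * (1 + 1 / et) * (ph' m)\<^sup>2 \<le> 4 * (1 + 1 / et) * ((al * K)\<^sup>2 / k\<^sup>2)"
        using ph'_upper et by (intro mult_left_mono) auto
      ultimately show ?thesis by (simp add: c2_def)
    next
      case F: False
      then show ?thesis using supp(2)[OF F] c2 by (simp add: indicator_def)
    qed
    have "c1 * ann_fun (- 3 * k) (- 2 * k) y - c2 / k\<^sup>2 * ann_fun (- 5 * k) 0 y
        = Q * (c1 * indicator {- 3 * k..<- 2 * k} m - c2 / k\<^sup>2 * indicator {- 5 * k..<0} m)"
      unfolding ann1 by (simp add: algebra_simps)
    also have "\<dots> \<le> Q * (ep / 2 * (ph m)\<^sup>2 - 4 * (1 + 1 / et) * (ph' m)\<^sup>2)"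
      using l1 l2 Q by (intro mult_left_mono) auto
    also have "\<dots> \<le> D y / hgt y" using bound by (simp add: H_def)
    finally show ?thesis .
  qed
  define V where "V = (LINT y|lborel. ann_fun 0 1 (y :: real^'n))"
  have V: "V > 0" unfolding V_def by (rule ann_fun_pos)
  have len1: "(LINT y|lborel. ann_fun (- 3 * k) (- 2 * k) (y :: real^'n)) = k * V"
    using ann_fun_length[of "- 3 * k" n] by (simp add: k_def V_def)
  have len2: "(LINT y|lborel. ann_fun (- 5 * k) 0 (y :: real^'n)) = 5 * k * V"
    using ann_fun_length[of "- 5 * k" "5 * n"] by (simp add: k_def V_def)
  have "0 < (c1 * k - 5 * c2 / k) * V"
  proof -
    have "5 * c2 / c1 < k * k" using kB(3) k1 c1 c2 mult_strict_mono[of 1 k k k] by (simp add: less_trans)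
    then have "5 * c2 < c1 * k * k" using c1 by (simp add: field_simps)
    then have "5 * c2 / k < c1 * k" using k by (simp add: field_simps)
    then show ?thesis using V by simp
  qed
  also have "\<dots> = c1 * (k * V) - c2 / k\<^sup>2 * (5 * k * V)"
    using k by (simp add: power2_eq_square field_simps)
  also have "\<dots> = c1 * (LINT y|lborel. ann_fun (- 3 * k) (- 2 * k) (y :: real^'n))
      - c2 / k\<^sup>2 * (LINT y|lborel. ann_fun (- 5 * k) 0 (y :: real^'n))"
    unfolding len1 len2 ..
  also have "\<dots> = (LINT y|lborel. c1 * ann_fun (- 3 * k) (- 2 * k) (y :: real^'n) - c2 / k\<^sup>2 * ann_fun (- 5 * k) 0 y)"
    by (subst Bochner_Integration.integral_diff)
      (simp_all only: integral_mult_right_zero integrable_mult_right[OF ann_fun_integrable])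
  also have "\<dots> \<le> hyp_int D"
    unfolding hyp_int_def
    by (intro integral_mono low cc0_integrable D_cc Bochner_Integration.integrable_diff
        integrable_mult_right ann_fun_integrable)
  also have "hyp_int D = (al\<^sup>2 + ep) * hyp_int (\<lambda>y. 1 / (norm y)\<^sup>2 * (dr v y)\<^sup>2) - hyp_int (\<lambda>y. (dr (dr v) y)\<^sup>2)"
    unfolding D_def[abs_def] by (simp only: hyp_int_diff hyp_int_cmult cc0_cmult a_cc b_cc)
  finally show ?thesis
    using radial_test_derivs(2)[OF k] by (intro that[OF v]) (auto simp: al_def v_def)
qed

lemma sinh_ge_self:
  assumes "0 \<le> s"
  shows "s \<le> sinh (s::real)"
proof -
  have "sinh 0 - 0 \<le> sinh s - s"
  proof (rule DERIV_nonneg_imp_nondecreasing[OF assms, of "\<lambda>s. sinh s - s"])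
    show "\<exists>d. ((\<lambda>s. sinh s - s) has_real_derivative d) (at x) \<and> 0 \<le> d" for x :: real
      by (rule exI[of _ "cosh x - 1"]) (auto intro!: derivative_eq_intros simp: cosh_real_ge_1)
  qed
  then show ?thesis by simp
qed

lemma mult_coth_ge_1:
  assumes "0 < s"
  shows "1 \<le> s * coth s"
proof -
  have "0 * cosh 0 - sinh 0 \<le> s * cosh s - sinh s"
  proof (rule DERIV_nonneg_imp_nondecreasing[of 0 s "\<lambda>s. s * cosh s - sinh s"])
    show "\<exists>d. ((\<lambda>s. s * cosh s - sinh s) has_real_derivative d) (at x) \<and> 0 \<le> d" if "0 \<le> x" for x :: real
      by (rule exI[of _ "x * sinh x"]) (use that in \<open>auto intro!: derivative_eq_intros\<close>)
  qed (use assms in auto)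
  then show ?thesis using assms by (simp add: coth_def field_simps)
qed

theorem theorem2p2:
  fixes x0 :: "real^'n" and l :: real
    and N :: nat and r :: "real^'n \<Rightarrow> real"
  defines "N \<equiv> CARD('n)"
    and "r \<equiv> (\<lambda>x. hyp_dist x x0)"
  assumes "N \<ge> 5" and "0 \<le> l" and "l \<le> ((real N - 1) / 2)\<^sup>2"
  shows
    "(\<forall>u\<in>test_functions x0.
        (LINT x|hyp_vol. (hyp_laplacian u x)\<^sup>2)
        \<ge> l * (LINT x|hyp_vol. hyp_grad2 u x)
          + (hN N l)\<^sup>2 * (LINT x|hyp_vol. hyp_grad2 u x / (r x)\<^sup>2)
          + ((real N / 2)\<^sup>2 - (hN N l)\<^sup>2) * (LINT x|hyp_vol. hyp_grad2 u x / (sinh (r x))\<^sup>2)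
          + gammaN N l * hN N l
            * (LINT x|hyp_vol. (r x * coth (r x) - 1) / (r x)\<^sup>2 * hyp_grad2 u x)
          + (LINT x|hyp_vol. (Psi N l (r x))\<^sup>2
                * hyp_grad2 (\<lambda>y. radial_deriv x0 u y / Psi N l (r y)) x))
     \<and> (\<forall>C > (real N / 2)\<^sup>2 - (hN N l)\<^sup>2. \<exists>u\<in>test_functions x0.
        \<not> ((LINT x|hyp_vol. (hyp_laplacian u x)\<^sup>2)
           \<ge> l * (LINT x|hyp_vol. hyp_grad2 u x)
             + (hN N l)\<^sup>2 * (LINT x|hyp_vol. hyp_grad2 u x / (r x)\<^sup>2)
             + C * (LINT x|hyp_vol. hyp_grad2 u x / (sinh (r x))\<^sup>2)
             + gammaN N l * hN N l
               * (LINT x|hyp_vol. (r x * coth (r x) - 1) / (r x)\<^sup>2 * hyp_grad2 u x)))"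
proof -
  obtain e t where e: "norm e = 1" and p: "boost e t x0 = 0"
    by (rule pole_boost_exists)
  show ?thesis
  proof (intro conjI ballI allI impI)
    fix u assume u: "u \<in> test_functions x0"
    define v where "v y = u (boost e (- t) y)" for y
    have v: "v \<in> test_functions 0"
      using test_functions_boost[OF e u, of "- t"] by (simp add: v_def[abs_def] p)
    have uv: "u = (\<lambda>x. v (boost e t x))"
      by (simp add: v_def boost_inverse[OF e])
    show "l * (LINT x|hyp_vol. hyp_grad2 u x)
          + (hN N l)\<^sup>2 * (LINT x|hyp_vol. hyp_grad2 u x / (r x)\<^sup>2)
          + ((real N / 2)\<^sup>2 - (hN N l)\<^sup>2) * (LINT x|hyp_vol. hyp_grad2 u x / (sinh (r x))\<^sup>2)
          + gammaN N l * hN N l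
            * (LINT x|hyp_vol. (r x * coth (r x) - 1) / (r x)\<^sup>2 * hyp_grad2 u x)
          + (LINT x|hyp_vol. (Psi N l (r x))\<^sup>2
                * hyp_grad2 (\<lambda>y. radial_deriv x0 u y / Psi N l (r y)) x)
        \<le> (LINT x|hyp_vol. (hyp_laplacian u x)\<^sup>2)"
      unfolding uv r_def pulled_back_integrals[OF v e p]
      using rellich_at_pole[OF v] assms(3,5) unfolding N_def by blast
  next
    fix C assume C: "C > (real N / 2)\<^sup>2 - (hN N l)\<^sup>2"
    \<comment> \<open>Measured on top of ((N-2)/2)^2, the same excess is what
      \<open>sharp_at_pole\<close> contradicts.\<close>
    define ep where "ep = C - ((real N / 2)\<^sup>2 - (hN N l)\<^sup>2)"
    have ep: "ep > 0" using C by (simp add: ep_def)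
    obtain v :: "real^'n \<Rightarrow> real" where v: "v \<in> test_functions 0"
      "\<And>j y. y \<noteq> 0 \<Longrightarrow> ang j v y = 0"
      "hyp_int (\<lambda>y. (dr (dr v) y)\<^sup>2) < (((real CARD('n) - 2) / 2)\<^sup>2 + ep) * hyp_int (\<lambda>y. 1 / (norm y)\<^sup>2 * (dr v y)\<^sup>2)"
      using sharp_at_pole[OF _ ep] assms(3) unfolding N_def by blast
    let ?u = "\<lambda>x. v (boost e t x)"
    define A where "A = hyp_int (\<lambda>y. 1 / (norm y)\<^sup>2 * (dr v y)\<^sup>2)"
    have u: "?u \<in> test_functions x0" by (rule pulled_back_test[OF v(1) e p])
    have g: "hyp_grad2 v y = (dr v y)\<^sup>2" if "y \<noteq> 0" for y
      using hyp_grad2_polar[OF that, of v] v(2)[OF that] by simp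
    note cc = c1_cc0[OF c1_hyp_grad2[OF v(1)]]
      c1_cc0[OF c1_radial_hyp_grad2[OF v(1) inverse_square_weight]]
      c1_cc0[OF c1_radial_hyp_grad2[OF v(1) radial_weight_derivs(1) continuous_on_radial_weights(2)]]
      c1_cc0[OF c1_radial_hyp_grad2[OF v(1) coth_weight]]
    have cA: "cc0 (\<lambda>y. 1 / (norm y)\<^sup>2 * (dr v y)\<^sup>2)"
      by (intro cc0_weight cc0_power2 cc0_test test_dr v continuous_on_weights) auto
    have cb: "cc0 (\<lambda>y. (dr (dr v) y)\<^sup>2)" by (intro cc0_power2 cc0_test test_dr v)
    have A3: "hyp_int (\<lambda>y. 1 / (sinh (rad y))\<^sup>2 * hyp_grad2 v y) = A"
      unfolding A_def
    proof (rule hyp_int_cong[OF cc(3) cA])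
      fix y :: "real^'n" assume y: "y \<noteq> 0"
      show "1 / (sinh (rad y))\<^sup>2 * hyp_grad2 v y = 1 / (norm y)\<^sup>2 * (dr v y)\<^sup>2"
        unfolding g[OF y] by simp
    qed
    have A1: "hyp_int (hyp_grad2 v) \<ge> 0"
    proof (rule hyp_int_nonneg[OF _ cc(1)])
      fix y :: "real^'n" assume y: "y \<noteq> 0"
      show "0 \<le> hyp_grad2 v y" unfolding g[OF y] by simp
    qed
    \<comment> \<open>As r <= sinh r, the 1/r^2 integral is at least the 1/sinh^2 integral, so a
      single quantity A bounds both critical terms.\<close>
    have A2: "hyp_int (\<lambda>y. 1 / (rad y)\<^sup>2 * hyp_grad2 v y) \<ge> A"
      unfolding A_def
    proof (rule hyp_int_mono[OF cA cc(2)])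
      fix y :: "real^'n" assume y: "y \<noteq> 0"
      have "rad y \<le> norm y"
        using sinh_hyp_dist_zero[of y] hyp_dist_zero_nonneg[of y] sinh_ge_self by metis
      then show "1 / (norm y)\<^sup>2 * (dr v y)\<^sup>2 \<le> 1 / (rad y)\<^sup>2 * hyp_grad2 v y"
        unfolding g[OF y] using hyp_dist_zero_pos[OF y] y
        by (intro mult_right_mono divide_left_mono power_mono) auto
    qed
    have A4: "hyp_int (\<lambda>y. (rad y * coth (rad y) - 1) / (rad y)\<^sup>2 * hyp_grad2 v y) \<ge> 0"
    proof (rule hyp_int_nonneg[OF _ cc(4)])
      fix y :: "real^'n" assume y: "y \<noteq> 0"
      show "0 \<le> (rad y * coth (rad y) - 1) / (rad y)\<^sup>2 * hyp_grad2 v y"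
        unfolding g[OF y] using mult_coth_ge_1[OF hyp_dist_zero_pos[OF y]] by simp
    qed
    \<comment> \<open>v has no angular derivatives, so the expansion of the squared Laplacian
      reduces to \<open>radial_laplacian_int_zero\<close>.\<close>
    have lap: "hyp_int (\<lambda>y. (hyp_laplacian v y)\<^sup>2) = hyp_int (\<lambda>y. (dr (dr v) y)\<^sup>2) + (real N - 1) * A"
    proof -
      have "hyp_int (\<lambda>y. (hyp_laplacian v y)\<^sup>2)
          = hyp_int (\<lambda>y. (dr (dr v) y + (real CARD('n) - 1) * (hgt y / norm y) * dr v y)\<^sup>2)"
      proof (rule hyp_int_cong)
        show "cc0 (\<lambda>y. (hyp_laplacian v y)\<^sup>2)"
          by (intro cc0_power2 cc0_test hyp_laplacian_test v)
        show "cc0 (\<lambda>y. (dr (dr v) y + (real CARD('n) - 1) * (hgt y / norm y) * dr v y)\<^sup>2)"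
          by (intro cc0_power2 cc0_add cc0_weight cc0_test test_dr v continuous_on_weights) auto
        fix y :: "real^'n" assume y: "y \<noteq> 0"
        have "ang j (ang j v) y = ang j (\<lambda>_. 0) y" for j
          by (rule ang_cong_open[OF open_Compl_0]) (use y v(2) in auto)
        then have "ang j (ang j v) y = 0" for j by (simp add: ang_def euler_def)
        then show "(hyp_laplacian v y)\<^sup>2
            = (dr (dr v) y + (real CARD('n) - 1) * (hgt y / norm y) * dr v y)\<^sup>2"
          by (simp add: hyp_laplacian_polar[OF test_smooth[OF v(1)] y])
      qed
      also have "\<dots> = hyp_int (\<lambda>y. (dr (dr v) y)\<^sup>2 + (real CARD('n) - 1) * (1 / (norm y)\<^sup>2 * (dr v y)\<^sup>2))"
      proof -
        have c1: "cc0 (\<lambda>y. (dr (dr v) y + (real CARD('n) - 1) * (hgt y / norm y) * dr v y)\<^sup>2)"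
          by (intro cc0_power2 cc0_add cc0_weight cc0_test test_dr v continuous_on_weights) auto
        have c2: "cc0 (\<lambda>y. (dr (dr v) y)\<^sup>2 + (real CARD('n) - 1) * (1 / (norm y)\<^sup>2 * (dr v y)\<^sup>2))"
          by (intro cc0_add cc0_cmult cA cb)
        show ?thesis
          using radial_laplacian_int_zero[OF v(1)] hyp_int_diff[OF c1 c2] by (simp add: int_zero_def)
      qed
      also have "\<dots> = hyp_int (\<lambda>y. (dr (dr v) y)\<^sup>2) + (real N - 1) * A"
        unfolding A_def N_def by (simp only: hyp_int_add hyp_int_cmult cc0_cmult cA cb)
      finally show ?thesis .
    qed
    have "gammaN N l \<ge> 0" "hN N l \<ge> 0"
    proof -
      have "4 * l \<le> (real N - 1)\<^sup>2" using assms(5) by (simp add: power_divide)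
      then show "gammaN N l \<ge> 0" by (simp add: gammaN_def)
      then show "hN N l \<ge> 0" by (simp add: hN_def)
    qed
    \<comment> \<open>Only the terms with hN^2 and with C are kept; their coefficients add up to
      (N/2)^2 + ep, from which hN has disappeared.\<close>
    then have "0 + (hN N l)\<^sup>2 * A + C * A + 0
        \<le> l * hyp_int (hyp_grad2 v) + (hN N l)\<^sup>2 * hyp_int (\<lambda>y. 1 / (rad y)\<^sup>2 * hyp_grad2 v y) + C * A
          + gammaN N l * hN N l * hyp_int (\<lambda>y. (rad y * coth (rad y) - 1) / (rad y)\<^sup>2 * hyp_grad2 v y)"
      using assms(4) A1 A4
      by (intro add_mono order_refl[of "C * A"] mult_left_mono[OF A2] mult_nonneg_nonneg) auto
    moreover have "hyp_int (\<lambda>y. (hyp_laplacian v y)\<^sup>2) < (hN N l)\<^sup>2 * A + C * A"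
    proof -
      have "((real N - 2) / 2)\<^sup>2 + (real N - 1) = (real N / 2)\<^sup>2"
        by (simp add: power2_eq_square field_simps)
      then have "(hN N l)\<^sup>2 * A + C * A = (((real N - 2) / 2)\<^sup>2 + ep) * A + (real N - 1) * A"
        by (simp add: ep_def flip: distrib_right)
      then show ?thesis using v(3) unfolding lap A_def[symmetric] N_def by linarith
    qed
    ultimately have "\<not> (hyp_int (\<lambda>y. (hyp_laplacian v y)\<^sup>2)
        \<ge> l * hyp_int (hyp_grad2 v) + (hN N l)\<^sup>2 * hyp_int (\<lambda>y. 1 / (rad y)\<^sup>2 * hyp_grad2 v y)
          + C * hyp_int (\<lambda>y. 1 / (sinh (rad y))\<^sup>2 * hyp_grad2 v y)
          + gammaN N l * hN N l * hyp_int (\<lambda>y. (rad y * coth (rad y) - 1) / (rad y)\<^sup>2 * hyp_grad2 v y))"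
      unfolding A3 by linarith
    then show "\<exists>u\<in>test_functions x0.
        \<not> ((LINT x|hyp_vol. (hyp_laplacian u x)\<^sup>2)
           \<ge> l * (LINT x|hyp_vol. hyp_grad2 u x)
             + (hN N l)\<^sup>2 * (LINT x|hyp_vol. hyp_grad2 u x / (r x)\<^sup>2)
             + C * (LINT x|hyp_vol. hyp_grad2 u x / (sinh (r x))\<^sup>2)
             + gammaN N l * hN N l
               * (LINT x|hyp_vol. (r x * coth (r x) - 1) / (r x)\<^sup>2 * hyp_grad2 u x))"
      unfolding r_def pulled_back_integrals[OF v(1) e p, symmetric] by (rule bexI[OF _ u])
  qed
qed

end
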